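(* Let $\mathcal K$ be a Hilbert space, $(\mathcal A,(\|\cdot\|_j)_{j\in\mathbb N})$ a submultiplicative $\Psi^*$-algebra in $\mathcal L(\mathcal K)$ with $\|\cdot\|_1=\|\cdot\|_{\mathcal L(\mathcal K)}$, and $\mathfrak T$ a finite set of densely defined, closed, symmetric operators $T:\mathcal K\supseteq\mathcal D(T)\to\mathcal K$. Let $\Psi^\infty(\mathfrak T)$ and $\mathcal J_k(\mathfrak T)$ be the associated spaces defined in the context, with their topologies. Then for every $k\in\mathbb N_0\cup\{\infty\}$: (a) $\mathcal J_k(\mathfrak T)$, with its defining system of norms, is a submultiplicative Fréchet algebra, and the canonical embedding $\mathcal J_k(\mathfrak T)\hookrightarrow\mathcal J_0(\mathfrak T)$ is continuous. (b) $\Psi^\infty(\mathfrak T)\,\mathcal J_k(\mathfrak T)\subseteq\mathcal J_k(\mathfrak T)$ and $\mathcal J_k(\mathfrak T)\,\Psi^\infty(\mathfrak T)\subseteq\mathcal J_k(\mathfrak T)$, and the two bilinear multiplication maps $\Psi^\infty(\mathfrak T)\times\mathcal J_k(\mathfrak T)\to\mathcal J_k(\mathfrak T)$ and $\mathcal J_k(\mathfrak T)\times\Psi^\infty(\mathfrak T)\to\mathcal J_k(\mathfrak T)$ are jointly continuous. (c) $\mathcal J_k(\mathfrak T)$ is a semi-ideal in $\mathcal A$; in particular, $\mathcal J_k(\mathfrak T)$ is closed under the holomorphic functional calculus in $\mathcal L(\mathcal K)$. Moreover, the map $\mathcal J_k(\mathfrak T)\times\mathcal A\times\mathcal J_k(\mathfrak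 T)\to\mathcal J_k(\mathfrak T)$, $(x,a,y)\mapsto xay$, is jointly continuous.
   Context: $\Psi^*$-algebra: for a unital $C^*$-algebra $\mathcal B$, a symmetric subalgebra $\mathcal A\subseteq\mathcal B$ with $e\in\mathcal A$ and $\mathcal A\cap\mathcal B^{-1}=\mathcal A^{-1}$ that carries a Fréchet algebra topology making $\mathcal A\hookrightarrow\mathcal B$ continuous. A Fréchet algebra is submultiplicative if its topology is generated by a countable system of semi-norms $q$ with $q(xy)\le q(x)q(y)$ (and $q(e)=1$ in the unital case). A subspace $J$ of a unital algebra $B$ is a semi-ideal in $B$ if $xby\in J$ for all $x,y\in J$, $b\in B$. A (not necessarily unital) subalgebra $A$ of a Banach algebra $\mathcal B$ with unit $e$ is closed under the holomorphic functional calculus in $\mathcal B$ if for every $a\in\mathbb C e+A$ and every $f$ holomorphic near the spectrum $\sigma_{\mathcal B}(a)$ one has $f(a)\in\mathbb C e+A$. Derivations: for $T\in\mathfrak T$, $\mathcal D(\delta_T)$ is the set of $a\in\mathcal A$ such that $a(\mathcal D(T))\subseteq\mathcal D(T)$ and there is $\delta_T(a)\in\mathcal A$ with $\delta_T(a)\varphi=i(Ta\varphi-aT\varphi)$ for all $\varphi\in\mathcal D(T)$, and the same holds with $a$ replaced by $a^*$. Put $\Psi^0(\mathfrak T)=\mathcal A$, $\Psi^1(\mathfrak T)=\bigcap_{T\in\mathfrak T}\mathcal D(\delta_T)$, and for $r\ge2$, $\Psi^r(\mathfrak T)=\{a\in\Psi^{r-1}(\mathfrak T):\delta_T(a)\in\Psi^{r-1}(\mathfrak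 T)\ \forall T\in\mathfrak T\}$; $\Psi^\infty(\mathfrak T)=\bigcap_r\Psi^r(\mathfrak T)$ with the topology of the semi-norms $q_{r,j}$, where $q_{0,j}(a)=\|a\|_j$ and $q_{r,j}(a)=q_{r-1,j}(a)+\sum_{T}q_{r-1,j}(\delta_T(a))$. Semi-ideals: $\mathcal J_0(\mathfrak T):=\mathcal A$. $\mathcal J_1(\mathfrak T)$ is the space of all $x\in\mathcal J_0(\mathfrak T)$ such that for all $T,T_1,T_2\in\mathfrak T$: (i) $x(\mathcal K)\subseteq\mathcal D(T)$ and $\omega_T^\ell(x):=Tx\in\mathcal J_0(\mathfrak T)$; (ii) there is $\omega_T^r(x)\in\mathcal J_0(\mathfrak T)$ with $\omega_T^r(x)f=xTf$ for all $f\in\mathcal D(T)$; (iii) $x(\mathcal K)\subseteq\mathcal D(T_1)$ and there is $\omega^{\ell,r}_{T_1,T_2}(x)\in\mathcal J_0(\mathfrak T)$ with $\omega^{\ell,r}_{T_1,T_2}(x)f=T_1xT_2f$ for all $f\in\mathcal D(T_2)$. Inductively $\mathcal J_{k+1}(\mathfrak T)$ is the space of $x\in\mathcal J_k(\mathfrak T)$ such that $\omega_T^\ell(x),\omega_T^r(x),\omega^{\ell,r}_{T_1,T_2}(x)\in\mathcal J_k(\mathfrak T)$ for all $T,T_1,T_2\in\mathfrak T$. Norms: $p_{j,0}(x)=\|x\|_j$ and $p_{j,k+1}(x)=p_{j,k}(x)+\sum_T\big(p_{j,k}(\omega_T^\ell(x))+p_{j,k}(\omega_T^r(x))\big)+\sum_{T_1,T_2}p_{j,k}(\omega^{\ell,r}_{T_1,T_2}(x))$.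 For finite $k$, $\mathcal J_k(\mathfrak T)$ carries the system $(p_{j,k})_j$; $\mathcal J_\infty(\mathfrak T)=\bigcap_k\mathcal J_k(\mathfrak T)$ carries the system $(p_{j,k})_{j,k}$. *)

theory Defs
  imports "HOL-Complex_Analysis.Complex_Analysis" "HOL-Library.Extended_Nat"
begin

section \<open>Complex Hilbert spaces and bounded operators\<close>

text \<open>The real inner product underlying the norm is required to be the real part of a complex
  one, so the norm is the one induced by \<open>cinner\<close>.\<close>

class complex_hilbert = real_inner + complete_space +
  fixes scaleC :: "complex \<Rightarrow> 'a \<Rightarrow> 'a" (infixr \<open>*\<^sub>C\<close> 75)
    and cinner :: "'a \<Rightarrow> 'a \<Rightarrow> complex"
  assumes scaleC_add_right: "c *\<^sub>C (x + y) = c *\<^sub>C x + c *\<^sub>C y"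
    and scaleC_add_left: "(c + d) *\<^sub>C x = c *\<^sub>C x + d *\<^sub>C x"
    and scaleC_scaleC: "c *\<^sub>C d *\<^sub>C x = (c * d) *\<^sub>C x"
    and scaleC_of_real: "complex_of_real r *\<^sub>C x = r *\<^sub>R x"
    and cinner_commute: "cinner x y = cnj (cinner y x)"
    and cinner_add_left: "cinner (x + y) z = cinner x z + cinner y z"
    and cinner_scaleC_left: "cinner (c *\<^sub>C x) y = c * cinner x y"
    and inner_eq_Re_cinner: "inner x y = Re (cinner x y)"

text \<open>The library's bounded operators are real-linear; \<open>L(K)\<close> is the algebra of the
  complex-linear ones. Their operator norm is the norm of the ambient type.\<close>

definition cblin :: "('k::complex_hilbert \<Rightarrow>\<^sub>L 'k) set" where
  "cblin = {a. \<forall>c x. blinfun_apply a (c *\<^sub>C x) = c *\<^sub>C blinfun_apply a x}"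

definition scalar_op :: "complex \<Rightarrow> ('k::complex_hilbert \<Rightarrow>\<^sub>L 'k)" where
  "scalar_op c = Blinfun (\<lambda>x. c *\<^sub>C x)"

definition cadj :: "('k::complex_hilbert \<Rightarrow>\<^sub>L 'k) \<Rightarrow> ('k \<Rightarrow>\<^sub>L 'k)" where
  "cadj a = (THE b. \<forall>x y. cinner (blinfun_apply a x) y = cinner x (blinfun_apply b y))"

definition op_subspace :: "('k::complex_hilbert \<Rightarrow>\<^sub>L 'k) set \<Rightarrow> bool" where
  "op_subspace V \<longleftrightarrow> V \<subseteq> cblin \<and> 0 \<in> V \<and> (\<forall>x\<in>V. \<forall>y\<in>V. x + y \<in> V) \<and>
     (\<forall>c. \<forall>x\<in>V. (scalar_op c o\<^sub>L x) \<in> V)"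

definition op_subalgebra :: "('k::complex_hilbert \<Rightarrow>\<^sub>L 'k) set \<Rightarrow> bool" where
  "op_subalgebra V \<longleftrightarrow> op_subspace V \<and> (\<forall>x\<in>V. \<forall>y\<in>V. (x o\<^sub>L y) \<in> V)"

definition units_in :: "('k::complex_hilbert \<Rightarrow>\<^sub>L 'k) set \<Rightarrow> ('k \<Rightarrow>\<^sub>L 'k) set" where
  "units_in B = {a\<in>B. \<exists>b\<in>B. (a o\<^sub>L b) = id_blinfun \<and> (b o\<^sub>L a) = id_blinfun}"


section \<open>Frechet algebras of operators\<close>

definition seminorm_on ::
  "('k::complex_hilbert \<Rightarrow>\<^sub>L 'k) set \<Rightarrow> (('k \<Rightarrow>\<^sub>L 'k) \<Rightarrow> real) \<Rightarrow> bool" where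
  "seminorm_on V q \<longleftrightarrow> (\<forall>x\<in>V. 0 \<le> q x) \<and> (\<forall>x\<in>V. \<forall>y\<in>V. q (x + y) \<le> q x + q y) \<and>
     (\<forall>c. \<forall>x\<in>V. q (scalar_op c o\<^sub>L x) = cmod c * q x)"

definition seminorm_topology ::
  "('k::complex_hilbert \<Rightarrow>\<^sub>L 'k) set \<Rightarrow> 'i set \<Rightarrow> ('i \<Rightarrow> ('k \<Rightarrow>\<^sub>L 'k) \<Rightarrow> real)
     \<Rightarrow> ('k \<Rightarrow>\<^sub>L 'k) topology" where
  "seminorm_topology V I q =
     topology_generated_by {{y\<in>V. q i (y - x) < r} | i x r. i \<in> I \<and> x \<in> V \<and> 0 < r}"

lemma topspace_seminorm_topology:
  assumes "I \<noteq> {}"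
  shows "topspace (seminorm_topology V I q) = V"
proof -
  obtain i where "i \<in> I" using assms by blast
  have "x \<in> topspace (seminorm_topology V I q)" if "x \<in> V" for x
  proof -
    have "x \<in> {y\<in>V. q i (y - x) < \<bar>q i 0\<bar> + 1}" using that by auto
    moreover have "0 < \<bar>q i 0\<bar> + 1" by linarith
    ultimately show ?thesis
      unfolding seminorm_topology_def topology_generated_by_topspace
      using \<open>i \<in> I\<close> that by blast
  qed
  moreover have "topspace (seminorm_topology V I q) \<subseteq> V"
    unfolding seminorm_topology_def topology_generated_by_topspace by blast
  ultimately show ?thesis by blast
qed

text \<open>Repetitions are allowed, so indexing countable systems by \<open>nat\<close> is no restriction.\<close>

definition frechet_space ::
  "('k::complex_hilbert \<Rightarrow>\<^sub>L 'k) set \<Rightarrow> ('k \<Rightarrow>\<^sub>L 'k) topology \<Rightarrow> bool" where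
  "frechet_space V X \<longleftrightarrow> op_subspace V \<and>
     (\<exists>q :: nat \<Rightarrow> ('k \<Rightarrow>\<^sub>L 'k) \<Rightarrow> real.
        X = seminorm_topology V UNIV q \<and>
        (\<forall>i. seminorm_on V (q i)) \<and>
        (\<forall>x\<in>V. (\<forall>i. q i x = 0) \<longrightarrow> x = 0) \<and>
        (\<forall>s :: nat \<Rightarrow> ('k \<Rightarrow>\<^sub>L 'k).
           (\<forall>n. s n \<in> V) \<and> (\<forall>i. \<forall>e>0. \<exists>N. \<forall>m\<ge>N. \<forall>n\<ge>N. q i (s m - s n) < e) \<longrightarrow>
           (\<exists>x\<in>V. \<forall>i. (\<lambda>n. q i (s n - x)) \<longlonglongrightarrow> 0)))"

definition frechet_algebra ::
  "('k::complex_hilbert \<Rightarrow>\<^sub>L 'k) set \<Rightarrow> ('k \<Rightarrow>\<^sub>L 'k) topology \<Rightarrow> bool" where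
  "frechet_algebra V X \<longleftrightarrow> op_subalgebra V \<and> frechet_space V X \<and>
     continuous_map (prod_topology X X) X (\<lambda>(x, y). x o\<^sub>L y)"

definition submult_seminorms ::
  "('k::complex_hilbert \<Rightarrow>\<^sub>L 'k) set \<Rightarrow> 'i set \<Rightarrow> ('i \<Rightarrow> ('k \<Rightarrow>\<^sub>L 'k) \<Rightarrow> real) \<Rightarrow> bool" where
  "submult_seminorms V I q \<longleftrightarrow> countable I \<and> I \<noteq> {} \<and>
     (\<forall>i\<in>I. seminorm_on V (q i) \<and> (\<forall>x\<in>V. \<forall>y\<in>V. q i (x o\<^sub>L y) \<le> q i x * q i y))"

text \<open>The unital case of the normalisation: the unit meant is that of the algebra \<open>V\<close> itself,
  which need not be the identity operator; the zero algebra is exempt.\<close>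

definition unit_normalized ::
  "('k::complex_hilbert \<Rightarrow>\<^sub>L 'k) set \<Rightarrow> 'i set \<Rightarrow> ('i \<Rightarrow> ('k \<Rightarrow>\<^sub>L 'k) \<Rightarrow> real) \<Rightarrow> bool" where
  "unit_normalized V I q \<longleftrightarrow>
     (\<forall>u\<in>V. u \<noteq> 0 \<and> (\<forall>x\<in>V. (u o\<^sub>L x) = x \<and> (x o\<^sub>L u) = x) \<longrightarrow> (\<forall>i\<in>I. q i u = 1))"

definition submult_frechet_algebra ::
  "('k::complex_hilbert \<Rightarrow>\<^sub>L 'k) set \<Rightarrow> ('k \<Rightarrow>\<^sub>L 'k) topology \<Rightarrow> bool" where
  "submult_frechet_algebra V X \<longleftrightarrow> frechet_algebra V X \<and>
     (\<exists>q :: nat \<Rightarrow> ('k \<Rightarrow>\<^sub>L 'k) \<Rightarrow> real.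
        submult_seminorms V UNIV q \<and> unit_normalized V UNIV q \<and> X = seminorm_topology V UNIV q)"

definition psi_star_algebra ::
  "('k::complex_hilbert \<Rightarrow>\<^sub>L 'k) set \<Rightarrow> ('k \<Rightarrow>\<^sub>L 'k) topology \<Rightarrow> bool" where
  "psi_star_algebra A X \<longleftrightarrow>
     op_subalgebra A \<and> id_blinfun \<in> A \<and> (\<forall>a\<in>A. cadj a \<in> A) \<and>
     A \<inter> units_in cblin = units_in A \<and>
     frechet_algebra A X \<and> continuous_map X euclidean (\<lambda>a. a)"

definition submult_psi_star_algebra ::
  "('k::complex_hilbert \<Rightarrow>\<^sub>L 'k) set \<Rightarrow> 'i set \<Rightarrow> ('i \<Rightarrow> ('k \<Rightarrow>\<^sub>L 'k) \<Rightarrow> real) \<Rightarrow> bool" where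
  "submult_psi_star_algebra A I q \<longleftrightarrow> psi_star_algebra A (seminorm_topology A I q) \<and>
     submult_seminorms A I q \<and> unit_normalized A I q"

definition semi_ideal ::
  "('k::complex_hilbert \<Rightarrow>\<^sub>L 'k) set \<Rightarrow> ('k \<Rightarrow>\<^sub>L 'k) set \<Rightarrow> bool" where
  "semi_ideal B J \<longleftrightarrow> op_subspace J \<and> J \<subseteq> B \<and>
     (\<forall>x\<in>J. \<forall>y\<in>J. \<forall>b\<in>B. (x o\<^sub>L b o\<^sub>L y) \<in> J)"


section \<open>Holomorphic functional calculus\<close>

definition op_spectrum :: "('k::complex_hilbert \<Rightarrow>\<^sub>L 'k) \<Rightarrow> complex set" where
  "op_spectrum a = {z. scalar_op z - a \<notin> units_in cblin}"

definition op_resolvent :: "('k::complex_hilbert \<Rightarrow>\<^sub>L 'k) \<Rightarrow> complex \<Rightarrow> ('k \<Rightarrow>\<^sub>L 'k)" where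
  "op_resolvent a z = (THE b. b \<in> cblin \<and>
     ((scalar_op z - a) o\<^sub>L b) = id_blinfun \<and> (b o\<^sub>L (scalar_op z - a)) = id_blinfun)"

text \<open>Cycles are finite lists of closed piecewise continuously differentiable paths.\<close>

definition surrounds :: "(real \<Rightarrow> complex) list \<Rightarrow> complex set \<Rightarrow> complex set \<Rightarrow> bool" where
  "surrounds \<Gamma> S U \<longleftrightarrow>
     (\<forall>\<gamma>\<in>set \<Gamma>. valid_path \<gamma> \<and> pathfinish \<gamma> = pathstart \<gamma> \<and> path_image \<gamma> \<subseteq> U - S) \<and>
     (\<forall>z\<in>S. (\<Sum>\<gamma>\<leftarrow>\<Gamma>. winding_number \<gamma> z) = 1) \<and>
     (\<forall>z. z \<notin> U \<longrightarrow> (\<Sum>\<gamma>\<leftarrow>\<Gamma>. winding_number \<gamma> z) = 0)"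

text \<open>The Riesz--Dunford integral of \<open>f(z) (z - a)\<^sup>-\<^sup>1 / (2 \<pi> i)\<close> over a cycle, convergent in the
  operator norm.\<close>

definition dunford_integral ::
  "(complex \<Rightarrow> complex) \<Rightarrow> (real \<Rightarrow> complex) list \<Rightarrow> ('k::complex_hilbert \<Rightarrow>\<^sub>L 'k)
     \<Rightarrow> ('k \<Rightarrow>\<^sub>L 'k)" where
  "dunford_integral f \<Gamma> a = (scalar_op (1 / (2 * of_real pi * \<i>)) o\<^sub>L
     (\<Sum>\<gamma>\<leftarrow>\<Gamma>. integral {0..1} (\<lambda>t.
        scalar_op (f (\<gamma> t) * vector_derivative \<gamma> (at t within {0..1})) o\<^sub>L
        op_resolvent a (\<gamma> t))))"

text \<open>\<open>b\<close> is the value \<open>f(a)\<close>. That a suitable cycle exists and that the integral does not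
  depend on it are the classical facts behind the calculus.\<close>

definition hol_calculus ::
  "('k::complex_hilbert \<Rightarrow>\<^sub>L 'k) \<Rightarrow> complex set \<Rightarrow> (complex \<Rightarrow> complex) \<Rightarrow> ('k \<Rightarrow>\<^sub>L 'k) \<Rightarrow> bool" where
  "hol_calculus a U f b \<longleftrightarrow>
     (\<exists>\<Gamma>. surrounds \<Gamma> (op_spectrum a) U \<and> b = dunford_integral f \<Gamma> a)"

definition unitization :: "('k::complex_hilbert \<Rightarrow>\<^sub>L 'k) set \<Rightarrow> ('k \<Rightarrow>\<^sub>L 'k) set" where
  "unitization V = {scalar_op c + x | c x. x \<in> V}"

definition closed_under_hol_calculus :: "('k::complex_hilbert \<Rightarrow>\<^sub>L 'k) set \<Rightarrow> bool" where
  "closed_under_hol_calculus V \<longleftrightarrow> op_subalgebra V \<and>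
     (\<forall>a\<in>unitization V. \<forall>U f b.
        open U \<and> op_spectrum a \<subseteq> U \<and> f holomorphic_on U \<and> hol_calculus a U f b \<longrightarrow>
        b \<in> unitization V)"


section \<open>Unbounded operators\<close>

text \<open>An operator \<open>T\<close> with domain is a partial function; \<open>D(T)\<close> is \<open>dom T\<close>, and \<open>T x\<close> is
  \<open>the (T x)\<close> for \<open>x\<close> in the domain.\<close>

definition clinear_operator :: "('k::complex_hilbert \<rightharpoonup> 'k) \<Rightarrow> bool" where
  "clinear_operator T \<longleftrightarrow> 0 \<in> dom T \<and>
     (\<forall>x\<in>dom T. \<forall>y\<in>dom T. x + y \<in> dom T \<and> the (T (x + y)) = the (T x) + the (T y)) \<and>
     (\<forall>c. \<forall>x\<in>dom T. c *\<^sub>C x \<in> dom T \<and> the (T (c *\<^sub>C x)) = c *\<^sub>C the (T x))"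

definition densely_defined :: "('k::complex_hilbert \<rightharpoonup> 'k) \<Rightarrow> bool" where
  "densely_defined T \<longleftrightarrow> closure (dom T) = UNIV"

definition closed_operator :: "('k::complex_hilbert \<rightharpoonup> 'k) \<Rightarrow> bool" where
  "closed_operator T \<longleftrightarrow> closed {(x, y). T x = Some y}"

definition symmetric_operator :: "('k::complex_hilbert \<rightharpoonup> 'k) \<Rightarrow> bool" where
  "symmetric_operator T \<longleftrightarrow>
     (\<forall>x\<in>dom T. \<forall>y\<in>dom T. cinner (the (T x)) y = cinner x (the (T y)))"


section \<open>Derivations and the algebra \<open>\<Psi>\<^sup>\<infinity>\<close>\<close>

text \<open>The operators denoted by definite descriptions below are unique when they exist, since
  the operators \<open>T\<close> are densely defined.\<close>

definition is_delta ::
  "('k::complex_hilbert \<Rightarrow>\<^sub>L 'k) set \<Rightarrow> ('k \<rightharpoonup> 'k) \<Rightarrow> ('k \<Rightarrow>\<^sub>L 'k) \<Rightarrow> ('k \<Rightarrow>\<^sub>L 'k) \<Rightarrow> bool" where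
  "is_delta A T a b \<longleftrightarrow> b \<in> A \<and>
     (\<forall>\<phi>\<in>dom T. blinfun_apply a \<phi> \<in> dom T \<and>
        blinfun_apply b \<phi> = \<i> *\<^sub>C (the (T (blinfun_apply a \<phi>)) - blinfun_apply a (the (T \<phi>))))"

definition delta ::
  "('k::complex_hilbert \<Rightarrow>\<^sub>L 'k) set \<Rightarrow> ('k \<rightharpoonup> 'k) \<Rightarrow> ('k \<Rightarrow>\<^sub>L 'k) \<Rightarrow> ('k \<Rightarrow>\<^sub>L 'k)" where
  "delta A T a = (THE b. is_delta A T a b)"

definition delta_domain ::
  "('k::complex_hilbert \<Rightarrow>\<^sub>L 'k) set \<Rightarrow> ('k \<rightharpoonup> 'k) \<Rightarrow> ('k \<Rightarrow>\<^sub>L 'k) set" where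
  "delta_domain A T = {a\<in>A. (\<exists>b. is_delta A T a b) \<and> (\<exists>b. is_delta A T (cadj a) b)}"

fun Psi ::
  "('k::complex_hilbert \<Rightarrow>\<^sub>L 'k) set \<Rightarrow> ('k \<rightharpoonup> 'k) set \<Rightarrow> nat \<Rightarrow> ('k \<Rightarrow>\<^sub>L 'k) set" where
  "Psi A TT 0 = A"
| "Psi A TT (Suc 0) = {a\<in>A. \<forall>T\<in>TT. a \<in> delta_domain A T}"
| "Psi A TT (Suc (Suc r)) =
     {a \<in> Psi A TT (Suc r). \<forall>T\<in>TT. delta A T a \<in> Psi A TT (Suc r)}"

definition Psi_inf ::
  "('k::complex_hilbert \<Rightarrow>\<^sub>L 'k) set \<Rightarrow> ('k \<rightharpoonup> 'k) set \<Rightarrow> ('k \<Rightarrow>\<^sub>L 'k) set" where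
  "Psi_inf A TT = (\<Inter>r. Psi A TT r)"

primrec Psi_norm ::
  "('k::complex_hilbert \<Rightarrow>\<^sub>L 'k) set \<Rightarrow> (nat \<Rightarrow> ('k \<Rightarrow>\<^sub>L 'k) \<Rightarrow> real) \<Rightarrow> ('k \<rightharpoonup> 'k) set
     \<Rightarrow> nat \<Rightarrow> nat \<Rightarrow> ('k \<Rightarrow>\<^sub>L 'k) \<Rightarrow> real" where
  "Psi_norm A nrm TT 0 j a = nrm j a"
| "Psi_norm A nrm TT (Suc r) j a =
     Psi_norm A nrm TT r j a + (\<Sum>T\<in>TT. Psi_norm A nrm TT r j (delta A T a))"

definition Psi_inf_topology ::
  "('k::complex_hilbert \<Rightarrow>\<^sub>L 'k) set \<Rightarrow> (nat \<Rightarrow> ('k \<Rightarrow>\<^sub>L 'k) \<Rightarrow> real) \<Rightarrow> ('k \<rightharpoonup> 'k) set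
     \<Rightarrow> ('k \<Rightarrow>\<^sub>L 'k) topology" where
  "Psi_inf_topology A nrm TT =
     seminorm_topology (Psi_inf A TT) (UNIV \<times> {1..}) (\<lambda>(r, j). Psi_norm A nrm TT r j)"


section \<open>The semi-ideals\<close>

definition is_omega_l ::
  "('k::complex_hilbert \<Rightarrow>\<^sub>L 'k) set \<Rightarrow> ('k \<rightharpoonup> 'k) \<Rightarrow> ('k \<Rightarrow>\<^sub>L 'k) \<Rightarrow> ('k \<Rightarrow>\<^sub>L 'k) \<Rightarrow> bool" where
  "is_omega_l A T x y \<longleftrightarrow> y \<in> A \<and>
     (\<forall>f. blinfun_apply x f \<in> dom T \<and> blinfun_apply y f = the (T (blinfun_apply x f)))"

definition is_omega_r ::
  "('k::complex_hilbert \<Rightarrow>\<^sub>L 'k) set \<Rightarrow> ('k \<rightharpoonup> 'k) \<Rightarrow> ('k \<Rightarrow>\<^sub>L 'k) \<Rightarrow> ('k \<Rightarrow>\<^sub>L 'k) \<Rightarrow> bool" where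
  "is_omega_r A T x y \<longleftrightarrow> y \<in> A \<and>
     (\<forall>f\<in>dom T. blinfun_apply y f = blinfun_apply x (the (T f)))"

definition is_omega_lr ::
  "('k::complex_hilbert \<Rightarrow>\<^sub>L 'k) set \<Rightarrow> ('k \<rightharpoonup> 'k) \<Rightarrow> ('k \<rightharpoonup> 'k)
     \<Rightarrow> ('k \<Rightarrow>\<^sub>L 'k) \<Rightarrow> ('k \<Rightarrow>\<^sub>L 'k) \<Rightarrow> bool" where
  "is_omega_lr A T1 T2 x y \<longleftrightarrow> y \<in> A \<and> (\<forall>f. blinfun_apply x f \<in> dom T1) \<and>
     (\<forall>f\<in>dom T2. blinfun_apply y f = the (T1 (blinfun_apply x (the (T2 f)))))"

definition omega_l ::
  "('k::complex_hilbert \<Rightarrow>\<^sub>L 'k) set \<Rightarrow> ('k \<rightharpoonup> 'k) \<Rightarrow> ('k \<Rightarrow>\<^sub>L 'k) \<Rightarrow> ('k \<Rightarrow>\<^sub>L 'k)" where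
  "omega_l A T x = (THE y. is_omega_l A T x y)"

definition omega_r ::
  "('k::complex_hilbert \<Rightarrow>\<^sub>L 'k) set \<Rightarrow> ('k \<rightharpoonup> 'k) \<Rightarrow> ('k \<Rightarrow>\<^sub>L 'k) \<Rightarrow> ('k \<Rightarrow>\<^sub>L 'k)" where
  "omega_r A T x = (THE y. is_omega_r A T x y)"

definition omega_lr ::
  "('k::complex_hilbert \<Rightarrow>\<^sub>L 'k) set \<Rightarrow> ('k \<rightharpoonup> 'k) \<Rightarrow> ('k \<rightharpoonup> 'k)
     \<Rightarrow> ('k \<Rightarrow>\<^sub>L 'k) \<Rightarrow> ('k \<Rightarrow>\<^sub>L 'k)" where
  "omega_lr A T1 T2 x = (THE y. is_omega_lr A T1 T2 x y)"

fun J_fin ::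
  "('k::complex_hilbert \<Rightarrow>\<^sub>L 'k) set \<Rightarrow> ('k \<rightharpoonup> 'k) set \<Rightarrow> nat \<Rightarrow> ('k \<Rightarrow>\<^sub>L 'k) set" where
  "J_fin A TT 0 = A"
| "J_fin A TT (Suc 0) =
     {x\<in>A. (\<forall>T\<in>TT. \<exists>y. is_omega_l A T x y) \<and>
           (\<forall>T\<in>TT. \<exists>y. is_omega_r A T x y) \<and>
           (\<forall>T1\<in>TT. \<forall>T2\<in>TT. \<exists>y. is_omega_lr A T1 T2 x y)}"
| "J_fin A TT (Suc (Suc k)) =
     {x \<in> J_fin A TT (Suc k).
        (\<forall>T\<in>TT. omega_l A T x \<in> J_fin A TT (Suc k) \<and> omega_r A T x \<in> J_fin A TT (Suc k)) \<and>
        (\<forall>T1\<in>TT. \<forall>T2\<in>TT. omega_lr A T1 T2 x \<in> J_fin A TT (Suc k))}"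

definition J_space ::
  "('k::complex_hilbert \<Rightarrow>\<^sub>L 'k) set \<Rightarrow> ('k \<rightharpoonup> 'k) set \<Rightarrow> enat \<Rightarrow> ('k \<Rightarrow>\<^sub>L 'k) set" where
  "J_space A TT k = (case k of enat n \<Rightarrow> J_fin A TT n | \<infinity> \<Rightarrow> (\<Inter>n. J_fin A TT n))"

primrec J_norm ::
  "('k::complex_hilbert \<Rightarrow>\<^sub>L 'k) set \<Rightarrow> (nat \<Rightarrow> ('k \<Rightarrow>\<^sub>L 'k) \<Rightarrow> real) \<Rightarrow> ('k \<rightharpoonup> 'k) set
     \<Rightarrow> nat \<Rightarrow> nat \<Rightarrow> ('k \<Rightarrow>\<^sub>L 'k) \<Rightarrow> real" where
  "J_norm A nrm TT j 0 x = nrm j x"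
| "J_norm A nrm TT j (Suc k) x =
     J_norm A nrm TT j k x +
     (\<Sum>T\<in>TT. J_norm A nrm TT j k (omega_l A T x) + J_norm A nrm TT j k (omega_r A T x)) +
     (\<Sum>T1\<in>TT. \<Sum>T2\<in>TT. J_norm A nrm TT j k (omega_lr A T1 T2 x))"

definition J_index :: "enat \<Rightarrow> (nat \<times> nat) set" where
  "J_index k = (case k of enat n \<Rightarrow> {1..} \<times> {n} | \<infinity> \<Rightarrow> {1..} \<times> UNIV)"

definition J_topology ::
  "('k::complex_hilbert \<Rightarrow>\<^sub>L 'k) set \<Rightarrow> (nat \<Rightarrow> ('k \<Rightarrow>\<^sub>L 'k) \<Rightarrow> real) \<Rightarrow> ('k \<rightharpoonup> 'k) set
     \<Rightarrow> enat \<Rightarrow> ('k \<Rightarrow>\<^sub>L 'k) topology" where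
  "J_topology A nrm TT k =
     seminorm_topology (J_space A TT k) (J_index k) (\<lambda>(j, n). J_norm A nrm TT j n)"

end

(* Every estimate rests on how the maps omega act on products: omega^l(x a y) = omega^l(x) a y,
   omega^r(x a y) = x a omega^r(y) and omega^{l,r}(x a y) = omega^l(x) a omega^r(y). By induction on k,
   p_{j,k}(x a y) <= p_{j,k}(x) |a|_j p_{j,k}(y), which contains submultiplicativity (a = e), the
   semi-ideal property and the continuity of (x, a, y) |-> x a y. Commuting T past an element of Psi
   costs a term with its derivation delta_T, whence p_{j,k}(a x) <= q_{k,j}(a) p_{j,k}(x) and its mirror
   image. Completeness follows since the operators T are closed.

   For the functional calculus let a = l + x with x in a semi-ideal V of A. If l is in the spectrum of
   a, then with m = z - l the resolvent is R(z) = 1/m + x/m^2 + x R(z) x/m^2 on the contour, and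
   integrals of R converge in A because inversion is continuous for submultiplicative seminorms.
   Otherwise x is invertible in A by spectral invariance, so V = A. *)

theory Submission
  imports Defs
begin

text \<open>Some obstacles lie outside these estimates. \<open>frechet_space\<close> speaks of some
  generating system of seminorms, whereas completeness of A is wanted for the given one;
  completeness is therefore transferred between systems with the same topology. A space
  \<open>J k\<close> may have a unit of its own, at which the \<open>p j k\<close> need not be 1; an
  equivalent submultiplicative system, built from left multiplication, is normalised there. A
  semi-ideal need not absorb one-sided products with elements of A, so the resolvent may enter only
  between two factors x. This forces the expansion to second order. It also divides by powers of
  \<open>z - l\<close>, while l may lie on the path when it is outside the spectrum; hence the
  separate case. Operator-valued integrals are seen from two sides: complex-linear functionals turn
  them into scalar contour integrals, to which Cauchy's theorem applies, and Riemann sums show that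
  their values lie in A.\<close>

instance complex_hilbert \<subseteq> banach ..

section \<open>Operators on complex Hilbert spaces\<close>

lemma cinner_scaleC_right:
  fixes x y :: "'a::complex_hilbert"
  shows "cinner x (c *\<^sub>C y) = cnj c * cinner x y"
  by (metis cinner_commute cinner_scaleC_left complex_cnj_mult)

lemma norm_scaleC:
  fixes x :: "'a::complex_hilbert"
  shows "norm (c *\<^sub>C x) = cmod c * norm x"
proof -
  have "cinner (c *\<^sub>C x) (c *\<^sub>C x) = complex_of_real ((cmod c)\<^sup>2) * cinner x x"
    by (simp add: cinner_scaleC_left cinner_scaleC_right complex_norm_square mult.assoc del: of_real_power)
  then have "(norm (c *\<^sub>C x))\<^sup>2 = (cmod c * norm x)\<^sup>2"
    by (simp add: power2_norm_eq_inner inner_eq_Re_cinner power_mult_distrib)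
  then show ?thesis
    by (metis abs_norm_cancel abs_of_nonneg mult_nonneg_nonneg norm_ge_zero power2_eq_iff_nonneg)
qed

lemma bounded_linear_scaleC: "bounded_linear (\<lambda>x::'a::complex_hilbert. c *\<^sub>C x)"
proof (rule bounded_linear_intro[of _ "cmod c"])
  show "c *\<^sub>C (r *\<^sub>R x) = r *\<^sub>R (c *\<^sub>C x)" for r and x :: 'a
    by (metis mult.commute scaleC_of_real scaleC_scaleC)
qed (simp_all add: scaleC_add_right norm_scaleC mult.commute)

lemma blinfun_apply_scalar_op [simp]: "blinfun_apply (scalar_op c) x = c *\<^sub>C x"
  unfolding scalar_op_def by (simp add: bounded_linear_Blinfun_apply bounded_linear_scaleC)

lemma scaleC_zero [simp]: "0 *\<^sub>C (x::'a::complex_hilbert) = 0"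
  using scaleC_of_real[of 0 x] by simp

lemma scaleC_one [simp]: "1 *\<^sub>C (x::'a::complex_hilbert) = x"
  using scaleC_of_real[of 1 x] by simp

lemma scaleC_minus_one: "(- 1) *\<^sub>C (x::'a::complex_hilbert) = - x"
  using scaleC_of_real[of "-1" x] by simp

lemma scaleC_zero_right [simp]: "c *\<^sub>C (0::'a::complex_hilbert) = 0"
  by (rule linear_0[OF bounded_linear.linear[OF bounded_linear_scaleC]])

lemma scaleC_diff_right: "c *\<^sub>C ((x::'a::complex_hilbert) - y) = c *\<^sub>C x - c *\<^sub>C y"
  by (rule linear_diff[OF bounded_linear.linear[OF bounded_linear_scaleC]])

lemma scaleC_diff_left: "(c - d) *\<^sub>C (x::'a::complex_hilbert) = c *\<^sub>C x - d *\<^sub>C x"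
  by (metis add_diff_cancel_right' diff_add_cancel scaleC_add_left)

lemma scalar_op_0 [simp]: "scalar_op 0 = 0"
  by (rule blinfun_eqI) simp

lemma scalar_op_1 [simp]: "scalar_op 1 = id_blinfun"
  by (rule blinfun_eqI) simp

lemma scalar_op_mult: "scalar_op (c * d) = scalar_op c o\<^sub>L scalar_op d"
  by (rule blinfun_eqI) (simp add: scaleC_scaleC)

lemma scalar_op_add: "scalar_op (c + d) = scalar_op c + scalar_op d"
  by (rule blinfun_eqI) (simp add: scaleC_add_left blinfun.add_left)

lemma blinfun_compose_assoc: "(a o\<^sub>L b) o\<^sub>L c = a o\<^sub>L (b o\<^sub>L c)"
  by (rule blinfun_eqI) simp

lemma blinfun_compose_id [simp]: "id_blinfun o\<^sub>L a = a" "a o\<^sub>L id_blinfun = a"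
  by (auto intro: blinfun_eqI)

lemma cblinD: "a \<in> cblin \<Longrightarrow> blinfun_apply a (c *\<^sub>C x) = c *\<^sub>C blinfun_apply a x"
  by (simp add: cblin_def)

lemma cblin_scalar_commute: "a \<in> cblin \<Longrightarrow> a o\<^sub>L scalar_op c = scalar_op c o\<^sub>L a"
  by (rule blinfun_eqI) (simp add: cblinD)

lemma cblin_scalar_left_commute:
  "a \<in> cblin \<Longrightarrow> a o\<^sub>L (scalar_op c o\<^sub>L b) = scalar_op c o\<^sub>L (a o\<^sub>L b)"
  by (metis blinfun_compose_assoc cblin_scalar_commute)

lemmas o_add_left = bounded_bilinear.add_left[OF bounded_bilinear_blinfun_compose]
  and o_add_right = bounded_bilinear.add_right[OF bounded_bilinear_blinfun_compose]
  and o_diff_left = bounded_bilinear.diff_left[OF bounded_bilinear_blinfun_compose]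
  and o_diff_right = bounded_bilinear.diff_right[OF bounded_bilinear_blinfun_compose]

section \<open>Subspaces of operators and seminorms on them\<close>

lemma op_subspace_cblin: "op_subspace V \<Longrightarrow> x \<in> V \<Longrightarrow> x \<in> cblin"
  by (auto simp: op_subspace_def)

lemma op_subspace_0: "op_subspace V \<Longrightarrow> 0 \<in> V"
  by (simp add: op_subspace_def)

lemma op_subspace_add: "op_subspace V \<Longrightarrow> x \<in> V \<Longrightarrow> y \<in> V \<Longrightarrow> x + y \<in> V"
  by (simp add: op_subspace_def)

lemma op_subspace_scalar: "op_subspace V \<Longrightarrow> x \<in> V \<Longrightarrow> scalar_op c o\<^sub>L x \<in> V"
  by (simp add: op_subspace_def)

text \<open>\<open>op_subspace\<close> and \<open>seminorm_on\<close> speak of sums and complex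
  multiples only, so negatives and differences enter as composition with
  \<open>scalar_op (- 1)\<close>.\<close>

lemma minus_eq_scalar_op: "- x = scalar_op (- 1) o\<^sub>L x"
  by (rule blinfun_eqI) (simp add: blinfun.minus_left scaleC_minus_one)

lemma diff_eq_scalar_op: "x - y = x + (scalar_op (- 1) o\<^sub>L y)"
  by (metis add_uminus_conv_diff minus_eq_scalar_op)

lemma op_subspace_diff: "op_subspace V \<Longrightarrow> x \<in> V \<Longrightarrow> y \<in> V \<Longrightarrow> x - y \<in> V"
  by (simp add: diff_eq_scalar_op op_subspace_def)

lemma op_subspace_sum:
  assumes "op_subspace V" and "\<And>i. i \<in> I \<Longrightarrow> f i \<in> V"
  shows "sum f I \<in> V"
  using assms(2)
  by (induction I rule: infinite_finite_induct)
     (auto intro: op_subspace_0 op_subspace_add assms(1))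

lemma seminorm_on_nonneg: "seminorm_on V q \<Longrightarrow> x \<in> V \<Longrightarrow> 0 \<le> q x"
  by (simp add: seminorm_on_def)

lemma seminorm_on_add: "seminorm_on V q \<Longrightarrow> x \<in> V \<Longrightarrow> y \<in> V \<Longrightarrow> q (x + y) \<le> q x + q y"
  by (simp add: seminorm_on_def)

lemma seminorm_on_scalar: "seminorm_on V q \<Longrightarrow> x \<in> V \<Longrightarrow> q (scalar_op c o\<^sub>L x) = cmod c * q x"
  by (simp add: seminorm_on_def)

lemma seminorm_on_0:
  assumes "op_subspace V" "seminorm_on V q"
  shows "q 0 = 0"
  using seminorm_on_scalar[OF assms(2) op_subspace_0[OF assms(1)], of 0] by simp

lemma seminorm_on_diff:
  assumes "op_subspace V" "seminorm_on V q" "x \<in> V" "y \<in> V"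
  shows "q (x - y) \<le> q x + q y"
  using seminorm_on_add[OF assms(2,3) op_subspace_scalar[OF assms(1,4), of "-1"]]
    seminorm_on_scalar[OF assms(2,4), of "-1"] by (simp add: diff_eq_scalar_op)

lemma seminorm_on_minus_commute:
  assumes "op_subspace V" "seminorm_on V q" "x \<in> V" "y \<in> V"
  shows "q (x - y) = q (y - x)"
  using seminorm_on_scalar[OF assms(2) op_subspace_diff[OF assms(1,3,4)], of "-1"]
  by (simp flip: minus_eq_scalar_op)

lemma seminorm_on_triangle:
  assumes "op_subspace V" "seminorm_on V q" "x \<in> V" "y \<in> V" "z \<in> V"
  shows "q (x - z) \<le> q (x - y) + q (y - z)"
  using seminorm_on_add[OF assms(2) op_subspace_diff[OF assms(1,3,4)] op_subspace_diff[OF assms(1,4,5)]]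
  by simp

lemma seminorm_on_sum:
  assumes "op_subspace V" "seminorm_on V q" "\<And>i. i \<in> I \<Longrightarrow> f i \<in> V"
  shows "q (sum f I) \<le> (\<Sum>i\<in>I. q (f i))"
  using assms(3)
proof (induction I rule: infinite_finite_induct)
  case (insert i I)
  then have "q (f i + sum f I) \<le> q (f i) + q (sum f I)"
    by (intro seminorm_on_add[OF assms(2)] op_subspace_sum[OF assms(1)]) auto
  with insert show ?case by force
qed (simp_all add: seminorm_on_0[OF assms(1,2)])

lemma seminorm_on_subset: "seminorm_on V q \<Longrightarrow> W \<subseteq> V \<Longrightarrow> seminorm_on W q"
  unfolding seminorm_on_def by blast


section \<open>Topologies generated by seminorms\<close>

text \<open>The generating balls have arbitrary centres. If \<open>f p\<close> lies in the ball of
  radius r about x, the triangle inequality leaves the slack \<open>r - q i (f p - x)\<close>, and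
  close to p the values of f differ from \<open>f p\<close> by less than that.\<close>

lemma continuous_map_into_seminorm_topology:
  assumes V: "op_subspace V" and I: "I \<noteq> {}" and q: "\<And>i. i \<in> I \<Longrightarrow> seminorm_on V (q i)"
    and f: "\<And>x. x \<in> topspace X \<Longrightarrow> f x \<in> V"
    and lim: "\<And>p i. p \<in> topspace X \<Longrightarrow> i \<in> I \<Longrightarrow> ((\<lambda>x. q i (f x - f p)) \<longlongrightarrow> 0) (atin X p)"
  shows "continuous_map X (seminorm_topology V I q) f"
  unfolding seminorm_topology_def
proof (rule continuous_on_generated_topo)
  have "\<Union> {{y \<in> V. q i (y - x) < r} |i x r. i \<in> I \<and> x \<in> V \<and> 0 < r} = V"
    using topspace_seminorm_topology[OF I, of V q]
    by (simp add: seminorm_topology_def topology_generated_by_topspace)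
  then show "f ` topspace X \<subseteq> \<Union> {{y \<in> V. q i (y - x) < r} |i x r. i \<in> I \<and> x \<in> V \<and> 0 < r}"
    using f by auto
next
  fix U assume "U \<in> {{y \<in> V. q i (y - x) < r} |i x r. i \<in> I \<and> x \<in> V \<and> 0 < r}"
  then obtain i x r where U: "U = {y \<in> V. q i (y - x) < r}" and i: "i \<in> I" and x: "x \<in> V"
    by blast
  show "openin X (f -` U \<inter> topspace X)"
  proof (subst openin_subopen, intro ballI)
    fix p assume p: "p \<in> f -` U \<inter> topspace X"
    then have pos: "0 < r - q i (f p - x)" and pt: "p \<in> topspace X" by (auto simp: U)
    have "eventually (\<lambda>y. q i (f y - f p) < r - q i (f p - x)) (atin X p)"
      by (rule order_tendstoD(2)[OF lim[OF pt i] pos])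
    then obtain W where W: "openin X W" "p \<in> W"
      "\<And>y. y \<in> W - {p} \<Longrightarrow> q i (f y - f p) < r - q i (f p - x)"
      using pt by (auto simp: eventually_atin)
    have "W \<subseteq> f -` U \<inter> topspace X"
    proof
      fix y assume y: "y \<in> W"
      then have yt: "y \<in> topspace X" using W(1) openin_subset by blast
      show "y \<in> f -` U \<inter> topspace X"
      \<comment> \<open>\<open>atin\<close> is a punctured filter, so the point p itself is treated
        separately.\<close>
      proof (cases "y = p")
        case False
        have "q i (f y - x) \<le> q i (f y - f p) + q i (f p - x)"
          by (rule seminorm_on_triangle[OF V q[OF i] f[OF yt] f[OF pt] x])
        moreover have "q i (f y - f p) < r - q i (f p - x)" using W(3) y False by blast
        ultimately show ?thesis using yt f[OF yt] by (auto simp: U)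
      qed (use p in simp)
    qed
    with W show "\<exists>T. openin X T \<and> p \<in> T \<and> T \<subseteq> f -` U \<inter> topspace X" by blast
  qed
qed

text \<open>Concrete maps come with an estimate rather than an exact limit: it suffices to bound the
  error by a function that tends to 0.\<close>

lemma continuous_map_into_seminorm_topology_bound:
  assumes V: "op_subspace V" and I: "I \<noteq> {}" and q: "\<And>i. i \<in> I \<Longrightarrow> seminorm_on V (q i)"
    and f: "\<And>x. x \<in> topspace X \<Longrightarrow> f x \<in> V"
    and lim: "\<And>p i. p \<in> topspace X \<Longrightarrow> i \<in> I \<Longrightarrow>
      \<exists>e. (e \<longlongrightarrow> 0) (atin X p) \<and> (\<forall>x\<in>topspace X. q i (f x - f p) \<le> e x)"
  shows "continuous_map X (seminorm_topology V I q) f"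
proof (rule continuous_map_into_seminorm_topology[OF V I q f])
  fix p i assume p: "p \<in> topspace X" and i: "i \<in> I"
  then obtain e where e: "(e \<longlongrightarrow> 0) (atin X p)" "\<And>x. x \<in> topspace X \<Longrightarrow> q i (f x - f p) \<le> e x"
    using lim by blast
  have ev: "eventually P (atin X p)" if "\<And>x. x \<in> topspace X \<Longrightarrow> P x" for P
    unfolding eventually_atin using that p by (metis DiffD1 openin_topspace)
  show "((\<lambda>x. q i (f x - f p)) \<longlongrightarrow> 0) (atin X p)"
    by (rule tendsto_sandwich[OF _ _ tendsto_const e(1)])
       (auto intro!: ev e(2) seminorm_on_nonneg[OF q[OF i]] op_subspace_diff[OF V] f p)
qed

text \<open>The hypotheses avoid the assumption that \<open>V\<close> is a subspace, which for \<open>\<Psi>\<^sup>\<infinity>\<close> would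
  require the existence of adjoints.\<close>

lemma seminorm_topology_tendsto:
  assumes g: "continuous_map X (seminorm_topology V I q) g"
    and i: "i \<in> I" and p: "p \<in> topspace X" and 0: "q i 0 = 0"
    and nonneg: "\<And>x y. x \<in> V \<Longrightarrow> y \<in> V \<Longrightarrow> 0 \<le> q i (x - y)"
  shows "((\<lambda>x. q i (g x - g p)) \<longlongrightarrow> 0) (atin X p)"
proof (rule tendstoI)
  fix e :: real assume e: "0 < e"
  have ts: "topspace (seminorm_topology V I q) = V"
    by (rule topspace_seminorm_topology) (use i in blast)
  have gV: "g x \<in> V" if "x \<in> topspace X" for x
    using g that ts continuous_map_image_subset_topspace by blast
  let ?U = "{y \<in> V. q i (y - g p) < e}"
  have "openin (seminorm_topology V I q) ?U"
    unfolding seminorm_topology_def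
    by (rule topology_generated_by_Basis) (use i gV[OF p] e in blast)
  then have op: "openin X {x \<in> topspace X. g x \<in> ?U}"
    using g openin_continuous_map_preimage by blast
  show "eventually (\<lambda>x. dist (q i (g x - g p)) 0 < e) (atin X p)"
    unfolding eventually_atin
    using op p gV e 0 nonneg[OF gV gV[OF p]]
    by (intro disjI2 exI[of _ "{x \<in> topspace X. g x \<in> ?U}"]) (auto simp: dist_real_def)
qed

text \<open>Uses xy - x'y' = (x - x')(y - y') + (x - x')y' + x'(y - y'). The estimates and the
  membership in V are demanded of differences directly, because V1 and V2 are not assumed to be
  closed under subtraction; one of them will be \<open>Psi_inf A TT\<close>.\<close>

lemma continuous_map_bilinear:
  assumes V: "op_subspace V" and I: "I \<noteq> {}" and q: "\<And>i. i \<in> I \<Longrightarrow> seminorm_on V (q i)"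
    and I1: "I1 \<noteq> {}" and I2: "I2 \<noteq> {}"
    and z1: "\<And>i. i \<in> I1 \<Longrightarrow> q1 i 0 = 0"
    and z2: "\<And>i. i \<in> I2 \<Longrightarrow> q2 i 0 = 0"
    and n1: "\<And>i x y. i \<in> I1 \<Longrightarrow> x \<in> V1 \<Longrightarrow> y \<in> V1 \<Longrightarrow> 0 \<le> q1 i (x - y)"
    and n2: "\<And>i x y. i \<in> I2 \<Longrightarrow> x \<in> V2 \<Longrightarrow> y \<in> V2 \<Longrightarrow> 0 \<le> q2 i (x - y)"
    and mem: "\<And>x y. x \<in> V1 \<Longrightarrow> y \<in> V2 \<Longrightarrow> x o\<^sub>L y \<in> V"
    and bd: "\<And>i. i \<in> I \<Longrightarrow> \<exists>i1\<in>I1. \<exists>i2\<in>I2. \<forall>x\<in>V1. \<forall>x'\<in>V1. \<forall>y\<in>V2. \<forall>y'\<in>V2.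
        q i ((x - x') o\<^sub>L (y - y')) \<le> q1 i1 (x - x') * q2 i2 (y - y') \<and>
        q i ((x - x') o\<^sub>L y') \<le> q1 i1 (x - x') * q2 i2 y' \<and>
        q i (x' o\<^sub>L (y - y')) \<le> q1 i1 x' * q2 i2 (y - y') \<and>
        (x - x') o\<^sub>L (y - y') \<in> V \<and> (x - x') o\<^sub>L y' \<in> V \<and> x' o\<^sub>L (y - y') \<in> V"
  shows "continuous_map (prod_topology (seminorm_topology V1 I1 q1) (seminorm_topology V2 I2 q2))
    (seminorm_topology V I q) (\<lambda>(x, y). x o\<^sub>L y)"
    (is "continuous_map ?X _ _")
proof (rule continuous_map_into_seminorm_topology_bound[OF V I q])
  have ts: "topspace ?X = V1 \<times> V2"
    by (simp add: topspace_seminorm_topology I1 I2)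
  show "(case z of (x, y) \<Rightarrow> x o\<^sub>L y) \<in> V" if "z \<in> topspace ?X" for z
    using that mem unfolding ts by auto
  fix p i assume p: "p \<in> topspace ?X" and i: "i \<in> I"
  obtain x' y' where pe: "p = (x', y')" and x': "x' \<in> V1" and y': "y' \<in> V2"
    using p unfolding ts by auto
  obtain i1 i2 where i12: "i1 \<in> I1" "i2 \<in> I2" and b: "\<forall>x\<in>V1. \<forall>x'\<in>V1. \<forall>y\<in>V2. \<forall>y'\<in>V2.
        q i ((x - x') o\<^sub>L (y - y')) \<le> q1 i1 (x - x') * q2 i2 (y - y') \<and>
        q i ((x - x') o\<^sub>L y') \<le> q1 i1 (x - x') * q2 i2 y' \<and>
        q i (x' o\<^sub>L (y - y')) \<le> q1 i1 x' * q2 i2 (y - y') \<and>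
        (x - x') o\<^sub>L (y - y') \<in> V \<and> (x - x') o\<^sub>L y' \<in> V \<and> x' o\<^sub>L (y - y') \<in> V"
    using bd[OF i] by blast
  define e where "e z = q1 i1 (fst z - x') * q2 i2 (snd z - y') + q1 i1 (fst z - x') * q2 i2 y'
    + q1 i1 x' * q2 i2 (snd z - y')" for z
  have t1: "((\<lambda>z. q1 i1 (fst z - fst p)) \<longlongrightarrow> 0) (atin ?X p)"
    by (rule seminorm_topology_tendsto[OF continuous_map_fst i12(1) p z1[OF i12(1)] n1[OF i12(1)]])
  have t2: "((\<lambda>z. q2 i2 (snd z - snd p)) \<longlongrightarrow> 0) (atin ?X p)"
    by (rule seminorm_topology_tendsto[OF continuous_map_snd i12(2) p z2[OF i12(2)] n2[OF i12(2)]])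
  have "(e \<longlongrightarrow> 0 * 0 + 0 * q2 i2 y' + q1 i1 x' * 0) (atin ?X p)"
    unfolding e_def using t1 t2 by (intro tendsto_intros) (simp_all add: pe)
  moreover have "q i ((case z of (x, y) \<Rightarrow> x o\<^sub>L y) - (case p of (x, y) \<Rightarrow> x o\<^sub>L y)) \<le> e z"
    if z: "z \<in> topspace ?X" for z
  proof -
    obtain x y where ze: "z = (x, y)" and x: "x \<in> V1" and y: "y \<in> V2"
      using z unfolding ts by auto
    note c = b[rule_format, OF x x' y y']
    have "(x o\<^sub>L y) - (x' o\<^sub>L y') = ((x - x') o\<^sub>L (y - y')) + ((x - x') o\<^sub>L y') + (x' o\<^sub>L (y - y'))"
      by (simp add: o_diff_left o_diff_right)
    then have "q i ((x o\<^sub>L y) - (x' o\<^sub>L y')) \<le>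
        q i ((x - x') o\<^sub>L (y - y')) + q i ((x - x') o\<^sub>L y') + q i (x' o\<^sub>L (y - y'))"
      using seminorm_on_add[OF q[OF i], of "(x - x') o\<^sub>L (y - y')" "(x - x') o\<^sub>L y'"]
        seminorm_on_add[OF q[OF i], of "((x - x') o\<^sub>L (y - y')) + ((x - x') o\<^sub>L y')" "x' o\<^sub>L (y - y')"]
        c op_subspace_add[OF V] by simp
    then show ?thesis using c by (simp add: ze pe e_def)
  qed
  ultimately show "\<exists>e. (e \<longlongrightarrow> 0) (atin ?X p) \<and>
      (\<forall>z\<in>topspace ?X. q i ((case z of (x, y) \<Rightarrow> x o\<^sub>L y) - (case p of (x, y) \<Rightarrow> x o\<^sub>L y)) \<le> e z)"
    by auto
qed

text \<open>The balls form only a subbasis, with arbitrary centres. In the induction over the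
  generated topology an intersection unites the finite index sets and takes the smaller radius, and
  the triangle inequality moves the centre of a ball to x.\<close>

lemma seminorm_topology_openD:
  assumes "openin (seminorm_topology V I q) U" and "x \<in> U"
    and V: "op_subspace V" and q: "\<And>i. i \<in> I \<Longrightarrow> seminorm_on V (q i)"
  shows "\<exists>F d. finite F \<and> F \<subseteq> I \<and> 0 < d \<and> (\<forall>y\<in>V. (\<forall>i\<in>F. q i (y - x) < d) \<longrightarrow> y \<in> U)"
proof -
  have "generate_topology_on {{y\<in>V. q i (y - x) < r} | i x r. i \<in> I \<and> x \<in> V \<and> 0 < r} U"
    using assms(1) unfolding seminorm_topology_def by (rule openin_topology_generated_by)
  then show ?thesis using assms(2)
  proof (induction arbitrary: x)
    case (Int a b)
    obtain F d where F: "finite F" "F \<subseteq> I" "0 < d"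
      "\<forall>y\<in>V. (\<forall>i\<in>F. q i (y - x) < d) \<longrightarrow> y \<in> a"
      using Int.IH(1)[of x] Int.prems by blast
    obtain G e where G: "finite G" "G \<subseteq> I" "0 < e"
      "\<forall>y\<in>V. (\<forall>i\<in>G. q i (y - x) < e) \<longrightarrow> y \<in> b"
      using Int.IH(2)[of x] Int.prems by blast
    show ?case
      by (rule exI[of _ "F \<union> G"], rule exI[of _ "min d e"]) (use F G in auto)
  next
    case (UN K)
    then obtain k where "k \<in> K" "x \<in> k" by blast
    then show ?case using UN.IH[of k x] by (meson UnionI)
  next
    case (Basis s)
    then obtain i z r where s: "s = {y \<in> V. q i (y - z) < r}" "i \<in> I" "z \<in> V" by blast
    then have "q i (y - z) < r" if "y \<in> V" "q i (y - x) < r - q i (x - z)" for y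
      using seminorm_on_triangle[OF V q[OF s(2)] that(1) _ s(3), of x] Basis that by auto
    then show ?case
      by (intro exI[of _ "{i}"] exI[of _ "r - q i (x - z)"]) (use Basis s in auto)
  qed simp
qed

text \<open>The two comparisons have the shape needed for the renorming below: each old seminorm is
  at most a multiple of a new one, while a new one is bounded by a sum of two old ones. They make
  the identity continuous in both directions.\<close>

lemma seminorm_topology_eqI:
  assumes V: "op_subspace V" and I: "I \<noteq> {}" and I': "I' \<noteq> {}"
    and q: "\<And>i. i \<in> I \<Longrightarrow> seminorm_on V (q i)" and q': "\<And>i. i \<in> I' \<Longrightarrow> seminorm_on V (q' i)"
    and le: "\<And>i. i \<in> I \<Longrightarrow> \<exists>j\<in>I'. \<exists>C. \<forall>x\<in>V. q i x \<le> C * q' j x"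
    and le': "\<And>j. j \<in> I' \<Longrightarrow> \<exists>i1\<in>I. \<exists>i2\<in>I. \<exists>C. \<forall>x\<in>V. q' j x \<le> C * (q i1 x + q i2 x)"
  shows "seminorm_topology V I q = seminorm_topology V I' q'"
proof -
  let ?X = "seminorm_topology V I q" and ?X' = "seminorm_topology V I' q'"
  have ts: "topspace ?X = V" "topspace ?X' = V"
    by (simp_all add: topspace_seminorm_topology I I')
  have t: "((\<lambda>x. q i (x - p)) \<longlongrightarrow> 0) (atin ?X p)" if "p \<in> V" "i \<in> I" for p i
    by (rule seminorm_topology_tendsto[where g = "\<lambda>x. x" and V = V and I = I])
       (use that seminorm_on_0[OF V q] seminorm_on_nonneg[OF q] op_subspace_diff[OF V] ts in auto)
  have t': "((\<lambda>x. q' i (x - p)) \<longlongrightarrow> 0) (atin ?X' p)" if "p \<in> V" "i \<in> I'" for p i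
    by (rule seminorm_topology_tendsto[where g = "\<lambda>x. x" and V = V and I = I'])
       (use that seminorm_on_0[OF V q'] seminorm_on_nonneg[OF q'] op_subspace_diff[OF V] ts in auto)
  have c: "continuous_map ?X ?X' (\<lambda>x. x)"
  proof (rule continuous_map_into_seminorm_topology_bound[OF V I' q'])
    fix p j assume "p \<in> topspace ?X" "j \<in> I'"
    then obtain i1 i2 C where i: "i1 \<in> I" "i2 \<in> I" and C: "\<forall>x\<in>V. q' j x \<le> C * (q i1 x + q i2 x)"
      and p: "p \<in> V"
      using le' ts by metis
    have "((\<lambda>x. C * (q i1 (x - p) + q i2 (x - p))) \<longlongrightarrow> C * (0 + 0)) (atin ?X p)"
      by (intro tendsto_intros t p i)
    then show "\<exists>e. (e \<longlongrightarrow> 0) (atin ?X p) \<and> (\<forall>x\<in>topspace ?X. q' j (x - p) \<le> e x)"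
      using C p op_subspace_diff[OF V] ts by auto
  qed (simp_all add: ts)
  have c': "continuous_map ?X' ?X (\<lambda>x. x)"
  proof (rule continuous_map_into_seminorm_topology_bound[OF V I q])
    fix p i assume "p \<in> topspace ?X'" "i \<in> I"
    then obtain j C where j: "j \<in> I'" and C: "\<forall>x\<in>V. q i x \<le> C * q' j x"
      and p: "p \<in> V"
      using le ts by metis
    have "((\<lambda>x. C * q' j (x - p)) \<longlongrightarrow> C * 0) (atin ?X' p)"
      by (intro tendsto_intros t' p j)
    then show "\<exists>e. (e \<longlongrightarrow> 0) (atin ?X' p) \<and> (\<forall>x\<in>topspace ?X'. q i (x - p) \<le> e x)"
      using C p op_subspace_diff[OF V] ts by auto
  qed (simp_all add: ts)
  have "openin ?X U \<longleftrightarrow> openin ?X' U" for U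
  proof -
    have "{x \<in> V. x \<in> U} = U" if "U \<subseteq> V" using that by blast
    then show ?thesis
      using openin_continuous_map_preimage[OF c, of U] openin_continuous_map_preimage[OF c', of U]
        openin_subset[of ?X U] openin_subset[of ?X' U] by (auto simp: ts)
  qed
  then show ?thesis by (simp add: topology_eq)
qed

lemma seminorm_topology_reindex:
  assumes "h ` J = I"
  shows "seminorm_topology V I q = seminorm_topology V J (\<lambda>n. q (h n))"
  unfolding seminorm_topology_def assms[symmetric] by (rule arg_cong[of _ _ topology_generated_by]) blast

text \<open>A property of one particular system, whereas \<open>frechet_space\<close> asserts it for
  some system that generates the topology.\<close>

definition complete_seminorms ::
  "('k::complex_hilbert \<Rightarrow>\<^sub>L 'k) set \<Rightarrow> 'i set \<Rightarrow> ('i \<Rightarrow> ('k \<Rightarrow>\<^sub>L 'k) \<Rightarrow> real) \<Rightarrow> bool" where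
  "complete_seminorms V I q \<longleftrightarrow> (\<forall>s :: nat \<Rightarrow> ('k \<Rightarrow>\<^sub>L 'k).
     (\<forall>n. s n \<in> V) \<and> (\<forall>i\<in>I. \<forall>e>0. \<exists>N. \<forall>m\<ge>N. \<forall>n\<ge>N. q i (s m - s n) < e) \<longrightarrow>
     (\<exists>x\<in>V. \<forall>i\<in>I. (\<lambda>n. q i (s n - x)) \<longlonglongrightarrow> 0))"

text \<open>The ball of \<open>q' i\<close> about 0 is open in the common topology, hence contains a
  finite intersection of balls of the other system.\<close>

lemma seminorm_topology_dominated:
  assumes V: "op_subspace V" and q: "\<And>i. i \<in> I \<Longrightarrow> seminorm_on V (q i)"
    and q': "seminorm_on V (q' i)" and i: "i \<in> I'" and e: "0 < (e::real)"
    and eq: "seminorm_topology V I q = seminorm_topology V I' q'"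
  shows "\<exists>F d. finite F \<and> F \<subseteq> I \<and> 0 < d \<and> (\<forall>y\<in>V. (\<forall>j\<in>F. q j y < d) \<longrightarrow> q' i y < e)"
proof -
  let ?U = "{y \<in> V. q' i (y - 0) < e}"
  have "openin (seminorm_topology V I' q') ?U"
    unfolding seminorm_topology_def
    by (rule topology_generated_by_Basis) (use i e op_subspace_0[OF V] in blast)
  then have "openin (seminorm_topology V I q) ?U" by (simp add: eq)
  from seminorm_topology_openD[OF this _ V q, of 0]
  show ?thesis using op_subspace_0[OF V] seminorm_on_0[OF V q'] e by simp
qed

text \<open>Equality of the topologies gives domination both ways: one direction carries the Cauchy
  property from q to q', the other carries convergence back.\<close>

lemma complete_seminorms_transfer:
  assumes V: "op_subspace V" and I: "I \<noteq> {}" and I': "I' \<noteq> {}"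
    and q: "\<And>i. i \<in> I \<Longrightarrow> seminorm_on V (q i)" and q': "\<And>i. i \<in> I' \<Longrightarrow> seminorm_on V (q' i)"
    and eq: "seminorm_topology V I q = seminorm_topology V I' q'"
    and comp: "complete_seminorms V I' q'"
  shows "complete_seminorms V I q"
  unfolding complete_seminorms_def
proof (intro allI impI)
  fix s :: "nat \<Rightarrow> _"
  assume s: "(\<forall>n. s n \<in> V) \<and> (\<forall>i\<in>I. \<forall>e>0. \<exists>N. \<forall>m\<ge>N. \<forall>n\<ge>N. q i (s m - s n) < e)"
  have "\<exists>N. \<forall>m\<ge>N. \<forall>n\<ge>N. q' i (s m - s n) < e" if i: "i \<in> I'" and e: "0 < e" for i e
  proof -
    obtain F d where F: "finite F" "F \<subseteq> I" "0 < d" "\<forall>y\<in>V. (\<forall>j\<in>F. q j y < d) \<longrightarrow> q' i y < e"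
      using seminorm_topology_dominated[OF V q q'[OF i] i e eq] by blast
    have "\<forall>j\<in>F. \<exists>N. \<forall>m\<ge>N. \<forall>n\<ge>N. q j (s m - s n) < d" using s F by blast
    then obtain N where N: "\<forall>j\<in>F. \<forall>m\<ge>N j. \<forall>n\<ge>N j. q j (s m - s n) < d"
      by metis
    have M: "N j \<le> Max (insert 0 (N ` F))" if "j \<in> F" for j using F(1) that by auto
    show ?thesis
    proof (intro exI[of _ "Max (insert 0 (N ` F))"] allI impI)
      fix m n assume mn: "Max (insert 0 (N ` F)) \<le> m" "Max (insert 0 (N ` F)) \<le> n"
      have "\<forall>j\<in>F. q j (s m - s n) < d" using N M mn by (meson order_trans)
      then show "q' i (s m - s n) < e" using F(4) s op_subspace_diff[OF V] by blast
    qed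
  qed
  then obtain x where x: "x \<in> V" "\<forall>i\<in>I'. (\<lambda>n. q' i (s n - x)) \<longlonglongrightarrow> 0"
    using comp s unfolding complete_seminorms_def by metis
  have "(\<lambda>n. q i (s n - x)) \<longlonglongrightarrow> 0" if i: "i \<in> I" for i
  proof (rule tendstoI)
    fix e :: real assume e: "0 < e"
    obtain F d where F: "finite F" "F \<subseteq> I'" "0 < d" "\<forall>y\<in>V. (\<forall>j\<in>F. q' j y < d) \<longrightarrow> q i y < e"
      using seminorm_topology_dominated[OF V q' q[OF i] i e eq[symmetric]] by blast
    have "\<forall>j\<in>F. eventually (\<lambda>n. q' j (s n - x) < d) sequentially"
      using x(2) F(2,3) by (auto intro: order_tendstoD(2))
    then have "eventually (\<lambda>n. \<forall>j\<in>F. q' j (s n - x) < d) sequentially"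
      by (rule eventually_ball_finite[OF F(1)])
    then show "eventually (\<lambda>n. dist (q i (s n - x)) 0 < e) sequentially"
    proof eventually_elim
      case (elim n)
      have "s n - x \<in> V" using s x op_subspace_diff[OF V] by blast
      then show ?case using F(4) elim seminorm_on_nonneg[OF q[OF i]] by (auto simp: dist_real_def)
    qed
  qed
  with x(1) show "\<exists>x\<in>V. \<forall>i\<in>I. (\<lambda>n. q i (s n - x)) \<longlonglongrightarrow> 0" by blast
qed

lemma frechet_spaceI:
  assumes V: "op_subspace V" and I: "I \<noteq> {}" "countable I"
    and q: "\<And>i. i \<in> I \<Longrightarrow> seminorm_on V (q i)"
    and sep: "\<And>x. x \<in> V \<Longrightarrow> (\<And>i. i \<in> I \<Longrightarrow> q i x = 0) \<Longrightarrow> x = 0"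
    and comp: "complete_seminorms V I q"
  shows "frechet_space V (seminorm_topology V I q)"
proof -
  let ?h = "from_nat_into I"
  have h: "range ?h = I" using I by simp
  then have hI: "?h n \<in> I" for n by blast
  show ?thesis
    unfolding frechet_space_def
  proof (intro conjI V exI[of _ "\<lambda>n. q (?h n)"])
    show "seminorm_topology V I q = seminorm_topology V UNIV (\<lambda>n. q (?h n))"
      by (rule seminorm_topology_reindex[OF h])
    show "\<forall>i. seminorm_on V (q (?h i))" using q hI by blast
    show "\<forall>x\<in>V. (\<forall>i. q (?h i) x = 0) \<longrightarrow> x = 0"
      using sep h by (metis imageE)
    have "(\<forall>i\<in>range ?h. \<forall>e>0. \<exists>N. \<forall>m\<ge>N. \<forall>n\<ge>N. q i (s m - s n) < e) \<longleftrightarrow>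
        (\<forall>i. \<forall>e>0. \<exists>N. \<forall>m\<ge>N. \<forall>n\<ge>N. q (?h i) (s m - s n) < e)"
      and "(\<forall>i\<in>range ?h. (\<lambda>n. q i (s n - x)) \<longlonglongrightarrow> 0) \<longleftrightarrow>
        (\<forall>i. (\<lambda>n. q (?h i) (s n - x)) \<longlonglongrightarrow> 0)" for s x
      by blast+
    then show "\<forall>s. (\<forall>n. s n \<in> V) \<and> (\<forall>i. \<forall>e>0. \<exists>N. \<forall>m\<ge>N. \<forall>n\<ge>N. q (?h i) (s m - s n) < e) \<longrightarrow>
        (\<exists>x\<in>V. \<forall>i. (\<lambda>n. q (?h i) (s n - x)) \<longlonglongrightarrow> 0)"
      using comp unfolding complete_seminorms_def h by metis
  qed
qed

text \<open>Recovers completeness for a given system from the unnamed one in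
  \<open>frechet_space\<close>; it will be applied to \<open>nrm\<close>.\<close>

lemma frechet_space_complete:
  assumes fr: "frechet_space V (seminorm_topology V I q)" and I: "I \<noteq> {}"
    and q: "\<And>i. i \<in> I \<Longrightarrow> seminorm_on V (q i)"
  shows "complete_seminorms V I q"
proof -
  obtain p :: "nat \<Rightarrow> _" where p: "seminorm_topology V I q = seminorm_topology V UNIV p"
    "\<forall>i. seminorm_on V (p i)" "complete_seminorms V UNIV p" and V: "op_subspace V"
    using fr unfolding frechet_space_def complete_seminorms_def by auto
  show ?thesis
    by (rule complete_seminorms_transfer[OF V I _ q _ p(1,3)]) (use p in auto)
qed

section \<open>Normalising the unit\<close>

text \<open>The system q may take a value other than 1 at a unit of V, which need not be
  \<open>id_blinfun\<close>. If there is such a unit, q is replaced by an equivalent system. The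
  seminorm with index k, which dominates the operator norm, separates points and keeps the modified
  seminorms positive at the unit.\<close>

lemma submult_frechet_algebraI:
  assumes alg: "op_subalgebra V" and sub: "submult_seminorms V I q"
    and comp: "complete_seminorms V I q"
    and k: "k \<in> I" and kn: "\<And>x. x \<in> V \<Longrightarrow> norm x \<le> q k x"
  shows "submult_frechet_algebra V (seminorm_topology V I q)"
proof -
  have V: "op_subspace V" using alg by (simp add: op_subalgebra_def)
  have mult: "x o\<^sub>L y \<in> V" if "x \<in> V" "y \<in> V" for x y
    using alg that by (simp add: op_subalgebra_def)
  have I: "countable I" "I \<noteq> {}" and q: "\<And>i. i \<in> I \<Longrightarrow> seminorm_on V (q i)"
    and qm: "\<And>i x y. i \<in> I \<Longrightarrow> x \<in> V \<Longrightarrow> y \<in> V \<Longrightarrow> q i (x o\<^sub>L y) \<le> q i x * q i y"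
    using sub by (auto simp: submult_seminorms_def)
  have sep: "x = 0" if "x \<in> V" "\<And>i. i \<in> I \<Longrightarrow> q i x = 0" for x
    using kn[OF that(1)] that(2)[OF k] by simp
  have fs: "frechet_space V (seminorm_topology V I q)"
    by (rule frechet_spaceI[OF V I(2,1) q sep comp])
  have cm: "continuous_map (prod_topology (seminorm_topology V I q) (seminorm_topology V I q))
    (seminorm_topology V I q) (\<lambda>(x, y). x o\<^sub>L y)"
  proof (rule continuous_map_bilinear[OF V I(2) q I(2) I(2)])
    fix i assume i: "i \<in> I"
    show "\<exists>i1\<in>I. \<exists>i2\<in>I. \<forall>x\<in>V. \<forall>x'\<in>V. \<forall>y\<in>V. \<forall>y'\<in>V.
        q i ((x - x') o\<^sub>L (y - y')) \<le> q i1 (x - x') * q i2 (y - y') \<and>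
        q i ((x - x') o\<^sub>L y') \<le> q i1 (x - x') * q i2 y' \<and>
        q i (x' o\<^sub>L (y - y')) \<le> q i1 x' * q i2 (y - y') \<and>
        (x - x') o\<^sub>L (y - y') \<in> V \<and> (x - x') o\<^sub>L y' \<in> V \<and> x' o\<^sub>L (y - y') \<in> V"
      by (intro bexI[of _ i] ballI conjI qm mult op_subspace_diff[OF V] i)
  qed (use seminorm_on_0[OF V q] seminorm_on_nonneg[OF q] op_subspace_diff[OF V] mult in auto)
  have fa: "frechet_algebra V (seminorm_topology V I q)"
    by (simp add: frechet_algebra_def alg fs cm)
  \<comment> \<open>Any normalised submultiplicative system over I with the same topology suffices;
    it is enumerated by \<open>nat\<close>, with repetitions if I is finite.\<close>
  have reindex: "submult_frechet_algebra V (seminorm_topology V I q)"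
    if "submult_seminorms V I p" "unit_normalized V I p"
      "seminorm_topology V I q = seminorm_topology V I p" for p
    unfolding submult_frechet_algebra_def
  proof (intro conjI fa exI[of _ "\<lambda>n. p (from_nat_into I n)"])
    have h: "range (from_nat_into I) = I" using I by simp
    then have hI: "from_nat_into I n \<in> I" for n by blast
    show "submult_seminorms V UNIV (\<lambda>n. p (from_nat_into I n))"
      "unit_normalized V UNIV (\<lambda>n. p (from_nat_into I n))"
      using that(1,2) hI by (simp_all add: submult_seminorms_def unit_normalized_def)
    show "seminorm_topology V I q = seminorm_topology V UNIV (\<lambda>n. p (from_nat_into I n))"
      using seminorm_topology_reindex[OF h] that(3) by metis
  qed
  show ?thesis
  proof (cases "\<exists>u\<in>V. u \<noteq> 0 \<and> (\<forall>x\<in>V. (u o\<^sub>L x) = x \<and> (x o\<^sub>L u) = x)")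
    case False
    then have "unit_normalized V I q" unfolding unit_normalized_def by blast
    then show ?thesis using reindex[OF sub] by blast
  next
    case True
    then obtain u where u: "u \<in> V" "u \<noteq> 0" "\<And>x. x \<in> V \<Longrightarrow> u o\<^sub>L x = x" "\<And>x. x \<in> V \<Longrightarrow> x o\<^sub>L u = x"
      by blast
    text \<open>Adding the norm makes the seminorms nonzero at the unit; passing to the norm of the
      operator of left multiplication then makes them equal to \<open>1\<close> there.\<close>
    define p where "p i x = q i x + q k x" for i x
    have p_le: "p i (x o\<^sub>L y) \<le> p i x * p i y" if "i \<in> I" "x \<in> V" "y \<in> V" for i x y
    proof -
      have "q i (x o\<^sub>L y) + q k (x o\<^sub>L y) \<le> q i x * q i y + q k x * q k y"
        by (intro add_mono qm that k)
      also have "\<dots> \<le> (q i x + q k x) * (q i y + q k y)"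
        using seminorm_on_nonneg[OF q[OF that(1)]] seminorm_on_nonneg[OF q[OF k]] that
        by (simp add: distrib_left distrib_right)
      finally show ?thesis by (simp add: p_def)
    qed
    have p0: "0 \<le> p i x" if "i \<in> I" "x \<in> V" for i x
      using that seminorm_on_nonneg[OF q] k by (simp add: p_def)
    have pu: "0 < p i u" if "i \<in> I" for i
      using kn[OF u(1)] u(2) seminorm_on_nonneg[OF q[OF that] u(1)] zero_less_norm_iff[of u]
      by (simp add: p_def del: zero_less_norm_iff)
    have p_add: "p i (x + y) \<le> p i x + p i y" if "i \<in> I" "x \<in> V" "y \<in> V" for i x y
      using seminorm_on_add[OF q[OF that(1)] that(2,3)] seminorm_on_add[OF q[OF k] that(2,3)]
      by (simp add: p_def)
    have p_sc: "p i (scalar_op c o\<^sub>L x) = cmod c * p i x" if "i \<in> I" "x \<in> V" for i x c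
      using seminorm_on_scalar[OF q[OF that(1)] that(2)] seminorm_on_scalar[OF q[OF k] that(2)]
      by (simp add: p_def distrib_left)
    define B where "B i x = {C. 0 \<le> C \<and> (\<forall>y\<in>V. p i (x o\<^sub>L y) \<le> C * p i y)}" for i x
    define r where "r i x = Inf (B i x)" for i x
    have bdd: "bdd_below (B i x)" for i x by (rule bdd_belowI[of _ 0]) (simp add: B_def)
    have pB: "p i x \<in> B i x" if "i \<in> I" "x \<in> V" for i x
      using that p_le p0 by (simp add: B_def)
    have r_le: "r i x \<le> C" if "0 \<le> C" "\<And>y. y \<in> V \<Longrightarrow> p i (x o\<^sub>L y) \<le> C * p i y" for i x C
      unfolding r_def by (rule cInf_lower[OF _ bdd]) (simp add: B_def that)
    have r0: "0 \<le> r i x" if "i \<in> I" "x \<in> V" for i x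
      unfolding r_def by (rule cInf_greatest) (use pB[OF that] in \<open>auto simp: B_def\<close>)
    have r_bound: "p i (x o\<^sub>L y) \<le> r i x * p i y" if i: "i \<in> I" and x: "x \<in> V" and y: "y \<in> V" for i x y
    \<comment> \<open>The bound by the infimum is obtained through division by \<open>p i y\<close>.
      If that is 0, the element \<open>p i x\<close> of \<open>B i x\<close> already forces
      \<open>p i (x o\<^sub>L y) \<le> 0\<close>.\<close>
    proof (cases "p i y = 0")
      case True
      then show ?thesis using pB[OF i x] y unfolding B_def by auto
    next
      case False
      with p0[OF i y] have pos: "0 < p i y" by simp
      have "p i (x o\<^sub>L y) / p i y \<le> r i x"
        unfolding r_def
        by (rule cInf_greatest) (use pB[OF i x] pos y in \<open>auto simp: B_def divide_le_eq\<close>)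
      then show ?thesis using pos by (simp add: divide_le_eq)
    qed
    have r_sn: "seminorm_on V (r i)" if i: "i \<in> I" for i
      unfolding seminorm_on_def
    proof (intro conjI ballI allI)
      fix x assume x: "x \<in> V"
      show "0 \<le> r i x" by (rule r0[OF i x])
    next
      fix x y assume x: "x \<in> V" and y: "y \<in> V"
      show "r i (x + y) \<le> r i x + r i y"
      proof (rule r_le)
        fix z assume z: "z \<in> V"
        have "p i ((x + y) o\<^sub>L z) \<le> p i (x o\<^sub>L z) + p i (y o\<^sub>L z)"
          unfolding o_add_left by (rule p_add[OF i mult mult]) (use x y z in auto)
        then show "p i ((x + y) o\<^sub>L z) \<le> (r i x + r i y) * p i z"
          using r_bound[OF i x z] r_bound[OF i y z] by (simp add: distrib_right)
      qed (use r0[OF i] x y in simp)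
    next
      have *: "r i (scalar_op c o\<^sub>L x) \<le> cmod c * r i x" if x: "x \<in> V" for c x
      proof (rule r_le)
        fix z assume z: "z \<in> V"
        show "p i ((scalar_op c o\<^sub>L x) o\<^sub>L z) \<le> cmod c * r i x * p i z"
          unfolding blinfun_compose_assoc p_sc[OF i mult[OF x z]]
          using mult_left_mono[OF r_bound[OF i x z], of "cmod c"] by (simp add: mult.assoc)
      qed (use r0[OF i x] in simp)
      fix c x assume x: "x \<in> V"
      show "r i (scalar_op c o\<^sub>L x) = cmod c * r i x"
      proof (cases "c = 0")
        case True
        then have "r i (scalar_op c o\<^sub>L x) \<le> 0" using *[OF x, of 0] by simp
        then show ?thesis using r0[OF i op_subspace_scalar[OF V x], of c] True by simp
      next
        case False
        \<comment> \<open>The reverse inequality is the one just proved, applied to the inverse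
          scalar.\<close>
        have "r i x = r i (scalar_op (inverse c) o\<^sub>L (scalar_op c o\<^sub>L x))"
          using False by (simp flip: blinfun_compose_assoc scalar_op_mult)
        also have "\<dots> \<le> cmod (inverse c) * r i (scalar_op c o\<^sub>L x)"
          by (rule *[OF op_subspace_scalar[OF V x]])
        finally have "cmod c * r i x \<le> r i (scalar_op c o\<^sub>L x)"
          using False by (simp add: norm_inverse norm_divide field_simps)
        with *[OF x, of c] show ?thesis by simp
      qed
    qed
    have r_le_p: "r i x \<le> p i x" if "i \<in> I" "x \<in> V" for i x
      by (rule r_le) (use that p0 p_le in auto)
    \<comment> \<open>Left multiplication by x, evaluated at u, gives x back; so \<open>r i\<close>
      dominates \<open>p i\<close> up to the constant \<open>p i u\<close>.\<close>
    have p_le_r: "p i x \<le> p i u * r i x" if "i \<in> I" "x \<in> V" for i x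
      using r_bound[OF that u(1)] u(4)[OF that(2)] by (simp add: mult.commute)
    have "r i (x o\<^sub>L y) \<le> r i x * r i y" if i: "i \<in> I" and x: "x \<in> V" and y: "y \<in> V" for i x y
    proof (rule r_le)
      fix z assume z: "z \<in> V"
      have "p i (x o\<^sub>L (y o\<^sub>L z)) \<le> r i x * p i (y o\<^sub>L z)" by (rule r_bound[OF i x mult[OF y z]])
      also have "\<dots> \<le> r i x * (r i y * p i z)"
        by (rule mult_left_mono[OF r_bound[OF i y z] r0[OF i x]])
      finally show "p i ((x o\<^sub>L y) o\<^sub>L z) \<le> r i x * r i y * p i z"
        by (simp add: blinfun_compose_assoc mult.assoc)
    qed (use r0 that in simp)
    then have "submult_seminorms V I r"
      using r_sn I by (simp add: submult_seminorms_def)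
    moreover have "unit_normalized V I r"
      unfolding unit_normalized_def
    proof (intro ballI impI)
      fix v i assume v: "v \<in> V" "v \<noteq> 0 \<and> (\<forall>x\<in>V. (v o\<^sub>L x) = x \<and> (x o\<^sub>L v) = x)" and i: "i \<in> I"
      then have "v = u" using u by metis
      moreover have "r i u \<le> 1" by (rule r_le) (simp_all add: u)
      \<comment> \<open>The positive number \<open>p i u\<close> is cancelled from
        \<open>p i u \<le> p i u * r i u\<close>.\<close>
      moreover have "1 \<le> r i u" using p_le_r[OF i u(1)] pu[OF i] by simp
      ultimately show "r i v = 1" by simp
    qed
    moreover have "seminorm_topology V I q = seminorm_topology V I r"
    proof (rule seminorm_topology_eqI[OF V I(2) I(2) q r_sn])
      fix i assume i: "i \<in> I"
      have "q i x \<le> p i u * r i x" if "x \<in> V" for x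
        using p_le_r[OF i that] seminorm_on_nonneg[OF q[OF k] that] by (simp add: p_def)
      then show "\<exists>j\<in>I. \<exists>C. \<forall>x\<in>V. q i x \<le> C * r j x" using i by blast
      have "r i x \<le> 1 * (q i x + q k x)" if "x \<in> V" for x
        using r_le_p[OF i that] by (simp add: p_def)
      then show "\<exists>i1\<in>I. \<exists>i2\<in>I. \<exists>C. \<forall>x\<in>V. r i x \<le> C * (q i1 x + q i2 x)" using i k by blast
    qed
    ultimately show ?thesis by (rule reindex)
  qed
qed

section \<open>The spaces \<open>J\<^sub>k\<close>\<close>

lemma blinfun_eq_on_dense:
  fixes a b :: "'a::real_normed_vector \<Rightarrow>\<^sub>L 'b::real_normed_vector"
  assumes "closure D = UNIV" and "\<And>x. x \<in> D \<Longrightarrow> blinfun_apply a x = blinfun_apply b x"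
  shows "a = b"
proof (rule blinfun_eqI)
  fix x
  have "closed {x. blinfun_apply a x = blinfun_apply b x}"
    by (intro closed_Collect_eq continuous_intros)
  then have "closure D \<subseteq> {x. blinfun_apply a x = blinfun_apply b x}"
    by (rule closure_minimal[rotated]) (use assms(2) in blast)
  then show "blinfun_apply a x = blinfun_apply b x" using assms(1) by blast
qed

lemma norm_blinfun_tendsto_apply:
  assumes "(\<lambda>n. norm (s n - a)) \<longlonglongrightarrow> 0"
  shows "(\<lambda>n. blinfun_apply (s n) f) \<longlonglongrightarrow> blinfun_apply a f"
proof -
  have "s \<longlonglongrightarrow> a" using assms by (simp add: tendsto_norm_zero_iff LIM_zero_iff)
  then show ?thesis by (intro tendsto_intros)
qed

locale psi_star_setting =
  fixes A :: "('k::complex_hilbert \<Rightarrow>\<^sub>L 'k) set"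
    and nrm :: "nat \<Rightarrow> ('k \<Rightarrow>\<^sub>L 'k) \<Rightarrow> real"
    and TT :: "('k \<rightharpoonup> 'k) set"
  assumes psi_star: "submult_psi_star_algebra A {1..} nrm"
    and nrm_1: "\<forall>a\<in>A. nrm 1 a = norm a"
    and finite_TT: "finite TT"
    and TT: "\<forall>T\<in>TT. clinear_operator T \<and> densely_defined T \<and> closed_operator T \<and> symmetric_operator T"
begin

lemma A_subalgebra: "op_subalgebra A"
  and A_id: "id_blinfun \<in> A"
  and A_units: "A \<inter> units_in cblin = units_in A"
  and A_frechet: "frechet_space A (seminorm_topology A {1..} nrm)"
  using psi_star
  by (simp_all add: submult_psi_star_algebra_def psi_star_algebra_def frechet_algebra_def)

lemma A_subspace: "op_subspace A"
  using A_subalgebra by (simp add: op_subalgebra_def)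

lemma A_mult: "x \<in> A \<Longrightarrow> y \<in> A \<Longrightarrow> x o\<^sub>L y \<in> A"
  using A_subalgebra by (simp add: op_subalgebra_def)

lemma A_cblin: "x \<in> A \<Longrightarrow> x \<in> cblin"
  using A_subspace by (rule op_subspace_cblin)

lemma A_scalar: "scalar_op c \<in> A"
  using op_subspace_scalar[OF A_subspace A_id, of c] by simp

lemma nrm_seminorm: "1 \<le> j \<Longrightarrow> seminorm_on A (nrm j)"
  and nrm_mult: "1 \<le> j \<Longrightarrow> x \<in> A \<Longrightarrow> y \<in> A \<Longrightarrow> nrm j (x o\<^sub>L y) \<le> nrm j x * nrm j y"
  using psi_star by (simp_all add: submult_psi_star_algebra_def submult_seminorms_def)

text \<open>Only an inequality: on the zero space the identity is 0 and every seminorm vanishes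
  there; otherwise the normalisation gives the value 1.\<close>

lemma nrm_id_le: "1 \<le> j \<Longrightarrow> nrm j id_blinfun \<le> 1"
proof (cases "(id_blinfun :: 'k \<Rightarrow>\<^sub>L 'k) = 0")
  case True
  then show "1 \<le> j \<Longrightarrow> ?thesis"
    using seminorm_on_0[OF A_subspace nrm_seminorm, of j] by simp
next
  case False
  then show "1 \<le> j \<Longrightarrow> ?thesis"
    using psi_star A_id by (simp add: submult_psi_star_algebra_def unit_normalized_def)
qed

lemma A_complete: "complete_seminorms A {1..} nrm"
  by (rule frechet_space_complete[OF A_frechet]) (auto intro: nrm_seminorm)

lemma TT_dense: "T \<in> TT \<Longrightarrow> closure (dom T) = UNIV"
  using TT by (simp add: densely_defined_def)

lemma TT_add:
  assumes "T \<in> TT" "x \<in> dom T" "y \<in> dom T"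
  shows "x + y \<in> dom T" "the (T (x + y)) = the (T x) + the (T y)"
  using TT assms by (simp_all add: clinear_operator_def)

lemma TT_scale:
  assumes "T \<in> TT" "x \<in> dom T"
  shows "c *\<^sub>C x \<in> dom T" "the (T (c *\<^sub>C x)) = c *\<^sub>C the (T x)"
  using TT assms by (simp_all add: clinear_operator_def)

lemma TT_0:
  assumes "T \<in> TT"
  shows "0 \<in> dom T" "the (T 0) = 0"
proof -
  show "0 \<in> dom T" using TT assms by (simp add: clinear_operator_def)
  then show "the (T 0) = 0" using TT_scale(2)[OF assms, of 0 0] by simp
qed

lemma TT_closed:
  assumes T: "T \<in> TT" and x: "\<And>n. x n \<in> dom T" "x \<longlonglongrightarrow> u" and y: "(\<lambda>n. the (T (x n))) \<longlonglongrightarrow> v"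
  shows "u \<in> dom T" "the (T u) = v"
proof -
  have "closed {(x, y). T x = Some y}" using TT T by (simp add: closed_operator_def)
  moreover have "(x n, the (T (x n))) \<in> {(x, y). T x = Some y}" for n
    using x(1)[of n] by (auto simp: domIff)
  moreover have "(\<lambda>n. (x n, the (T (x n)))) \<longlonglongrightarrow> (u, v)" using x(2) y by (rule tendsto_Pair)
  ultimately have "(u, v) \<in> {(x, y). T x = Some y}" by (rule closed_sequentially)
  then show "u \<in> dom T" "the (T u) = v" by auto
qed

section \<open>The operators omega and the levels \<open>J k\<close> with their seminorms\<close>

lemma omega_l_eq: "is_omega_l A T x y \<Longrightarrow> omega_l A T x = y"
  unfolding omega_l_def by (rule the_equality) (auto simp: is_omega_l_def intro: blinfun_eqI)

lemma omega_r_eq: "T \<in> TT \<Longrightarrow> is_omega_r A T x y \<Longrightarrow> omega_r A T x = y"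
  unfolding omega_r_def
  by (rule the_equality, assumption, rule blinfun_eq_on_dense[OF TT_dense[of T]])
     (simp_all add: is_omega_r_def)

lemma omega_lr_eq: "S \<in> TT \<Longrightarrow> is_omega_lr A T S x y \<Longrightarrow> omega_lr A T S x = y"
  unfolding omega_lr_def
  by (rule the_equality, assumption, rule blinfun_eq_on_dense[OF TT_dense[of S]])
     (simp_all add: is_omega_lr_def)

abbreviation "J \<equiv> J_fin A TT"
abbreviation "p \<equiv> J_norm A nrm TT"
abbreviation "wl \<equiv> omega_l A"
abbreviation "wr \<equiv> omega_r A"
abbreviation "wlr \<equiv> omega_lr A"

lemma J_Suc_subset: "J (Suc k) \<subseteq> J k"
  by (cases k) auto

lemma J_antimono: "k \<le> n \<Longrightarrow> J n \<subseteq> J k"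
  by (rule lift_Suc_antimono_le[of J]) (rule J_Suc_subset)

text \<open>\<open>J_fin\<close> separates level 1, which demands that the operators omega exist,
  from the higher levels, which demand that their chosen values lie in the preceding level. This
  lemma and \<open>J_SucI\<close> restore a uniform step from k to k + 1; for k = 0, membership in A
  is part of the predicates \<open>is_omega_l\<close>, \<open>is_omega_r\<close> and
  \<open>is_omega_lr\<close>.\<close>

lemma J_SucD:
  assumes x: "x \<in> J (Suc k)"
  shows "x \<in> J k"
    and "T \<in> TT \<Longrightarrow> is_omega_l A T x (wl T x)" and "T \<in> TT \<Longrightarrow> wl T x \<in> J k"
    and "T \<in> TT \<Longrightarrow> is_omega_r A T x (wr T x)" and "T \<in> TT \<Longrightarrow> wr T x \<in> J k"
    and "T \<in> TT \<Longrightarrow> S \<in> TT \<Longrightarrow> is_omega_lr A T S x (wlr T S x)"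
    and "T \<in> TT \<Longrightarrow> S \<in> TT \<Longrightarrow> wlr T S x \<in> J k"
proof -
  have 1: "x \<in> J (Suc 0)" using x J_antimono[of "Suc 0" "Suc k"] by auto
  show "x \<in> J k" using x J_Suc_subset by blast
  show l: "is_omega_l A T x (wl T x)" if "T \<in> TT"
    using 1 that omega_l_eq by auto
  show r: "is_omega_r A T x (wr T x)" if "T \<in> TT"
    using 1 that omega_r_eq by auto
  show lr: "is_omega_lr A T S x (wlr T S x)" if "T \<in> TT" "S \<in> TT"
  proof -
    obtain y where "is_omega_lr A T S x y" using 1 \<open>T \<in> TT\<close> \<open>S \<in> TT\<close> by simp blast
    with omega_lr_eq[OF \<open>S \<in> TT\<close> this] show ?thesis by simp
  qed
  show "wl T x \<in> J k" if "T \<in> TT" using x l[OF that] that by (cases k) (auto simp: is_omega_l_def)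
  show "wr T x \<in> J k" if "T \<in> TT" using x r[OF that] that by (cases k) (auto simp: is_omega_r_def)
  show "wlr T S x \<in> J k" if "T \<in> TT" "S \<in> TT"
    using x lr[OF that] that by (cases k) (auto simp: is_omega_lr_def)
qed

lemma J_SucI:
  assumes x: "x \<in> J k"
    and l: "\<And>T. T \<in> TT \<Longrightarrow> is_omega_l A T x (l T)" "\<And>T. T \<in> TT \<Longrightarrow> l T \<in> J k"
    and r: "\<And>T. T \<in> TT \<Longrightarrow> is_omega_r A T x (r T)" "\<And>T. T \<in> TT \<Longrightarrow> r T \<in> J k"
    and lr: "\<And>T S. T \<in> TT \<Longrightarrow> S \<in> TT \<Longrightarrow> is_omega_lr A T S x (lr T S)"
      "\<And>T S. T \<in> TT \<Longrightarrow> S \<in> TT \<Longrightarrow> lr T S \<in> J k"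
  shows "x \<in> J (Suc k)"
proof (cases k)
  case 0
  then show ?thesis using x l(1) r(1) lr(1) by simp blast
next
  case (Suc m)
  then show ?thesis
    using x l r lr omega_l_eq[OF l(1)] omega_r_eq[OF _ r(1)] omega_lr_eq[OF _ lr(1)] by simp
qed

lemma J_subset_A: "x \<in> J k \<Longrightarrow> x \<in> A"
  using J_antimono[of 0 k] by auto

lemma is_omega_l_add:
  "T \<in> TT \<Longrightarrow> is_omega_l A T x u \<Longrightarrow> is_omega_l A T y v \<Longrightarrow> is_omega_l A T (x + y) (u + v)"
  by (simp add: is_omega_l_def op_subspace_add[OF A_subspace] blinfun.add_left TT_add)

lemma is_omega_r_add:
  "T \<in> TT \<Longrightarrow> is_omega_r A T x u \<Longrightarrow> is_omega_r A T y v \<Longrightarrow> is_omega_r A T (x + y) (u + v)"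
  by (simp add: is_omega_r_def op_subspace_add[OF A_subspace] blinfun.add_left)

lemma is_omega_lr_add:
  "T \<in> TT \<Longrightarrow> is_omega_lr A T S x u \<Longrightarrow> is_omega_lr A T S y v \<Longrightarrow> is_omega_lr A T S (x + y) (u + v)"
  by (simp add: is_omega_lr_def op_subspace_add[OF A_subspace] blinfun.add_left TT_add)

lemma is_omega_l_scalar:
  "T \<in> TT \<Longrightarrow> is_omega_l A T x u \<Longrightarrow> is_omega_l A T (scalar_op c o\<^sub>L x) (scalar_op c o\<^sub>L u)"
  by (simp add: is_omega_l_def op_subspace_scalar[OF A_subspace] TT_scale)

lemma is_omega_r_scalar:
  "T \<in> TT \<Longrightarrow> is_omega_r A T x u \<Longrightarrow> is_omega_r A T (scalar_op c o\<^sub>L x) (scalar_op c o\<^sub>L u)"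
  by (simp add: is_omega_r_def op_subspace_scalar[OF A_subspace])

lemma is_omega_lr_scalar:
  "T \<in> TT \<Longrightarrow> is_omega_lr A T S x u \<Longrightarrow> is_omega_lr A T S (scalar_op c o\<^sub>L x) (scalar_op c o\<^sub>L u)"
  by (simp add: is_omega_lr_def op_subspace_scalar[OF A_subspace] TT_scale)

lemma is_omega_l_0: "T \<in> TT \<Longrightarrow> is_omega_l A T 0 0"
  by (simp add: is_omega_l_def op_subspace_0[OF A_subspace] TT_0)

lemma is_omega_r_0: "T \<in> TT \<Longrightarrow> is_omega_r A T 0 0"
  by (simp add: is_omega_r_def op_subspace_0[OF A_subspace])

lemma is_omega_lr_0: "T \<in> TT \<Longrightarrow> is_omega_lr A T S 0 0"
  by (simp add: is_omega_lr_def op_subspace_0[OF A_subspace] TT_0)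

lemma omega_add:
  assumes "x \<in> J (Suc k)" "y \<in> J (Suc k)" and T: "T \<in> TT" "S \<in> TT"
  shows "wl T (x + y) = wl T x + wl T y" "wr T (x + y) = wr T x + wr T y"
    "wlr T S (x + y) = wlr T S x + wlr T S y"
  using J_SucD[OF assms(1)] J_SucD[OF assms(2)] T
  by (simp_all add: omega_l_eq[OF is_omega_l_add] omega_r_eq[OF _ is_omega_r_add]
      omega_lr_eq[OF _ is_omega_lr_add])

lemma omega_scalar:
  assumes "x \<in> J (Suc k)" and T: "T \<in> TT" "S \<in> TT"
  shows "wl T (scalar_op c o\<^sub>L x) = scalar_op c o\<^sub>L wl T x"
    "wr T (scalar_op c o\<^sub>L x) = scalar_op c o\<^sub>L wr T x"
    "wlr T S (scalar_op c o\<^sub>L x) = scalar_op c o\<^sub>L wlr T S x"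
  using J_SucD[OF assms(1)] T
  by (simp_all add: omega_l_eq[OF is_omega_l_scalar] omega_r_eq[OF _ is_omega_r_scalar]
      omega_lr_eq[OF _ is_omega_lr_scalar])

lemma J_subspace: "op_subspace (J k)"
proof (induction k)
  case 0
  then show ?case by (simp add: A_subspace)
next
  case (Suc k)
  show ?case
    unfolding op_subspace_def
  proof (intro conjI ballI allI)
    show "J (Suc k) \<subseteq> cblin" using J_subset_A A_cblin by blast
    show "0 \<in> J (Suc k)"
      by (rule J_SucI[where l = "\<lambda>_. 0" and r = "\<lambda>_. 0" and lr = "\<lambda>_ _. 0"])
         (auto intro: op_subspace_0[OF Suc] is_omega_l_0 is_omega_r_0 is_omega_lr_0)
  next
    fix x y assume "x \<in> J (Suc k)" "y \<in> J (Suc k)"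
    note x = J_SucD[OF this(1)] and y = J_SucD[OF this(2)]
    show "x + y \<in> J (Suc k)"
      by (rule J_SucI[where l = "\<lambda>T. wl T x + wl T y" and r = "\<lambda>T. wr T x + wr T y"
            and lr = "\<lambda>T S. wlr T S x + wlr T S y"])
         (intro op_subspace_add[OF Suc] is_omega_l_add is_omega_r_add is_omega_lr_add x y; assumption)+
  next
    fix c x assume "x \<in> J (Suc k)"
    note x = J_SucD[OF this(1)]
    show "scalar_op c o\<^sub>L x \<in> J (Suc k)"
      by (rule J_SucI[where l = "\<lambda>T. scalar_op c o\<^sub>L wl T x" and r = "\<lambda>T. scalar_op c o\<^sub>L wr T x"
            and lr = "\<lambda>T S. scalar_op c o\<^sub>L wlr T S x"])
         (intro op_subspace_scalar[OF Suc] is_omega_l_scalar is_omega_r_scalar is_omega_lr_scalar x;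
           assumption)+
  qed
qed

lemma p_seminorm:
  assumes j: "1 \<le> j"
  shows "seminorm_on (J k) (p j k)"
proof (induction k)
  case 0
  then show ?case using nrm_seminorm[OF j] by (simp add: seminorm_on_def)
next
  case (Suc k)
  show ?case
    unfolding seminorm_on_def
  proof (intro conjI ballI allI)
    fix x assume "x \<in> J (Suc k)"
    note x = J_SucD[OF this]
    show "0 \<le> p j (Suc k) x"
      using x by (auto intro!: add_nonneg_nonneg sum_nonneg seminorm_on_nonneg[OF Suc])
  next
    fix x y assume xy: "x \<in> J (Suc k)" "y \<in> J (Suc k)"
    note x = J_SucD[OF xy(1)] and y = J_SucD[OF xy(2)]
    have "p j (Suc k) (x + y) \<le> (p j k x + p j k y) +
      (\<Sum>T\<in>TT. (p j k (wl T x) + p j k (wl T y)) + (p j k (wr T x) + p j k (wr T y))) +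
      (\<Sum>T\<in>TT. \<Sum>S\<in>TT. p j k (wlr T S x) + p j k (wlr T S y))"
      unfolding J_norm.simps
      by (intro add_mono sum_mono)
         (auto simp: omega_add[OF xy] x y intro!: seminorm_on_add[OF Suc])
    then show "p j (Suc k) (x + y) \<le> p j (Suc k) x + p j (Suc k) y"
      by (simp add: sum.distrib)
  next
    fix c x assume x': "x \<in> J (Suc k)"
    note x = J_SucD[OF this]
    show "p j (Suc k) (scalar_op c o\<^sub>L x) = cmod c * p j (Suc k) x"
      by (simp add: omega_scalar[OF x'] seminorm_on_scalar[OF Suc] x distrib_left sum_distrib_left
          cong: sum.cong)
  qed
qed

lemma p_nonneg: "1 \<le> j \<Longrightarrow> x \<in> J k \<Longrightarrow> 0 \<le> p j k x"
  using p_seminorm by (rule seminorm_on_nonneg)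

lemma p_mono:
  assumes j: "1 \<le> j" and x: "x \<in> J n" and kn: "k \<le> n"
  shows "p j k x \<le> p j n x"
  using kn x
proof (induction n rule: dec_induct)
  case (step n)
  note x = J_SucD[OF step.prems]
  have "p j n x \<le> p j (Suc n) x"
    using x by (auto intro!: add_nonneg_nonneg sum_nonneg p_nonneg[OF j])
  then show ?case using step.IH[OF x(1)] by simp
qed simp

text \<open>The index j = 1 ties every level to the operator norm: convergence in \<open>J n\<close>
  implies convergence of operators.\<close>

lemma norm_le_p: "x \<in> J n \<Longrightarrow> norm x \<le> p 1 n x"
  using p_mono[of 1 x n 0] nrm_1 J_subset_A[of x n] by simp

section \<open>Products and the operators omega\<close>

lemma is_omega_l_mult:
  "is_omega_l A T x u \<Longrightarrow> y \<in> A \<Longrightarrow> is_omega_l A T (x o\<^sub>L y) (u o\<^sub>L y)"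
  by (simp add: is_omega_l_def A_mult)

lemma is_omega_r_mult:
  "is_omega_r A T y v \<Longrightarrow> x \<in> A \<Longrightarrow> is_omega_r A T (x o\<^sub>L y) (x o\<^sub>L v)"
  by (simp add: is_omega_r_def A_mult)

lemma is_omega_lr_mult:
  "is_omega_l A T x u \<Longrightarrow> is_omega_r A S y v \<Longrightarrow> is_omega_lr A T S (x o\<^sub>L y) (u o\<^sub>L v)"
  by (simp add: is_omega_l_def is_omega_r_def is_omega_lr_def A_mult)

lemma J_sandwich:
  assumes a: "a \<in> A"
  shows "x \<in> J k \<Longrightarrow> y \<in> J k \<Longrightarrow> x o\<^sub>L a o\<^sub>L y \<in> J k \<and>
    (\<forall>j\<ge>1. p j k (x o\<^sub>L a o\<^sub>L y) \<le> p j k x * nrm j a * p j k y)"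
proof (induction k arbitrary: x y)
  case 0
  have "nrm j (x o\<^sub>L a o\<^sub>L y) \<le> nrm j x * nrm j a * nrm j y" if "1 \<le> j" for j
  proof -
    have "nrm j (x o\<^sub>L a o\<^sub>L y) \<le> nrm j (x o\<^sub>L a) * nrm j y"
      using 0 a that by (intro nrm_mult) (auto intro: A_mult)
    also have "\<dots> \<le> (nrm j x * nrm j a) * nrm j y"
      using 0 a that by (intro mult_right_mono nrm_mult seminorm_on_nonneg[OF nrm_seminorm]) auto
    finally show ?thesis .
  qed
  then show ?case using 0 a by (auto intro: A_mult)
next
  case (Suc k)
  note x = J_SucD[OF Suc.prems(1)] and y = J_SucD[OF Suc.prems(2)]
  let ?z = "x o\<^sub>L a o\<^sub>L y"
  have yA: "y \<in> A" "x \<in> A" using x(1) y(1) J_subset_A by auto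
  have l: "is_omega_l A T ?z (wl T x o\<^sub>L a o\<^sub>L y)" if "T \<in> TT" for T
    using is_omega_l_mult[OF x(2)[OF that], of "a o\<^sub>L y"] A_mult[OF a yA(1)]
    by (simp add: blinfun_compose_assoc)
  have r: "is_omega_r A T ?z (x o\<^sub>L a o\<^sub>L wr T y)" if "T \<in> TT" for T
    using is_omega_r_mult[OF y(4)[OF that], of "x o\<^sub>L a"] A_mult[OF yA(2) a] by simp
  have lr: "is_omega_lr A T S ?z (wl T x o\<^sub>L a o\<^sub>L wr S y)" if "T \<in> TT" "S \<in> TT" for T S
    using is_omega_lr_mult[OF is_omega_l_mult[OF x(2)[OF that(1)] a] y(4)[OF that(2)]] by simp
  have mem: "?z \<in> J (Suc k)"
    by (rule J_SucI[OF _ l _ r _ lr]) (use Suc.IH x y in auto)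
  have "p j (Suc k) ?z \<le> p j (Suc k) x * nrm j a * p j (Suc k) y" if j: "1 \<le> j" for j
  proof -
    let ?m = "nrm j a"
    have b: "p j k (u o\<^sub>L a o\<^sub>L v) \<le> p j k u * ?m * p j k v" if "u \<in> J k" "v \<in> J k" for u v
      using Suc.IH that j by blast
    have m: "0 \<le> ?m" by (rule seminorm_on_nonneg[OF nrm_seminorm[OF j] a])
    have "p j (Suc k) ?z = p j k ?z +
        (\<Sum>T\<in>TT. p j k (wl T x o\<^sub>L a o\<^sub>L y) + p j k (x o\<^sub>L a o\<^sub>L wr T y)) +
        (\<Sum>T\<in>TT. \<Sum>S\<in>TT. p j k (wl T x o\<^sub>L a o\<^sub>L wr S y))"
      by (simp add: omega_l_eq[OF l] omega_r_eq[OF _ r] omega_lr_eq[OF _ lr] cong: sum.cong)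
    also have "\<dots> \<le> p j k x * ?m * p j k y +
        (\<Sum>T\<in>TT. p j k (wl T x) * ?m * p j k y + p j k x * ?m * p j k (wr T y)) +
        (\<Sum>T\<in>TT. \<Sum>S\<in>TT. p j k (wl T x) * ?m * p j k (wr S y))"
      by (intro add_mono sum_mono b) (auto simp: x y)
    \<comment> \<open>The four kinds of terms are exactly the expansion of this product. Enlarging
      each outer factor to \<open>p j (Suc k)\<close> only adds nonnegative terms.\<close>
    also have "\<dots> = (p j k x + (\<Sum>T\<in>TT. p j k (wl T x))) * ?m * (p j k y + (\<Sum>T\<in>TT. p j k (wr T y)))"
      by (simp add: sum.distrib distrib_left distrib_right sum_distrib_left sum_distrib_right
          mult.assoc) (rule sum.swap)
    also have "\<dots> \<le> p j (Suc k) x * ?m * p j (Suc k) y"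
      using x y m p_nonneg[OF j]
      by (intro mult_mono mult_nonneg_nonneg)
         (auto simp: sum.distrib intro!: add_nonneg_nonneg sum_nonneg)
    finally show ?thesis .
  qed
  with mem show ?case by blast
qed

lemma J_mult:
  assumes "x \<in> J k" "y \<in> J k"
  shows "x o\<^sub>L y \<in> J k" and "1 \<le> j \<Longrightarrow> p j k (x o\<^sub>L y) \<le> p j k x * p j k y"
proof -
  note s = J_sandwich[OF A_id assms, simplified]
  show "x o\<^sub>L y \<in> J k" using s by simp
  assume j: "1 \<le> j"
  have "p j k (x o\<^sub>L y) \<le> p j k x * nrm j id_blinfun * p j k y" using s j by simp
  also have "\<dots> \<le> p j k x * 1 * p j k y"
    by (intro mult_right_mono mult_left_mono nrm_id_le j p_nonneg assms)
  finally show "p j k (x o\<^sub>L y) \<le> p j k x * p j k y" by simp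
qed

section \<open>Completeness of the levels \<open>J k\<close>\<close>

lemma Cauchy_dominated:
  assumes "\<forall>j\<in>I. \<forall>e>0. \<exists>N. \<forall>m\<ge>N. \<forall>n\<ge>N. (P j m n :: real) < e"
    and "\<And>j m n. j \<in> I \<Longrightarrow> Q j m n \<le> P j m n"
  shows "\<forall>j\<in>I. \<forall>e>0. \<exists>N. \<forall>m\<ge>N. \<forall>n\<ge>N. (Q j m n :: real) < e"
  using assms by (meson le_less_trans)

lemma omega_diff:
  assumes xy: "x \<in> J (Suc k)" "y \<in> J (Suc k)" and T: "T \<in> TT" "S \<in> TT"
  shows "wl T (x - y) = wl T x - wl T y" "wr T (x - y) = wr T x - wr T y"
    "wlr T S (x - y) = wlr T S x - wlr T S y"
  using omega_add[OF xy(1) op_subspace_scalar[OF J_subspace xy(2)] T, of "-1"]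
    omega_scalar[OF xy(2) T, of "-1"] by (simp_all add: diff_eq_scalar_op)

text \<open>Each value is one of the nonnegative summands; finiteness of \<open>TT\<close> lets the
  sum dominate it.\<close>

lemma omega_le_p:
  assumes j: "1 \<le> j" and x: "x \<in> J (Suc k)" and T: "T \<in> TT" "S \<in> TT"
  shows "p j k (wl T x) \<le> p j (Suc k) x" "p j k (wr T x) \<le> p j (Suc k) x"
    "p j k (wlr T S x) \<le> p j (Suc k) x"
proof -
  note x = J_SucD[OF x]
  note n = p_nonneg[OF j]
  have 1: "p j k (wl T x) + p j k (wr T x) \<le> (\<Sum>T\<in>TT. p j k (wl T x) + p j k (wr T x))"
    by (rule member_le_sum[OF T(1) _ finite_TT, of "\<lambda>T. p j k (wl T x) + p j k (wr T x)"])
       (use x n in auto)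
  have 2: "p j k (wlr T S x) \<le> (\<Sum>S\<in>TT. p j k (wlr T S x))"
    by (rule member_le_sum[OF T(2) _ finite_TT, of "\<lambda>S. p j k (wlr T S x)"]) (use x n T in auto)
  have 3: "(\<Sum>S\<in>TT. p j k (wlr T S x)) \<le> (\<Sum>T\<in>TT. \<Sum>S\<in>TT. p j k (wlr T S x))"
    by (rule member_le_sum[OF T(1) _ finite_TT, of "\<lambda>T. \<Sum>S\<in>TT. p j k (wlr T S x)"])
       (use x n T in \<open>auto intro: sum_nonneg\<close>)
  have "0 \<le> p j k (wl T x)" "0 \<le> p j k (wr T x)" "0 \<le> p j k x" "0 \<le> p j k (wlr T S x)"
    using x n T by auto
  then show "p j k (wl T x) \<le> p j (Suc k) x" "p j k (wr T x) \<le> p j (Suc k) x"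
    "p j k (wlr T S x) \<le> p j (Suc k) x" using 1 2 3 by auto
qed

text \<open>For a Cauchy sequence s at level k + 1, the sequences \<open>s n\<close>,
  \<open>wl T (s n)\<close>, \<open>wr T (s n)\<close> and \<open>wlr T S (s n)\<close> are Cauchy
  at level k and have limits there. It remains to recognise the last three limits as the operators
  omega of the first. Closedness of T does this for the left and the two-sided ones; for the right
  ones pointwise convergence is enough.\<close>

lemma J_complete: "complete_seminorms (J k) {1..} (\<lambda>j. p j k)"
proof (induction k)
  case 0
  show ?case using A_complete by (simp add: complete_seminorms_def)
next
  case (Suc k)
  show ?case
    unfolding complete_seminorms_def
  proof (intro allI impI)
    fix s :: "nat \<Rightarrow> _"
    assume "(\<forall>n. s n \<in> J (Suc k)) \<and>
      (\<forall>j\<in>{1..}. \<forall>e>0. \<exists>N. \<forall>m\<ge>N. \<forall>n\<ge>N. p j (Suc k) (s m - s n) < e)"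
    then have s: "\<And>n. s n \<in> J (Suc k)"
      and C: "\<forall>j\<in>{1..}. \<forall>e>0. \<exists>N. \<forall>m\<ge>N. \<forall>n\<ge>N. p j (Suc k) (s m - s n) < e" by auto
    note sD = J_SucD[OF s]
    have sd: "s m - s n \<in> J (Suc k)" for m n by (rule op_subspace_diff[OF J_subspace s s])
    have lim: "\<exists>x\<in>J k. \<forall>j\<in>{1..}. (\<lambda>n. p j k (t n - x)) \<longlonglongrightarrow> 0"
      if "\<And>n. t n \<in> J k" "\<And>j m n. 1 \<le> j \<Longrightarrow> p j k (t m - t n) \<le> p j (Suc k) (s m - s n)" for t
      using Suc Cauchy_dominated[OF C, of "\<lambda>j m n. p j k (t m - t n)"] that
      unfolding complete_seminorms_def by simp
    obtain x where x: "x \<in> J k" "\<forall>j\<in>{1..}. (\<lambda>n. p j k (s n - x)) \<longlonglongrightarrow> 0"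
      using lim[OF sD(1) p_mono[OF _ sd]] by auto
    have "\<exists>y\<in>J k. \<forall>j\<in>{1..}. (\<lambda>n. p j k (wl T (s n) - y)) \<longlonglongrightarrow> 0" if "T \<in> TT" for T
      using omega_le_p(1)[OF _ sd that that]
      by (intro lim sD that) (simp add: omega_diff(1)[OF s s that that])
    then obtain l where l: "\<And>T. T \<in> TT \<Longrightarrow> l T \<in> J k"
      "\<And>T. T \<in> TT \<Longrightarrow> \<forall>j\<in>{1..}. (\<lambda>n. p j k (wl T (s n) - l T)) \<longlonglongrightarrow> 0" by metis
    have "\<exists>y\<in>J k. \<forall>j\<in>{1..}. (\<lambda>n. p j k (wr T (s n) - y)) \<longlonglongrightarrow> 0" if "T \<in> TT" for T
      using omega_le_p(2)[OF _ sd that that]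
      by (intro lim sD that) (simp add: omega_diff(2)[OF s s that that])
    then obtain r where r: "\<And>T. T \<in> TT \<Longrightarrow> r T \<in> J k"
      "\<And>T. T \<in> TT \<Longrightarrow> \<forall>j\<in>{1..}. (\<lambda>n. p j k (wr T (s n) - r T)) \<longlonglongrightarrow> 0" by metis
    have "\<exists>y\<in>J k. \<forall>j\<in>{1..}. (\<lambda>n. p j k (wlr T S (s n) - y)) \<longlonglongrightarrow> 0"
      if "T \<in> TT" "S \<in> TT" for T S
      using omega_le_p(3)[OF _ sd that]
      by (intro lim sD that) (simp add: omega_diff(3)[OF s s that])
    then obtain lr where lr: "\<And>T S. T \<in> TT \<Longrightarrow> S \<in> TT \<Longrightarrow> lr T S \<in> J k"
      "\<And>T S. T \<in> TT \<Longrightarrow> S \<in> TT \<Longrightarrow> \<forall>j\<in>{1..}. (\<lambda>n. p j k (wlr T S (s n) - lr T S)) \<longlonglongrightarrow> 0"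
      by metis
    \<comment> \<open>Closedness is a statement about vectors, so convergence in
      \<open>p 1 k\<close> is turned into pointwise convergence by way of the operator norm.\<close>
    have app: "(\<lambda>n. blinfun_apply (t n) f) \<longlonglongrightarrow> blinfun_apply y f"
      if "\<And>n. t n \<in> J k" "y \<in> J k" "\<forall>j\<in>{1..}. (\<lambda>n. p j k (t n - y)) \<longlonglongrightarrow> 0" for t y f
    proof (rule norm_blinfun_tendsto_apply)
      show "(\<lambda>n. norm (t n - y)) \<longlonglongrightarrow> 0"
        by (rule tendsto_sandwich[of "\<lambda>_. 0" _ _ "\<lambda>n. p 1 k (t n - y)"])
           (use that norm_le_p op_subspace_diff[OF J_subspace] in auto)
    qed
    have sx: "(\<lambda>n. blinfun_apply (s n) f) \<longlonglongrightarrow> blinfun_apply x f" for f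
      by (rule app[OF sD(1) x])
    have isl: "is_omega_l A T x (l T)" if T: "T \<in> TT" for T
      unfolding is_omega_l_def
    proof (intro conjI allI)
      show "l T \<in> A" by (rule J_subset_A[OF l(1)[OF T]])
      fix f
      have d: "blinfun_apply (s n) f \<in> dom T"
        "the (T (blinfun_apply (s n) f)) = blinfun_apply (wl T (s n)) f" for n
        using sD(2)[OF T, of n] by (auto simp: is_omega_l_def)
      have c: "(\<lambda>n. the (T (blinfun_apply (s n) f))) \<longlonglongrightarrow> blinfun_apply (l T) f"
        unfolding d(2) by (rule app[OF sD(3)[OF T] l(1,2)[OF T]])
      show "blinfun_apply x f \<in> dom T" by (rule TT_closed(1)[OF T d(1) sx c])
      show "blinfun_apply (l T) f = the (T (blinfun_apply x f))"
        by (rule TT_closed(2)[OF T d(1) sx c, symmetric])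
    qed
    have isr: "is_omega_r A T x (r T)" if T: "T \<in> TT" for T
      unfolding is_omega_r_def
    proof (intro conjI ballI)
      show "r T \<in> A" by (rule J_subset_A[OF r(1)[OF T]])
      fix f assume f: "f \<in> dom T"
      have d: "blinfun_apply (wr T (s n)) f = blinfun_apply (s n) (the (T f))" for n
        using sD(4)[OF T, of n] f by (auto simp: is_omega_r_def)
      show "blinfun_apply (r T) f = blinfun_apply x (the (T f))"
        by (rule LIMSEQ_unique[OF app[OF sD(5)[OF T] r(1,2)[OF T]]]) (simp add: d sx)
    qed
    have islr: "is_omega_lr A T S x (lr T S)" if T: "T \<in> TT" "S \<in> TT" for T S
      unfolding is_omega_lr_def
    proof (intro conjI ballI allI)
      show "lr T S \<in> A" by (rule J_subset_A[OF lr(1)[OF T]])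
      show "blinfun_apply x f \<in> dom T" for f
        using isl[OF T(1)] by (simp add: is_omega_l_def)
      fix f assume f: "f \<in> dom S"
      let ?g = "the (S f)"
      have d: "blinfun_apply (s n) ?g \<in> dom T"
        "the (T (blinfun_apply (s n) ?g)) = blinfun_apply (wlr T S (s n)) f" for n
        using sD(6)[OF T, of n] f by (auto simp: is_omega_lr_def)
      have c: "(\<lambda>n. the (T (blinfun_apply (s n) ?g))) \<longlonglongrightarrow> blinfun_apply (lr T S) f"
        unfolding d(2) by (rule app[OF sD(7)[OF T] lr(1,2)[OF T]])
      show "blinfun_apply (lr T S) f = the (T (blinfun_apply x ?g))"
        by (rule TT_closed(2)[OF T(1) d(1) sx c, symmetric])
    qed
    have xJ: "x \<in> J (Suc k)" by (rule J_SucI[OF x(1) isl l(1) isr r(1) islr lr(1)])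
    have "(\<lambda>n. p j (Suc k) (s n - x)) \<longlonglongrightarrow> 0" if j: "j \<in> {1..}" for j
    proof -
      \<comment> \<open>By additivity the operators omega of \<open>s n - x\<close> are differences
        from the limits l, r and lr, so this norm is a finite sum of null sequences.\<close>
      have eq: "p j (Suc k) (s n - x) = p j k (s n - x) +
          (\<Sum>T\<in>TT. p j k (wl T (s n) - l T) + p j k (wr T (s n) - r T)) +
          (\<Sum>T\<in>TT. \<Sum>S\<in>TT. p j k (wlr T S (s n) - lr T S))" for n
        by (simp add: omega_diff[OF s xJ] omega_l_eq[OF isl] omega_r_eq[OF _ isr]
            omega_lr_eq[OF _ islr] cong: sum.cong)
      have "(\<lambda>n. p j (Suc k) (s n - x)) \<longlonglongrightarrow> 0 + (\<Sum>T\<in>TT. 0 + 0) + (\<Sum>T\<in>TT. \<Sum>S\<in>TT. 0)"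
        unfolding eq by (intro tendsto_add tendsto_sum) (use x(2) l(2) r(2) lr(2) j in auto)
      then show ?thesis by simp
    qed
    with xJ show "\<exists>x\<in>J (Suc k). \<forall>j\<in>{1..}. (\<lambda>n. p j (Suc k) (s n - x)) \<longlonglongrightarrow> 0" by blast
  qed
qed

section \<open>Multiplication by \<open>\<Psi>\<^sup>\<infinity>\<close>\<close>

text \<open>Unlike \<open>Psi\<close>, these spaces impose no condition on adjoints and are therefore evidently
  closed under differences.\<close>

primrec pre_Psi :: "nat \<Rightarrow> ('k \<Rightarrow>\<^sub>L 'k) set" where
  "pre_Psi 0 = A"
| "pre_Psi (Suc r) = {a \<in> pre_Psi r. \<forall>T\<in>TT. \<exists>b\<in>pre_Psi r. is_delta A T a b}"

abbreviation "q \<equiv> Psi_norm A nrm TT"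

lemma delta_eq: "T \<in> TT \<Longrightarrow> is_delta A T a b \<Longrightarrow> delta A T a = b"
  unfolding delta_def
  by (rule the_equality, assumption, rule blinfun_eq_on_dense[OF TT_dense[of T]])
     (simp_all add: is_delta_def)

lemma pre_Psi_SucD:
  assumes "a \<in> pre_Psi (Suc r)"
  shows "a \<in> pre_Psi r" and "T \<in> TT \<Longrightarrow> is_delta A T a (delta A T a)"
    and "T \<in> TT \<Longrightarrow> delta A T a \<in> pre_Psi r"
  using assms delta_eq by auto

lemma pre_Psi_subset_A: "a \<in> pre_Psi r \<Longrightarrow> a \<in> A"
  by (induction r) auto

text \<open>The multiplication estimates are proved on the spaces \<open>pre_Psi\<close> and reach
  \<open>Psi_inf\<close> through this inclusion. \<open>Psi\<close> has two initial levels, hence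
  the induction over all smaller r.\<close>

lemma Psi_subset_pre_Psi: "Psi A TT r \<subseteq> pre_Psi r"
proof (induction r rule: less_induct)
  case (less r)
  consider "r = 0" | "r = Suc 0" | n where "r = Suc (Suc n)" by (metis not0_implies_Suc)
  then show ?case
  proof cases
    case 2
    have "\<exists>b\<in>A. is_delta A T a b" if "is_delta A T a b" for T a b
      using that by (auto simp: is_delta_def)
    then show ?thesis using 2 by (auto simp: delta_domain_def)
  next
    case 3
    show ?thesis
    proof
      fix a assume "a \<in> Psi A TT r"
      then have a: "a \<in> Psi A TT (Suc n)" "\<And>T. T \<in> TT \<Longrightarrow> delta A T a \<in> Psi A TT (Suc n)"
        by (auto simp: 3)
      have sub: "Psi A TT (Suc n) \<subseteq> pre_Psi (Suc n)" by (rule less) (simp add: 3)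
      with a show "a \<in> pre_Psi r"
        unfolding 3 pre_Psi.simps(2)[of "Suc n"] using pre_Psi_SucD(2) by blast
    qed
  qed simp
qed

lemma is_delta_diff:
  assumes T: "T \<in> TT" and a: "is_delta A T a u" and b: "is_delta A T b v"
  shows "is_delta A T (a - b) (u - v)"
  unfolding is_delta_def
proof (intro conjI ballI)
  show "u - v \<in> A" using a b op_subspace_diff[OF A_subspace] by (simp add: is_delta_def)
  fix x assume x: "x \<in> dom T"
  have d: "blinfun_apply a x \<in> dom T" "blinfun_apply b x \<in> dom T"
    and e: "blinfun_apply u x = \<i> *\<^sub>C (the (T (blinfun_apply a x)) - blinfun_apply a (the (T x)))"
      "blinfun_apply v x = \<i> *\<^sub>C (the (T (blinfun_apply b x)) - blinfun_apply b (the (T x)))"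
    using a b x by (auto simp: is_delta_def)
  have D: "blinfun_apply a x - blinfun_apply b x = blinfun_apply a x + (- 1) *\<^sub>C blinfun_apply b x"
    by (simp add: scaleC_minus_one)
  have m: "blinfun_apply a x - blinfun_apply b x \<in> dom T"
    "the (T (blinfun_apply a x - blinfun_apply b x)) = the (T (blinfun_apply a x)) - the (T (blinfun_apply b x))"
    unfolding D using TT_add[OF T d(1) TT_scale(1)[OF T d(2), of "-1"]] TT_scale(2)[OF T d(2), of "-1"]
    by (simp_all add: scaleC_minus_one)
  show "blinfun_apply (a - b) x \<in> dom T" using m by (simp add: blinfun.diff_left)
  show "blinfun_apply (u - v) x =
      \<i> *\<^sub>C (the (T (blinfun_apply (a - b) x)) - blinfun_apply (a - b) (the (T x)))"
    using m(2) by (simp add: blinfun.diff_left e flip: scaleC_diff_right) (simp add: algebra_simps)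
qed

lemma pre_Psi_diff: "a \<in> pre_Psi r \<Longrightarrow> b \<in> pre_Psi r \<Longrightarrow> a - b \<in> pre_Psi r"
proof (induction r arbitrary: a b)
  case 0
  then show ?case using op_subspace_diff[OF A_subspace] by simp
next
  case (Suc r)
  then show ?case using is_delta_diff by simp blast
qed

lemma q_nonneg: "1 \<le> j \<Longrightarrow> a \<in> pre_Psi r \<Longrightarrow> 0 \<le> q r j a"
proof (induction r arbitrary: a)
  case 0
  then show ?case using seminorm_on_nonneg[OF nrm_seminorm] by simp
next
  case (Suc r)
  then show ?case using pre_Psi_SucD[OF Suc.prems(2)] by (auto intro!: add_nonneg_nonneg sum_nonneg)
qed

lemma q_0: "1 \<le> j \<Longrightarrow> q r j 0 = 0"
proof (induction r)
  case 0
  then show ?case using seminorm_on_0[OF A_subspace nrm_seminorm] by simp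
next
  case (Suc r)
  have "is_delta A T 0 0" if "T \<in> TT" for T
    using that by (simp add: is_delta_def op_subspace_0[OF A_subspace] TT_0)
  then have "delta A T 0 = 0" if "T \<in> TT" for T using that delta_eq by blast
  then show ?case using Suc by simp
qed

text \<open>Multiplying the defining identity of the derivation b of a by -i gives the commutation
  rule Ta = aT - ib, the source of the factors i below.\<close>

lemma delta_apply:
  assumes "is_delta A T a b" "x \<in> dom T"
  shows "blinfun_apply a x \<in> dom T"
    and "the (T (blinfun_apply a x)) = blinfun_apply a (the (T x)) - \<i> *\<^sub>C blinfun_apply b x"
  using assms by (auto simp: is_delta_def scaleC_scaleC scaleC_minus_one)

lemma is_omega_l_left_mult:
  assumes d: "is_delta A T a b" and x: "is_omega_l A T x u" "x \<in> A" "a \<in> A"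
  shows "is_omega_l A T (a o\<^sub>L x) ((a o\<^sub>L u) - (scalar_op \<i> o\<^sub>L (b o\<^sub>L x)))"
proof -
  have "b \<in> A" using d by (simp add: is_delta_def)
  then show ?thesis
    using x delta_apply[OF d]
    by (simp add: is_omega_l_def A_mult A_scalar op_subspace_diff[OF A_subspace] blinfun.diff_left)
qed

text \<open>On the domain of S one has TaxS = aTxS - ibxS, and the last term is bounded because xS
  extends to v.\<close>

lemma is_omega_lr_left_mult:
  assumes d: "is_delta A T a b" and x: "is_omega_lr A T S x u" "is_omega_r A S x v" "a \<in> A"
  shows "is_omega_lr A T S (a o\<^sub>L x) ((a o\<^sub>L u) - (scalar_op \<i> o\<^sub>L (b o\<^sub>L v)))"
proof -
  have "b \<in> A" using d by (simp add: is_delta_def)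
  then show ?thesis
    using x delta_apply[OF d]
    by (simp add: is_omega_lr_def is_omega_r_def A_mult A_scalar op_subspace_diff[OF A_subspace]
        blinfun.diff_left)
qed

text \<open>Here T has to be brought next to x, so the rule is read as aT = Ta + ib and the sign
  changes; xT then extends to u.\<close>

lemma is_omega_r_right_mult:
  assumes d: "is_delta A T a b" and x: "is_omega_r A T x u" "x \<in> A" "a \<in> A"
  shows "is_omega_r A T (x o\<^sub>L a) ((u o\<^sub>L a) + (scalar_op \<i> o\<^sub>L (x o\<^sub>L b)))"
proof -
  have "b \<in> A" using d by (simp add: is_delta_def)
  then show ?thesis
    using x delta_apply[OF d] cblinD[OF A_cblin[OF x(2)]]
    by (simp add: is_omega_r_def A_mult A_scalar op_subspace_add[OF A_subspace] blinfun.add_left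
        blinfun.diff_right)
qed

text \<open>Writing aS = Sa + ib splits the vector to which T is applied. T may be applied to each
  summand because x maps every vector into the domain of T.\<close>

lemma is_omega_lr_right_mult:
  assumes T: "T \<in> TT" and d: "is_delta A S a b"
    and x: "is_omega_lr A T S x u" "is_omega_l A T x v" "x \<in> A" "a \<in> A"
  shows "is_omega_lr A T S (x o\<^sub>L a) ((u o\<^sub>L a) + (scalar_op \<i> o\<^sub>L (v o\<^sub>L b)))"
proof -
  have b: "b \<in> A" using d by (simp add: is_delta_def)
  have "blinfun_apply u (blinfun_apply a f) + \<i> *\<^sub>C blinfun_apply v (blinfun_apply b f) =
      the (T (blinfun_apply x (blinfun_apply a (the (S f)))))" if f: "f \<in> dom S" for f
  proof -
    have e: "blinfun_apply a (the (S f)) = the (S (blinfun_apply a f)) + \<i> *\<^sub>C blinfun_apply b f"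
      and m: "blinfun_apply a f \<in> dom S"
      using delta_apply[OF d f] by simp_all
    have dx: "blinfun_apply x g \<in> dom T" for g using x(2) by (simp add: is_omega_l_def)
    have 1: "the (T (blinfun_apply x (the (S (blinfun_apply a f))))) = blinfun_apply u (blinfun_apply a f)"
      using x(1) m by (simp add: is_omega_lr_def)
    have 2: "the (T (blinfun_apply x (blinfun_apply b f))) = blinfun_apply v (blinfun_apply b f)"
      using x(2) by (simp add: is_omega_l_def)
    show ?thesis
      unfolding e blinfun.add_right cblinD[OF A_cblin[OF x(3)]]
        TT_add(2)[OF T dx TT_scale(1)[OF T dx]] TT_scale(2)[OF T dx] 1 2 ..
  qed
  then show ?thesis
    using x b delta_apply[OF d]
    by (simp add: is_omega_lr_def is_omega_l_def A_mult A_scalar op_subspace_add[OF A_subspace]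
        blinfun.add_left)
qed

lemma p_i: "1 \<le> j \<Longrightarrow> x \<in> J k \<Longrightarrow> p j k (scalar_op \<i> o\<^sub>L x) = p j k x"
  using seminorm_on_scalar[OF p_seminorm, of j x k \<i>] by simp

text \<open>One level of \<open>pre_Psi\<close> pays for one level of \<open>J\<close>: the
  derivatives of a lie in \<open>pre_Psi k\<close>, where the induction hypothesis, stated for all
  a, applies to them.\<close>

lemma Psi_left_mult:
  "a \<in> pre_Psi k \<Longrightarrow> x \<in> J k \<Longrightarrow> a o\<^sub>L x \<in> J k \<and> (\<forall>j\<ge>1. p j k (a o\<^sub>L x) \<le> q k j a * p j k x)"
proof (induction k arbitrary: a x)
  case 0
  then show ?case by (simp add: A_mult nrm_mult)
next
  case (Suc k)
  note a = pre_Psi_SucD[OF Suc.prems(1)] and x = J_SucD[OF Suc.prems(2)]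
  let ?d = "\<lambda>T. delta A T a"
  have aA: "a \<in> A" and xA: "x \<in> A" using a(1) x(1) pre_Psi_subset_A J_subset_A by auto
  note l = is_omega_l_left_mult[OF a(2) x(2) xA aA]
    and r = is_omega_r_mult[OF x(4) aA]
    and lr = is_omega_lr_left_mult[OF a(2) x(6) x(4) aA]
  have mem: "u o\<^sub>L y \<in> J k" if "u \<in> pre_Psi k" "y \<in> J k" for u y using Suc.IH that by blast
  note sc = op_subspace_scalar[OF J_subspace] and df = op_subspace_diff[OF J_subspace]
  have "a o\<^sub>L x \<in> J (Suc k)"
    by (rule J_SucI[OF _ l _ r _ lr]) (auto intro!: mem sc df a x)
  moreover have "p j (Suc k) (a o\<^sub>L x) \<le> q (Suc k) j a * p j (Suc k) x" if j: "1 \<le> j" for j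
  proof -
    let ?q = "q k j" and ?p = "p j k"
    have b: "?p (u o\<^sub>L y) \<le> ?q u * ?p y" if "u \<in> pre_Psi k" "y \<in> J k" for u y
      using Suc.IH that j by blast
    have bd: "?p ((u o\<^sub>L y) - (scalar_op \<i> o\<^sub>L (v o\<^sub>L z))) \<le> ?q u * ?p y + ?q v * ?p z"
      if "u \<in> pre_Psi k" "y \<in> J k" "v \<in> pre_Psi k" "z \<in> J k" for u v y z
      using seminorm_on_diff[OF J_subspace p_seminorm[OF j] mem[OF that(1,2)] sc[OF mem[OF that(3,4)]], of \<i>]
        b[OF that(1,2)] b[OF that(3,4)] p_i[OF j mem[OF that(3,4)]] by simp
    have "p j (Suc k) (a o\<^sub>L x) = ?p (a o\<^sub>L x) +
        (\<Sum>T\<in>TT. ?p ((a o\<^sub>L wl T x) - (scalar_op \<i> o\<^sub>L (?d T o\<^sub>L x))) + ?p (a o\<^sub>L wr T x)) +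
        (\<Sum>T\<in>TT. \<Sum>S\<in>TT. ?p ((a o\<^sub>L wlr T S x) - (scalar_op \<i> o\<^sub>L (?d T o\<^sub>L wr S x))))"
      by (simp add: omega_l_eq[OF l] omega_r_eq[OF _ r] omega_lr_eq[OF _ lr] cong: sum.cong)
    also have "\<dots> \<le> ?q a * ?p x +
        (\<Sum>T\<in>TT. (?q a * ?p (wl T x) + ?q (?d T) * ?p x) + ?q a * ?p (wr T x)) +
        (\<Sum>T\<in>TT. \<Sum>S\<in>TT. ?q a * ?p (wlr T S x) + ?q (?d T) * ?p (wr S x))"
      by (intro add_mono sum_mono b bd) (auto intro: a x)
    \<comment> \<open>The terms with a itself add up to the full norm of x. The derivatives of a
      meet only x and its right operators omega, so their terms factor through a part of that
      norm.\<close>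
    also have "\<dots> = ?q a * p j (Suc k) x + (\<Sum>T\<in>TT. ?q (?d T)) * (?p x + (\<Sum>T\<in>TT. ?p (wr T x)))"
      by (simp add: sum.distrib distrib_left distrib_right sum_distrib_left sum_distrib_right)
         (rule sum.swap)
    also have "\<dots> \<le> ?q a * p j (Suc k) x + (\<Sum>T\<in>TT. ?q (?d T)) * p j (Suc k) x"
      using a x p_nonneg[OF j] q_nonneg[OF j]
      by (intro add_left_mono mult_left_mono)
         (auto simp: sum.distrib intro!: add_nonneg_nonneg sum_nonneg)
    also have "\<dots> = q (Suc k) j a * p j (Suc k) x" by (simp only: Psi_norm.simps distrib_right)
    finally show ?thesis .
  qed
  ultimately show ?case by blast
qed

lemma Psi_right_mult:
  "a \<in> pre_Psi k \<Longrightarrow> x \<in> J k \<Longrightarrow> x o\<^sub>L a \<in> J k \<and> (\<forall>j\<ge>1. p j k (x o\<^sub>L a) \<le> p j k x * q k j a)"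
proof (induction k arbitrary: a x)
  case 0
  then show ?case by (simp add: A_mult nrm_mult)
next
  case (Suc k)
  note a = pre_Psi_SucD[OF Suc.prems(1)] and x = J_SucD[OF Suc.prems(2)]
  let ?d = "\<lambda>T. delta A T a"
  have aA: "a \<in> A" and xA: "x \<in> A" using a(1) x(1) pre_Psi_subset_A J_subset_A by auto
  note l = is_omega_l_mult[OF x(2) aA]
    and r = is_omega_r_right_mult[OF a(2) x(4) xA aA]
    and lr = is_omega_lr_right_mult[OF _ a(2) x(6) x(2) xA aA]
  have mem: "y o\<^sub>L u \<in> J k" if "u \<in> pre_Psi k" "y \<in> J k" for u y using Suc.IH that by blast
  note sc = op_subspace_scalar[OF J_subspace] and ad = op_subspace_add[OF J_subspace]
  have "x o\<^sub>L a \<in> J (Suc k)"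
    by (rule J_SucI[OF _ l _ r _ lr]) (auto intro!: mem sc ad a x)
  moreover have "p j (Suc k) (x o\<^sub>L a) \<le> p j (Suc k) x * q (Suc k) j a" if j: "1 \<le> j" for j
  proof -
    let ?q = "q k j" and ?p = "p j k"
    have b: "?p (y o\<^sub>L u) \<le> ?p y * ?q u" if "u \<in> pre_Psi k" "y \<in> J k" for u y
      using Suc.IH that j by blast
    have bd: "?p ((y o\<^sub>L u) + (scalar_op \<i> o\<^sub>L (z o\<^sub>L v))) \<le> ?p y * ?q u + ?p z * ?q v"
      if "u \<in> pre_Psi k" "y \<in> J k" "v \<in> pre_Psi k" "z \<in> J k" for u v y z
      using seminorm_on_add[OF p_seminorm[OF j] mem[OF that(1,2)] sc[OF mem[OF that(3,4)]], of \<i>]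
        b[OF that(1,2)] b[OF that(3,4)] p_i[OF j mem[OF that(3,4)]] by simp
    have "p j (Suc k) (x o\<^sub>L a) = ?p (x o\<^sub>L a) +
        (\<Sum>T\<in>TT. ?p (wl T x o\<^sub>L a) + ?p ((wr T x o\<^sub>L a) + (scalar_op \<i> o\<^sub>L (x o\<^sub>L ?d T)))) +
        (\<Sum>T\<in>TT. \<Sum>S\<in>TT. ?p ((wlr T S x o\<^sub>L a) + (scalar_op \<i> o\<^sub>L (wl T x o\<^sub>L ?d S))))"
      by (simp add: omega_l_eq[OF l] omega_r_eq[OF _ r] omega_lr_eq[OF _ lr] cong: sum.cong)
    also have "\<dots> \<le> ?p x * ?q a +
        (\<Sum>T\<in>TT. ?p (wl T x) * ?q a + (?p (wr T x) * ?q a + ?p x * ?q (?d T))) +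
        (\<Sum>T\<in>TT. \<Sum>S\<in>TT. ?p (wlr T S x) * ?q a + ?p (wl T x) * ?q (?d S))"
      by (intro add_mono sum_mono b bd) (auto intro: a x)
    \<comment> \<open>Mirror image: the derivatives of a meet only x and its left operators
      omega.\<close>
    also have "\<dots> = p j (Suc k) x * ?q a + (?p x + (\<Sum>T\<in>TT. ?p (wl T x))) * (\<Sum>T\<in>TT. ?q (?d T))"
      by (simp add: sum.distrib distrib_left distrib_right sum_distrib_left sum_distrib_right)
         (rule sum.swap)
    also have "\<dots> \<le> p j (Suc k) x * ?q a + p j (Suc k) x * (\<Sum>T\<in>TT. ?q (?d T))"
      using a x p_nonneg[OF j] q_nonneg[OF j]
      by (intro add_left_mono mult_right_mono)
         (auto simp: sum.distrib intro!: add_nonneg_nonneg sum_nonneg)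
    also have "\<dots> = p j (Suc k) x * q (Suc k) j a" by (simp only: Psi_norm.simps distrib_left)
    finally show ?thesis .
  qed
  ultimately show ?case by blast
qed

end

section \<open>Resolvents and the holomorphic functional calculus\<close>

text \<open>\<open>P n\<close> is the n-th power of y. Both recursions are recorded so that the sum
  of the series is a left and a right inverse.\<close>

lemma blinfun_neumann:
  fixes y :: "'a::banach \<Rightarrow>\<^sub>L 'a"
  assumes "norm y < 1"
  shows "\<exists>z. (id_blinfun - y) o\<^sub>L z = id_blinfun \<and> z o\<^sub>L (id_blinfun - y) = id_blinfun"
proof -
  define P where "P n = ((o\<^sub>L) y ^^ n) id_blinfun" for n
  have Suc_l: "P (Suc n) = y o\<^sub>L P n" for n by (simp add: P_def)
  have Suc_r: "P (Suc n) = P n o\<^sub>L y" for n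
  proof (induction n)
    case 0
    show ?case by (rule blinfun_eqI) (simp add: P_def)
  next
    case (Suc n)
    show ?case by (subst Suc_l, subst Suc) (rule blinfun_eqI, simp add: Suc_l)
  qed
  have P0: "P 0 = id_blinfun" by (simp add: P_def)
  have "norm (P n) \<le> norm y ^ n" for n
  proof (induction n)
    case 0
    show ?case by (rule norm_blinfun_bound) (simp_all add: P_def)
  next
    case (Suc n)
    have "norm (P (Suc n)) \<le> norm y * norm (P n)" unfolding Suc_l by (rule norm_blinfun_compose)
    with Suc show ?case by (simp add: mult_left_mono order_trans)
  qed
  then have P: "summable P"
    by (intro summable_comparison_test'[OF summable_geometric[of "norm y"]]) (use assms in auto)
  define z where "z = suminf P"
  have split: "z = id_blinfun + (\<Sum>n. P (Suc n))"
    using suminf_split_head[OF P] P0 by (simp add: z_def)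
  have "(\<Sum>n. P (Suc n)) = y o\<^sub>L z" "(\<Sum>n. P (Suc n)) = z o\<^sub>L y"
    using bounded_linear.suminf[OF bounded_bilinear.bounded_linear_right[OF bounded_bilinear_blinfun_compose] P, of y]
      bounded_linear.suminf[OF bounded_bilinear.bounded_linear_left[OF bounded_bilinear_blinfun_compose] P, of y]
    by (simp_all add: z_def flip: Suc_l Suc_r)
  then have "z - (y o\<^sub>L z) = id_blinfun" "z - (z o\<^sub>L y) = id_blinfun"
    using split by (metis add_diff_cancel_right')+
  then show ?thesis
    by (intro exI[of _ z]) (simp add: o_diff_left o_diff_right)
qed

text \<open>\<open>blinfun_neumann\<close> yields an inverse known only to be real-linear; complex
  linearity is inherited from a.\<close>

lemma cblin_inverse:
  assumes a: "a \<in> cblin" and "a o\<^sub>L b = id_blinfun" and "b o\<^sub>L a = id_blinfun"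
  shows "b \<in> cblin"
  unfolding cblin_def
proof (intro CollectI allI)
  fix c x
  have ab: "blinfun_apply a (blinfun_apply b y) = y" and ba: "blinfun_apply b (blinfun_apply a y) = y" for y
    using assms(2,3) by (metis blinfun_apply_blinfun_compose id_blinfun.rep_eq id_apply)+
  have "blinfun_apply b (c *\<^sub>C x) = blinfun_apply b (c *\<^sub>C blinfun_apply a (blinfun_apply b x))"
    by (simp add: ab)
  also have "\<dots> = c *\<^sub>C blinfun_apply b x" by (simp add: ba flip: cblinD[OF a])
  finally show "blinfun_apply b (c *\<^sub>C x) = c *\<^sub>C blinfun_apply b x" .
qed

lemma norm_scalar_op_le: "norm (scalar_op c :: 'a::complex_hilbert \<Rightarrow>\<^sub>L 'a) \<le> cmod c"
  by (rule norm_blinfun_bound) (simp_all add: norm_scaleC)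

lemma scalar_op_diff: "scalar_op (c - d) = scalar_op c - scalar_op d"
  by (rule blinfun_eqI) (simp add: scaleC_diff_left blinfun.diff_left)

lemma op_subspace_cblin_UNIV: "op_subspace (cblin :: ('k::complex_hilbert \<Rightarrow>\<^sub>L 'k) set)"
  by (auto simp: op_subspace_def cblin_def blinfun.add_left scaleC_add_right scaleC_scaleC mult.commute)

lemma scalar_op_cblin: "scalar_op c \<in> cblin"
  by (simp add: cblin_def scaleC_scaleC mult.commute)

lemma units_in_cblinI:
  "a \<in> cblin \<Longrightarrow> a o\<^sub>L b = id_blinfun \<Longrightarrow> b o\<^sub>L a = id_blinfun \<Longrightarrow> a \<in> units_in cblin"
  unfolding units_in_def using cblin_inverse by blast

lemma open_resolvent_set:
  assumes a: "a \<in> cblin"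
  shows "open (- op_spectrum a)"
  unfolding open_contains_ball
proof
  fix z0 assume "z0 \<in> - op_spectrum a"
  then obtain b where b: "b \<in> cblin" "(scalar_op z0 - a) o\<^sub>L b = id_blinfun"
    "b o\<^sub>L (scalar_op z0 - a) = id_blinfun"
    by (auto simp: op_spectrum_def units_in_def)
  have d: "scalar_op z - a \<in> cblin" for z
    by (rule op_subspace_diff[OF op_subspace_cblin_UNIV scalar_op_cblin a])
  \<comment> \<open>With this radius the perturbation y below has norm less than 1, and the summand
    1 keeps r positive even for b = 0.\<close>
  define r where "r = inverse (norm b + 1)"
  have r: "0 < r" by (simp add: r_def add_nonneg_pos)
  have "z \<in> - op_spectrum a" if z: "z \<in> ball z0 r" for z
  proof -
    define y where "y = scalar_op (z0 - z) o\<^sub>L b"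
    have "norm y \<le> cmod (z0 - z) * norm b"
      unfolding y_def by (meson mult_right_mono norm_blinfun_compose norm_ge_zero norm_scalar_op_le order_trans)
    also have "\<dots> \<le> r * norm b" using z by (intro mult_right_mono) (auto simp: dist_norm)
    also have "\<dots> < 1" using add_nonneg_pos[OF norm_ge_zero[of b] zero_less_one] by (simp add: r_def field_simps)
    finally obtain w where w: "(id_blinfun - y) o\<^sub>L w = id_blinfun" "w o\<^sub>L (id_blinfun - y) = id_blinfun"
      using blinfun_neumann by blast
    have "(scalar_op z0 - a) o\<^sub>L y = scalar_op (z0 - z)"
      unfolding y_def cblin_scalar_left_commute[OF d] b(2) by simp
    then have e: "scalar_op z - a = (scalar_op z0 - a) o\<^sub>L (id_blinfun - y)"
      by (simp add: o_diff_right scalar_op_diff)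
    have w1: "(id_blinfun - y) o\<^sub>L (w o\<^sub>L u) = u" for u
      by (simp only: w(1) blinfun_compose_id flip: blinfun_compose_assoc)
    have b1: "b o\<^sub>L ((scalar_op z0 - a) o\<^sub>L u) = u" for u
      by (simp only: b(3) blinfun_compose_id flip: blinfun_compose_assoc)
    have "scalar_op z - a \<in> units_in cblin"
      by (rule units_in_cblinI[OF d, of _ "w o\<^sub>L b"])
         (simp_all only: e blinfun_compose_assoc w1 b1 b(2) w(2))
    then show ?thesis by (simp add: op_spectrum_def)
  qed
  with r show "\<exists>e>0. ball z0 e \<subseteq> - op_spectrum a" by blast
qed

text \<open>The operators form only a real normed space here, so complex linearity is expressed by
  composition with \<open>scalar_op\<close>. Such functionals turn operator-valued integrals into
  scalar contour integrals.\<close>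

definition cfunctional :: "(('k::complex_hilbert \<Rightarrow>\<^sub>L 'k) \<Rightarrow> complex) \<Rightarrow> bool" where
  "cfunctional F \<longleftrightarrow> bounded_linear F \<and> (\<forall>c X. F (scalar_op c o\<^sub>L X) = c * F X)"

lemma cfunctional_scalar: "cfunctional F \<Longrightarrow> F (scalar_op c o\<^sub>L X) = c * F X"
  and cfunctional_bounded_linear: "cfunctional F \<Longrightarrow> bounded_linear F"
  by (simp_all add: cfunctional_def)

lemma cfunctional_add: "cfunctional F \<Longrightarrow> F (X + Y) = F X + F Y"
  by (simp add: cfunctional_def bounded_linear.linear linear_add)

text \<open>The imaginary part of \<open>cinner x y\<close> is minus the real inner product of
  \<open>\<i> *\<^sub>C x\<close> with y. Boundedness of matrix coefficients thereby reduces to that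
  of the real inner product.\<close>

lemma cinner_eq_inner:
  fixes x y :: "'a::complex_hilbert"
  shows "cinner x y = complex_of_real (inner x y) - \<i> * complex_of_real (inner (\<i> *\<^sub>C x) y)"
  by (simp add: complex_eq_iff inner_eq_Re_cinner cinner_scaleC_left)

lemma cfunctional_cinner: "cfunctional (\<lambda>X. cinner (blinfun_apply X u) v)"
  unfolding cfunctional_def
proof (intro conjI allI)
  have "bounded_linear (\<lambda>X. \<i> *\<^sub>C blinfun_apply X u)"
    by (rule bounded_linear_compose[OF bounded_linear_scaleC])
       (rule bounded_bilinear.bounded_linear_left[OF bounded_bilinear_blinfun_apply])
  then show "bounded_linear (\<lambda>X. cinner (blinfun_apply X u) v)"
    unfolding cinner_eq_inner
    by (intro bounded_linear_sub bounded_linear_of_real[THEN bounded_linear_compose]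
        bounded_linear_mult_right[THEN bounded_linear_compose]
        bounded_linear_inner_left[THEN bounded_linear_compose]
        bounded_bilinear.bounded_linear_left[OF bounded_bilinear_blinfun_apply])
qed (simp add: cinner_scaleC_left)

text \<open>Lets x R(z) x be tested by a functional of R(z) alone. Scalars pass x because x is
  complex-linear.\<close>

lemma cfunctional_sandwich:
  assumes "cfunctional F" and x: "x \<in> cblin"
  shows "cfunctional (\<lambda>X. F (x o\<^sub>L X o\<^sub>L y))"
  unfolding cfunctional_def
proof (intro conjI allI)
  show "bounded_linear (\<lambda>X. F (x o\<^sub>L X o\<^sub>L y))"
    by (rule bounded_linear_compose[OF cfunctional_bounded_linear[OF assms(1)]
          bounded_linear_compose[OF
            bounded_bilinear.bounded_linear_left[OF bounded_bilinear_blinfun_compose]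
            bounded_bilinear.bounded_linear_right[OF bounded_bilinear_blinfun_compose]]])
qed (simp add: blinfun_compose_assoc cblin_scalar_left_commute[OF x] cfunctional_scalar[OF assms(1)])

text \<open>Matrix coefficients already determine an operator, and even their real parts do.\<close>

lemma cfunctional_separates:
  assumes "\<And>F. cfunctional F \<Longrightarrow> F X = F Y"
  shows "X = Y"
proof (rule blinfun_eqI)
  fix u
  have "cinner (blinfun_apply X u) v = cinner (blinfun_apply Y u) v" for v
    by (rule assms[OF cfunctional_cinner])
  then have "inner (blinfun_apply X u) v = inner (blinfun_apply Y u) v" for v
    by (simp add: inner_eq_Re_cinner)
  then show "blinfun_apply X u = blinfun_apply Y u" by (metis vector_eq_rdot)
qed

text \<open>\<open>dunford_integral\<close> uses the derivative within the unit interval,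
  \<open>contour_integral_integral\<close> the two-sided one; they can differ at the two endpoints
  only.\<close>

lemma contour_integral_integral_within:
  "contour_integral \<gamma> f = integral {0..1} (\<lambda>t. f (\<gamma> t) * vector_derivative \<gamma> (at t within {0..1}))"
  unfolding contour_integral_integral
proof (rule integral_spike)
  show "negligible {0, 1::real}" by simp
  fix t :: real assume "t \<in> {0..1} - {0, 1}"
  then have "at t within {0..1} = at t" by (intro at_within_Icc_at) auto
  then show "f (\<gamma> t) * vector_derivative \<gamma> (at t within {0..1}) = f (\<gamma> t) * vector_derivative \<gamma> (at t)"
    by simp
qed

section \<open>Integrals as limits of Riemann sums\<close>

lemma integral_unit_interval_split:
  fixes h :: "real \<Rightarrow> 'a::banach"
  assumes "h integrable_on {0..1}" and n: "0 < n" and "m \<le> n"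
  shows "(\<Sum>i<m. integral {real i / real n..real (Suc i) / real n} h) = integral {0..real m / real n} h"
  using assms(3)
proof (induction m)
  case (Suc m)
  have "integral {0..real m / real n} h + integral {real m / real n..real (Suc m) / real n} h =
      integral {0..real (Suc m) / real n} h"
  proof (rule Henstock_Kurzweil_Integration.integral_combine)
    show "h integrable_on {0..real (Suc m) / real n}"
      by (rule integrable_on_subinterval[OF assms(1)]) (use Suc n in \<open>auto simp: field_simps\<close>)
  qed (use n in \<open>auto simp: divide_right_mono\<close>)
  with Suc show ?case by simp
qed simp

text \<open>Ties the integral to finite sums, which lie in A when the values of h do and can be
  tested for the Cauchy property in every \<open>nrm j\<close>.\<close>

lemma riemann_sums_tendsto:
  fixes h :: "real \<Rightarrow> 'a::banach"
  assumes h: "continuous_on {0..1} h"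
  shows "(\<lambda>n. (1 / real n) *\<^sub>R (\<Sum>i<n. h (real i / real n))) \<longlonglongrightarrow> integral {0..1} h"
proof (rule LIMSEQ_I)
  fix e :: real assume e: "0 < e"
  have "uniformly_continuous_on {0..1} h" by (rule compact_uniformly_continuous[OF h compact_Icc])
  then obtain d where d: "0 < d" "\<And>s t. s \<in> {0..1} \<Longrightarrow> t \<in> {0..1} \<Longrightarrow> dist s t < d \<Longrightarrow> dist (h s) (h t) < e / 2"
    using e unfolding uniformly_continuous_on_def by (meson half_gt_zero)
  obtain N where N: "0 < N" "1 / real N < d"
    using d(1) by (metis One_nat_def divide_inverse mult_1 real_arch_inverse zero_less_Suc neq0_conv)
  have "norm ((1 / real n) *\<^sub>R (\<Sum>i<n. h (real i / real n)) - integral {0..1} h) < e" if n: "N \<le> n" for n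
  proof -
    have n0: "0 < n" using n N by simp
    have "1 / real n \<le> 1 / real N" using n N by (simp add: frac_le)
    then have nd: "1 / real n < d" using N by simp
    have hi: "h integrable_on {0..1}" by (rule integrable_continuous_interval[OF h])
    have piece: "norm ((1 / real n) *\<^sub>R h (real i / real n) -
        integral {real i / real n..real (Suc i) / real n} h) \<le> e / 2 * (1 / real n)"
      if i: "i < n" for i
    proof -
      let ?a = "real i / real n" and ?b = "real (Suc i) / real n"
      have ab: "?b - ?a = 1 / real n" by (simp add: diff_divide_distrib[symmetric])
      have le: "?a \<le> ?b" by (simp add: divide_right_mono)
      have sub: "{?a..?b} \<subseteq> {0..1}" using i by (auto simp: field_simps)
      have c: "continuous_on {?a..?b} h" by (rule continuous_on_subset[OF h sub])
      have "(1 / real n) *\<^sub>R h ?a - integral {?a..?b} h = integral {?a..?b} (\<lambda>t. h ?a - h t)"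
        using integrable_continuous_interval[OF c] le ab
        by (subst integral_diff) auto
      moreover have "norm (integral {?a..?b} (\<lambda>t. h ?a - h t)) \<le> e / 2 * (?b - ?a)"
      proof (rule integral_bound[OF le])
        show "continuous_on {?a..?b} (\<lambda>t. h ?a - h t)" using c by (intro continuous_intros)
        fix t assume t: "t \<in> {?a..?b}"
        have "dist ?a t \<le> 1 / real n" using t ab by (auto simp: dist_real_def)
        then have "dist (h ?a) (h t) < e / 2"
          using subsetD[OF sub t] subsetD[OF sub, of ?a] le nd by (intro d(2)) auto
        then show "norm (h ?a - h t) \<le> e / 2" by (simp add: dist_norm)
      qed
      ultimately show ?thesis by (simp only: ab)
    qed
    have "(1 / real n) *\<^sub>R (\<Sum>i<n. h (real i / real n)) - integral {0..1} h =
        (\<Sum>i<n. (1 / real n) *\<^sub>R h (real i / real n) - integral {real i / real n..real (Suc i) / real n} h)"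
      using integral_unit_interval_split[OF hi n0, of n] n0
      by (simp add: sum_subtractf scaleR_sum_right)
    also have "norm \<dots> \<le> (\<Sum>i<n. e / 2 * (1 / real n))"
      by (rule sum_norm_le) (use piece in auto)
    also have "\<dots> = e / 2" using n0 by simp
    also have "\<dots> < e" using e by simp
    finally show ?thesis .
  qed
  then show "\<exists>N. \<forall>n\<ge>N. norm ((1 / real n) *\<^sub>R (\<Sum>i<n. h (real i / real n)) - integral {0..1} h) < e"
    by blast
qed

lemma scaleR_eq_scalar_op: "r *\<^sub>R x = scalar_op (complex_of_real r) o\<^sub>L x"
  by (rule blinfun_eqI) (simp add: scaleC_of_real blinfun.scaleR_left)

context psi_star_setting
begin

section \<open>Operator-valued integrals inside A\<close>

lemma A_scaleR: "x \<in> A \<Longrightarrow> r *\<^sub>R x \<in> A"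
  unfolding scaleR_eq_scalar_op by (rule op_subspace_scalar[OF A_subspace])

lemma nrm_scaleR: "1 \<le> j \<Longrightarrow> x \<in> A \<Longrightarrow> nrm j (r *\<^sub>R x) = \<bar>r\<bar> * nrm j x"
  unfolding scaleR_eq_scalar_op by (simp add: seminorm_on_scalar[OF nrm_seminorm])

text \<open>\<open>nrm j\<close> is in general not the norm of the type. The Heine-Cantor theorem is
  therefore applied to the real-valued function \<open>nrm j (h s - h t)\<close> of (s, t) on the
  unit square, which vanishes on the diagonal.\<close>

lemma nrm_uniformly_continuous:
  assumes hA: "\<And>t. t \<in> {0..1::real} \<Longrightarrow> h t \<in> A" and j: "1 \<le> j"
    and cont: "\<And>t. t \<in> {0..1} \<Longrightarrow> ((\<lambda>s. nrm j (h s - h t)) \<longlongrightarrow> 0) (at t within {0..1})"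
    and e: "0 < e"
  shows "\<exists>d>0. \<forall>s\<in>{0..1}. \<forall>t\<in>{0..1}. \<bar>s - t\<bar> < d \<longrightarrow> nrm j (h s - h t) < e"
proof -
  let ?S = "{0..1} \<times> {0..1} :: (real \<times> real) set"
  let ?g = "\<lambda>z. nrm j (h (fst z) - h (snd z))"
  note sn = nrm_seminorm[OF j]
  note tri = seminorm_on_triangle[OF A_subspace sn] and com = seminorm_on_minus_commute[OF A_subspace sn]
  have nn: "0 \<le> nrm j (h s - h t)" if "s \<in> {0..1}" "t \<in> {0..1}" for s t
    by (intro seminorm_on_nonneg[OF sn] op_subspace_diff[OF A_subspace] hA that)
  have "continuous_on ?S ?g"
    unfolding continuous_on_def
  proof (intro ballI)
    fix z assume z: "z \<in> ?S"
    have c: "continuous (at t within {0..1}) (\<lambda>s. nrm j (h s - h t))" if "t \<in> {0..1}" for t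
      using cont[OF that] seminorm_on_0[OF A_subspace sn] by (simp add: continuous_within)
    have "continuous (at z within ?S) (\<lambda>w. nrm j (h (fst w) - h (fst z)))"
      by (rule continuous_within_compose2[where f = fst]) (use z c in \<open>auto intro!: continuous_intros\<close>)
    then have l1: "((\<lambda>w. nrm j (h (fst w) - h (fst z))) \<longlongrightarrow> 0) (at z within ?S)"
      using seminorm_on_0[OF A_subspace sn] by (simp add: continuous_within)
    have "continuous (at z within ?S) (\<lambda>w. nrm j (h (snd w) - h (snd z)))"
      by (rule continuous_within_compose2[where f = snd]) (use z c in \<open>auto intro!: continuous_intros\<close>)
    then have l2: "((\<lambda>w. nrm j (h (snd w) - h (snd z))) \<longlongrightarrow> 0) (at z within ?S)"
      using seminorm_on_0[OF A_subspace sn] by (simp add: continuous_within)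
    have "\<bar>?g w - ?g z\<bar> \<le> nrm j (h (fst w) - h (fst z)) + nrm j (h (snd w) - h (snd z))" if w: "w \<in> ?S" for w
    proof -
      have m: "h (fst w) \<in> A" "h (snd w) \<in> A" "h (fst z) \<in> A" "h (snd z) \<in> A"
        using w z hA by auto
      \<comment> \<open>Two triangle inequalities for each sign of
        \<open>?g w - ?g z\<close>.\<close>
      show ?thesis
        using tri[OF m(1) m(3) m(2)] tri[OF m(3) m(4) m(2)] tri[OF m(3) m(1) m(4)] tri[OF m(1) m(2) m(4)]
          com[OF m(1) m(3)] com[OF m(2) m(4)] by linarith
    qed
    then have "eventually (\<lambda>w. norm (?g w - ?g z) \<le>
        nrm j (h (fst w) - h (fst z)) + nrm j (h (snd w) - h (snd z))) (at z within ?S)"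
      by (simp add: eventually_at_filter)
    moreover have "((\<lambda>w. nrm j (h (fst w) - h (fst z)) + nrm j (h (snd w) - h (snd z))) \<longlongrightarrow> 0)
        (at z within ?S)"
      using tendsto_add[OF l1 l2] by simp
    ultimately have "((\<lambda>w. ?g w - ?g z) \<longlongrightarrow> 0) (at z within ?S)"
      by (rule Lim_null_comparison)
    then show "(?g \<longlongrightarrow> ?g z) (at z within ?S)" by (rule LIM_zero_cancel)
  qed
  then have "uniformly_continuous_on ?S ?g"
    by (rule compact_uniformly_continuous) (intro compact_Times compact_Icc)
  then obtain d where d: "0 < d" "\<And>w z. w \<in> ?S \<Longrightarrow> z \<in> ?S \<Longrightarrow> dist w z < d \<Longrightarrow> dist (?g w) (?g z) < e"
    using e unfolding uniformly_continuous_on_def by meson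
  \<comment> \<open>The point (s, t) is compared with (t, t): their distance is
    \<open>\<bar>s - t\<bar>\<close>, and the value at the latter is 0.\<close>
  have "nrm j (h s - h t) < e" if "s \<in> {0..1}" "t \<in> {0..1}" "\<bar>s - t\<bar> < d" for s t
    using d(2)[of "(s, t)" "(t, t)"] that nn[of s t] seminorm_on_0[OF A_subspace sn]
    by (simp add: dist_Pair_Pair dist_real_def)
  with d(1) show ?thesis by blast
qed

text \<open>Riemann sums of h lie in A and are Cauchy for every \<open>nrm j\<close>, hence converge
  in A. As \<open>nrm 1\<close> is the operator norm, this limit is also the norm limit of the sums,
  that is, the integral.\<close>

lemma integral_in_A:
  assumes hA: "\<And>t. t \<in> {0..1::real} \<Longrightarrow> h t \<in> A"
    and cont: "\<And>j t. 1 \<le> j \<Longrightarrow> t \<in> {0..1} \<Longrightarrow> ((\<lambda>s. nrm j (h s - h t)) \<longlongrightarrow> 0) (at t within {0..1})"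
  shows "continuous_on {0..1} h" and "integral {0..1} h \<in> A"
proof -
  show ch: "continuous_on {0..1} h"
    unfolding continuous_on_def
  proof
    fix t :: real assume t: "t \<in> {0..1}"
    have "eventually (\<lambda>s. norm (h s - h t) \<le> nrm 1 (h s - h t)) (at t within {0..1})"
      unfolding eventually_at_filter
      using nrm_1 op_subspace_diff[OF A_subspace hA hA[OF t]] by simp
    then have "((\<lambda>s. h s - h t) \<longlongrightarrow> 0) (at t within {0..1})"
      by (rule Lim_null_comparison[OF _ cont[of 1, OF _ t]]) simp
    then show "(h \<longlongrightarrow> h t) (at t within {0..1})" by (rule LIM_zero_cancel)
  qed
  define S where "S n = (1 / real n) *\<^sub>R (\<Sum>i<n. h (real i / real n))" for n
  have hin: "h (real i / real n) \<in> A" if "i < n" for i n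
    using that by (intro hA) auto
  have SA: "S n \<in> A" for n
    unfolding S_def by (intro A_scaleR op_subspace_sum[OF A_subspace]) (use hin in auto)
  \<comment> \<open>Dividing each of the n intervals into m equal parts replaces the sample at i/n
    by the average of m samples at points within distance 1/n of it.\<close>
  have refine: "nrm j (S n - S (n * m)) \<le> e"
    if j: "1 \<le> j" and n: "0 < n" and m: "0 < m" and nd: "1 / real n < d"
      and d: "\<forall>s\<in>{0..1}. \<forall>t\<in>{0..1}. \<bar>s - t\<bar> < d \<longrightarrow> nrm j (h s - h t) < e" for j n m d e
  proof -
    have il: "l < n * m" if "i < n" "l \<in> {i * m..<i * m + m}" for i l
    proof -
      have "l < Suc i * m" using that by simp
      also have "\<dots> \<le> n * m" using that by (intro mult_right_mono) auto
      finally show ?thesis .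
    qed
    have "S n = (1 / real (n * m)) *\<^sub>R (\<Sum>i<n. \<Sum>l\<in>{i * m..<i * m + m}. h (real i / real n))"
      using n m by (simp add: S_def sum_constant_scaleR scaleR_sum_right)
    moreover have "S (n * m) = (1 / real (n * m)) *\<^sub>R
        (\<Sum>i<n. \<Sum>l\<in>{i * m..<i * m + m}. h (real l / real (n * m)))"
      unfolding S_def sum.nat_group ..
    ultimately have "S n - S (n * m) = (1 / real (n * m)) *\<^sub>R
        (\<Sum>i<n. \<Sum>l\<in>{i * m..<i * m + m}. h (real i / real n) - h (real l / real (n * m)))"
      by (simp add: sum_subtractf scaleR_diff_right)
    moreover have mA: "h (real i / real n) - h (real l / real (n * m)) \<in> A"
      if "i < n" "l \<in> {i * m..<i * m + m}" for i l
      by (intro op_subspace_diff[OF A_subspace] hin that(1) hin[OF il[OF that]])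
    moreover have sA: "(\<Sum>l\<in>{i * m..<i * m + m}. h (real i / real n) - h (real l / real (n * m))) \<in> A"
      if "i < n" for i
      by (rule op_subspace_sum[OF A_subspace mA[OF that]])
    moreover have "(\<Sum>i<n. \<Sum>l\<in>{i * m..<i * m + m}. h (real i / real n) - h (real l / real (n * m))) \<in> A"
      by (rule op_subspace_sum[OF A_subspace sA]) simp
    ultimately have "nrm j (S n - S (n * m)) = (1 / real (n * m)) *
        nrm j (\<Sum>i<n. \<Sum>l\<in>{i * m..<i * m + m}. h (real i / real n) - h (real l / real (n * m)))"
      by (simp add: nrm_scaleR[OF j])
    also have "\<dots> \<le> (1 / real (n * m)) *
        (\<Sum>i<n. \<Sum>l\<in>{i * m..<i * m + m}. nrm j (h (real i / real n) - h (real l / real (n * m))))"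
    proof (rule mult_left_mono)
      have "nrm j (\<Sum>i<n. \<Sum>l\<in>{i * m..<i * m + m}. h (real i / real n) - h (real l / real (n * m)))
          \<le> (\<Sum>i<n. nrm j (\<Sum>l\<in>{i * m..<i * m + m}. h (real i / real n) - h (real l / real (n * m))))"
        by (rule seminorm_on_sum[OF A_subspace nrm_seminorm[OF j] sA]) simp
      also have "\<dots> \<le> (\<Sum>i<n. \<Sum>l\<in>{i * m..<i * m + m}. nrm j (h (real i / real n) - h (real l / real (n * m))))"
        by (rule sum_mono, rule seminorm_on_sum[OF A_subspace nrm_seminorm[OF j] mA]) auto
      finally show "nrm j (\<Sum>i<n. \<Sum>l\<in>{i * m..<i * m + m}. h (real i / real n) - h (real l / real (n * m)))
          \<le> (\<Sum>i<n. \<Sum>l\<in>{i * m..<i * m + m}. nrm j (h (real i / real n) - h (real l / real (n * m))))" .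
    qed simp
    also have "\<dots> \<le> (1 / real (n * m)) * (\<Sum>i<n. \<Sum>l\<in>{i * m..<i * m + m}. e)"
    proof (intro mult_left_mono sum_mono)
      fix i l assume i: "i \<in> {..<n}" and l: "l \<in> {i * m..<i * m + m}"
      have "real (i * m) \<le> real l" "real l < real (i * m + m)"
        using l by (simp_all only: of_nat_le_iff of_nat_less_iff atLeastLessThan_iff)
      then have lm: "\<bar>real i * real m - real l\<bar> \<le> real m" by simp
      have "real i / real n - real l / real (n * m) = (real i * real m - real l) / (real n * real m)"
        using n m by (simp add: field_simps)
      then have "\<bar>real i / real n - real l / real (n * m)\<bar> = \<bar>real i * real m - real l\<bar> / (real n * real m)"
        by (simp add: abs_mult)
      also have "\<dots> \<le> real m / (real n * real m)" using lm by (intro divide_right_mono) auto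
      also have "\<dots> = 1 / real n" using m by simp
      finally have "\<bar>real i / real n - real l / real (n * m)\<bar> < d" using nd by simp
      moreover have "real i / real n \<in> {0..1}" using i by auto
      moreover have "real l / real (n * m) \<in> {0..1}" using il[of i l] i l
        by (simp del: of_nat_mult)
      ultimately show "nrm j (h (real i / real n) - h (real l / real (n * m))) \<le> e"
        using d by (meson less_imp_le)
    qed simp
    also have "\<dots> = e" using n m by simp
    finally show ?thesis .
  qed
  have C: "\<exists>N. \<forall>m\<ge>N. \<forall>n\<ge>N. nrm j (S m - S n) < e" if j: "1 \<le> j" and e: "0 < e" for j e
  proof -
    obtain d where d: "0 < d" "\<forall>s\<in>{0..1}. \<forall>t\<in>{0..1}. \<bar>s - t\<bar> < d \<longrightarrow> nrm j (h s - h t) < e / 3"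
      using nrm_uniformly_continuous[OF hA j cont[OF j], of "e / 3"] e by auto
    obtain N where N: "0 < N" "1 / real N < d"
      using d(1) by (metis One_nat_def divide_inverse mult_1 real_arch_inverse zero_less_Suc neq0_conv)
    \<comment> \<open>Both sums are compared with their common refinement into m n
      intervals.\<close>
    have "nrm j (S m - S n) < e" if m: "N \<le> m" and n: "N \<le> n" for m n
    proof -
      have "1 / real m \<le> 1 / real N" "1 / real n \<le> 1 / real N" using m n N by (simp_all add: frac_le)
      then have "1 / real m < d" "1 / real n < d" using N by simp_all
      then have "nrm j (S m - S (m * n)) \<le> e / 3" "nrm j (S n - S (n * m)) \<le> e / 3"
        using refine[OF j _ _ _ d(2)] m n N by simp_all
      moreover have "nrm j (S m - S n) \<le> nrm j (S m - S (m * n)) + nrm j (S (m * n) - S n)"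
        by (rule seminorm_on_triangle[OF A_subspace nrm_seminorm[OF j] SA SA SA])
      moreover have "nrm j (S (m * n) - S n) = nrm j (S n - S (n * m))"
        using seminorm_on_minus_commute[OF A_subspace nrm_seminorm[OF j] SA SA] by (simp add: mult.commute)
      ultimately show ?thesis using e by linarith
    qed
    then show ?thesis by blast
  qed
  obtain x where x: "x \<in> A" "\<forall>j\<in>{1..}. (\<lambda>n. nrm j (S n - x)) \<longlonglongrightarrow> 0"
    using A_complete C SA unfolding complete_seminorms_def by (metis atLeast_iff)
  have "(\<lambda>n. norm (S n - x)) \<longlonglongrightarrow> 0"
  proof -
    have "nrm 1 (S n - x) = norm (S n - x)" for n
      using nrm_1 op_subspace_diff[OF A_subspace SA x(1)] by blast
    moreover have "(\<lambda>n. nrm 1 (S n - x)) \<longlonglongrightarrow> 0" using x(2) by simp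
    ultimately show ?thesis by (simp only:)
  qed
  then have "S \<longlonglongrightarrow> x" by (simp add: tendsto_norm_zero_iff LIM_zero_iff)
  moreover have "S \<longlonglongrightarrow> integral {0..1} h"
    unfolding S_def by (rule riemann_sums_tendsto[OF ch])
  ultimately show "integral {0..1} h \<in> A" using x(1) LIMSEQ_unique by blast
qed

section \<open>Resolvents of elements of A\<close>

lemma resolvent:
  assumes a: "a \<in> A" and z: "z \<notin> op_spectrum a"
  shows "op_resolvent a z \<in> A"
    and "(scalar_op z - a) o\<^sub>L op_resolvent a z = id_blinfun"
    and "op_resolvent a z o\<^sub>L (scalar_op z - a) = id_blinfun"
proof -
  have "scalar_op z - a \<in> A" by (rule op_subspace_diff[OF A_subspace A_scalar a])
  \<comment> \<open>Spectral invariance: the inverse among all complex-linear bounded operators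
    already lies in A.\<close>
  then have "scalar_op z - a \<in> units_in A" using z A_units by (auto simp: op_spectrum_def)
  then obtain b where b: "b \<in> A" "(scalar_op z - a) o\<^sub>L b = id_blinfun" "b o\<^sub>L (scalar_op z - a) = id_blinfun"
    by (auto simp: units_in_def)
  have "op_resolvent a z = b"
    unfolding op_resolvent_def
  proof (rule the_equality)
    show "b \<in> cblin \<and> (scalar_op z - a) o\<^sub>L b = id_blinfun \<and> b o\<^sub>L (scalar_op z - a) = id_blinfun"
      using b A_cblin by blast
    fix c assume "c \<in> cblin \<and> (scalar_op z - a) o\<^sub>L c = id_blinfun \<and> c o\<^sub>L (scalar_op z - a) = id_blinfun"
    then show "c = b" using b by (metis blinfun_compose_assoc blinfun_compose_id)
  qed
  with b show "op_resolvent a z \<in> A" "(scalar_op z - a) o\<^sub>L op_resolvent a z = id_blinfun"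
    "op_resolvent a z o\<^sub>L (scalar_op z - a) = id_blinfun" by auto
qed

lemma resolvent_identity:
  assumes a: "a \<in> A" and z: "z \<notin> op_spectrum a" and w: "w \<notin> op_spectrum a"
  shows "op_resolvent a w - op_resolvent a z =
    scalar_op (z - w) o\<^sub>L (op_resolvent a w o\<^sub>L op_resolvent a z)"
proof -
  let ?R = "op_resolvent a"
  have "?R w - ?R z = (?R w o\<^sub>L ((scalar_op z - a) o\<^sub>L ?R z)) - ((?R w o\<^sub>L (scalar_op w - a)) o\<^sub>L ?R z)"
    by (simp add: resolvent[OF a z] resolvent[OF a w])
  also have "\<dots> = ?R w o\<^sub>L (scalar_op (z - w) o\<^sub>L ?R z)"
    by (simp add: blinfun_compose_assoc scalar_op_diff o_diff_left o_diff_right)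
  also have "\<dots> = scalar_op (z - w) o\<^sub>L (?R w o\<^sub>L ?R z)"
    by (rule cblin_scalar_left_commute[OF A_cblin[OF resolvent(1)[OF a w]]])
  finally show ?thesis .
qed

text \<open>Let N be the seminorm of R(z). Once \<open>cmod (z - w) * N\<close> is below 1/2, the
  resolvent identity bounds the seminorm of R(w) by half of itself plus N, hence by 2N. Inserting
  this bound into the identity gives the error \<open>cmod (z - w) * (2 * N * N)\<close>.\<close>

lemma resolvent_tendsto:
  assumes a: "a \<in> A" and z: "z \<notin> op_spectrum a" and j: "1 \<le> j"
  shows "((\<lambda>w. nrm j (op_resolvent a w - op_resolvent a z)) \<longlongrightarrow> 0) (at z)"
proof -
  let ?R = "op_resolvent a"
  note sn = nrm_seminorm[OF j]
  define N where "N = nrm j (?R z)"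
  have N: "0 \<le> N" unfolding N_def by (rule seminorm_on_nonneg[OF sn resolvent(1)[OF a z]])
  have "eventually (\<lambda>w. w \<in> - op_spectrum a) (at z)"
    using eventually_at_topological open_resolvent_set[OF A_cblin[OF a]] z by fast
  moreover have "eventually (\<lambda>w. cmod (z - w) * N < 1 / 2) (at z)"
  proof (rule order_tendstoD(2))
    show "((\<lambda>w. cmod (z - w) * N) \<longlongrightarrow> cmod (z - z) * N) (at z)" by (intro tendsto_intros)
  qed simp
  ultimately have "eventually (\<lambda>w. norm (nrm j (?R w - ?R z)) \<le> cmod (z - w) * (2 * N * N)) (at z)"
  proof eventually_elim
    case (elim w)
    then have w: "w \<notin> op_spectrum a" by simp
    note Rw = resolvent(1)[OF a w] and Rz = resolvent(1)[OF a z]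
    let ?M = "nrm j (?R w)"
    have M: "0 \<le> ?M" by (rule seminorm_on_nonneg[OF sn Rw])
    have "nrm j (?R w - ?R z) = cmod (z - w) * nrm j (?R w o\<^sub>L ?R z)"
      by (simp only: resolvent_identity[OF a z w] seminorm_on_scalar[OF sn A_mult[OF Rw Rz]])
    also have "\<dots> \<le> cmod (z - w) * (?M * N)"
      unfolding N_def by (intro mult_left_mono nrm_mult j Rw Rz) simp
    finally have 1: "nrm j (?R w - ?R z) \<le> cmod (z - w) * (?M * N)" .
    have "cmod (z - w) * N * ?M \<le> 1 / 2 * ?M" using elim M by (intro mult_right_mono) auto
    moreover have "?M \<le> nrm j (?R w - ?R z) + N"
      using seminorm_on_add[OF sn op_subspace_diff[OF A_subspace Rw Rz] Rz] by (simp add: N_def)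
    ultimately have "?M \<le> 2 * N" using 1 by (simp add: mult_ac)
    then have "cmod (z - w) * (?M * N) \<le> cmod (z - w) * (2 * N * N)"
      using N by (intro mult_left_mono mult_right_mono) auto
    then show ?case
      using 1 seminorm_on_nonneg[OF sn op_subspace_diff[OF A_subspace Rw Rz]] by simp
  qed
  moreover have "((\<lambda>w. cmod (z - w) * (2 * N * N)) \<longlongrightarrow> 0) (at z)"
  proof -
    have "((\<lambda>w. cmod (z - w) * (2 * N * N)) \<longlongrightarrow> cmod (z - z) * (2 * N * N)) (at z)"
      by (intro tendsto_intros)
    then show ?thesis by simp
  qed
  ultimately show ?thesis by (rule Lim_null_comparison)
qed

text \<open>By the resolvent identity the difference quotient is minus the value of F at R(w) R(z),
  which converges as w tends to z.\<close>

lemma cfunctional_resolvent_holomorphic: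
  assumes a: "a \<in> A" and W: "W \<inter> op_spectrum a = {}" and F: "cfunctional F"
  shows "(\<lambda>z. F (op_resolvent a z)) holomorphic_on W"
proof -
  let ?R = "op_resolvent a"
  have "((\<lambda>z. F (?R z)) has_field_derivative - F (?R z o\<^sub>L ?R z)) (at z)" if "z \<in> W" for z
  proof -
    have z: "z \<notin> op_spectrum a" using that W by blast
    have ev: "eventually (\<lambda>w. w \<in> - op_spectrum a) (at z)"
      using eventually_at_topological open_resolvent_set[OF A_cblin[OF a]] z by fast
    have "eventually (\<lambda>w. norm (?R w - ?R z) \<le> nrm 1 (?R w - ?R z)) (at z)"
      using ev
    proof eventually_elim
      case (elim w)
      then show ?case
        using nrm_1 op_subspace_diff[OF A_subspace resolvent(1)[OF a] resolvent(1)[OF a z], of w] by simp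
    qed
    then have "((\<lambda>w. ?R w - ?R z) \<longlongrightarrow> 0) (at z)"
      by (rule Lim_null_comparison[OF _ resolvent_tendsto[OF a z]]) simp
    then have R: "(?R \<longlongrightarrow> ?R z) (at z)" by (rule LIM_zero_cancel)
    have "((\<lambda>w. - F (?R w o\<^sub>L ?R z)) \<longlongrightarrow> - F (?R z o\<^sub>L ?R z)) (at z)"
      by (intro tendsto_minus bounded_linear.tendsto[OF cfunctional_bounded_linear[OF F]]
          bounded_bilinear.tendsto[OF bounded_bilinear_blinfun_compose] R tendsto_const)
    moreover have "eventually (\<lambda>w. - F (?R w o\<^sub>L ?R z) = (F (?R w) - F (?R z)) / (w - z)) (at z)"
      using ev eventually_neq_at_within[of z]
    proof eventually_elim
      case (elim w)
      have "F (?R w) - F (?R z) = F (?R w - ?R z)"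
        by (simp add: linear_diff bounded_linear.linear cfunctional_bounded_linear[OF F])
      also have "\<dots> = (z - w) * F (?R w o\<^sub>L ?R z)"
        using elim by (simp add: resolvent_identity[OF a z] cfunctional_scalar[OF F])
      finally show ?case using elim by (simp add: field_simps)
    qed
    ultimately show ?thesis
      unfolding has_field_derivative_iff by (rule Lim_transform_eventually)
  qed
  then show ?thesis
    unfolding holomorphic_on_def field_differentiable_def by (blast intro: has_field_derivative_at_within)
qed

text \<open>The path may fail to be rectifiable, so it is first replaced by a nearby polynomial path.\<close>

lemma contour_integral_resolvent:
  assumes a: "a \<in> A" and W: "open W" "W \<inter> op_spectrum a = {}"
    and \<gamma>: "valid_path \<gamma>" "path_image \<gamma> \<subseteq> W" and g: "g holomorphic_on W"
  shows "\<exists>S\<in>A. \<forall>F. cfunctional F \<longrightarrow> contour_integral \<gamma> (\<lambda>z. g z * F (op_resolvent a z)) = F S"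
proof -
  let ?R = "op_resolvent a"
  obtain d where d: "0 < d" "\<And>u v. valid_path u \<Longrightarrow> valid_path v \<Longrightarrow>
      \<forall>t\<in>{0..1}. norm (u t - \<gamma> t) < d \<and> norm (v t - \<gamma> t) < d \<Longrightarrow>
      pathstart v = pathstart u \<and> pathfinish v = pathfinish u \<Longrightarrow>
      path_image u \<subseteq> W \<and> path_image v \<subseteq> W \<and>
      (\<forall>f. f holomorphic_on W \<longrightarrow> contour_integral v f = contour_integral u f)"
    using contour_integral_nearby_ends[OF W(1) valid_path_imp_path[OF \<gamma>(1)] \<gamma>(2)] by metis
  obtain u where u: "polynomial_function u" "pathstart u = pathstart \<gamma>" "pathfinish u = pathfinish \<gamma>"
    "\<And>t. t \<in> {0..1} \<Longrightarrow> norm (u t - \<gamma> t) < d"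
    using path_approx_polynomial_function[OF valid_path_imp_path[OF \<gamma>(1)] d(1)] by metis
  have uW: "path_image u \<subseteq> W"
    and eq: "f holomorphic_on W \<Longrightarrow> contour_integral \<gamma> f = contour_integral u f" for f
    using d(2)[OF valid_path_polynomial_function[OF u(1)] \<gamma>(1)] u d(1) by auto
  obtain u' where u': "polynomial_function u'" "\<And>t. (u has_vector_derivative u' t) (at t)"
    using has_vector_derivative_polynomial_function[OF u(1)] by blast
  have ut: "u t \<in> W" if "t \<in> {0..1}" for t using uW that by (auto simp: path_image_def)
  then have us: "u t \<notin> op_spectrum a" if "t \<in> {0..1}" for t using W that by blast
  \<comment> \<open>This weight is continuous on the whole interval because u' is polynomial; the
    derivative of the original path need not be.\<close>
  define k where "k t = g (u t) * u' t" for t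
  have cu: "continuous_on {0..1} u" by (rule continuous_on_polymonial_function[OF u(1)])
  have ck: "continuous_on {0..1} k"
    unfolding k_def
    by (intro continuous_intros continuous_on_polymonial_function[OF u'(1)]
        continuous_on_compose2[OF holomorphic_on_imp_continuous_on[OF g] cu]) (use ut in auto)
  define h where "h t = scalar_op (k t) o\<^sub>L ?R (u t)" for t
  have RA: "?R (u t) \<in> A" if "t \<in> {0..1}" for t by (rule resolvent(1)[OF a us[OF that]])
  have hA: "h t \<in> A" if "t \<in> {0..1}" for t
    unfolding h_def by (rule op_subspace_scalar[OF A_subspace RA[OF that]])
  have lim: "((\<lambda>s. nrm j (h s - h t)) \<longlongrightarrow> 0) (at t within {0..1})" if j: "1 \<le> j" and t: "t \<in> {0..1}" for j t
  proof -
    note sn = nrm_seminorm[OF j]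
    let ?D = "\<lambda>s. ?R (u s) - ?R (u t)"
    have "isCont (\<lambda>w. nrm j (?R w - ?R (u t))) (u t)"
      using resolvent_tendsto[OF a us[OF t] j] seminorm_on_0[OF A_subspace sn] by (simp add: isCont_def)
    then have "((\<lambda>s. nrm j (?D s)) \<longlongrightarrow> nrm j (?D t)) (at t within {0..1})"
      by (rule isCont_tendsto_compose) (use cu t in \<open>simp add: continuous_on_def\<close>)
    then have l1: "((\<lambda>s. nrm j (?D s)) \<longlongrightarrow> 0) (at t within {0..1})"
      using seminorm_on_0[OF A_subspace sn] by simp
    have "((\<lambda>s. k s) \<longlongrightarrow> k t) (at t within {0..1})" using ck t by (simp add: continuous_on_def)
    then have l2: "((\<lambda>s. cmod (k s - k t)) \<longlongrightarrow> 0) (at t within {0..1})"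
      by (simp add: tendsto_norm_zero_iff LIM_zero)
    have "eventually (\<lambda>s. norm (nrm j (h s - h t)) \<le> cmod (k s - k t) * nrm j (?D s) +
        cmod (k s - k t) * nrm j (?R (u t)) + cmod (k t) * nrm j (?D s)) (at t within {0..1})"
      unfolding eventually_at_filter
    proof (intro always_eventually allI impI)
      fix s :: real assume s: "s \<in> {0..1}"
      have D: "?D s \<in> A" by (rule op_subspace_diff[OF A_subspace RA[OF s] RA[OF t]])
      note sc = op_subspace_scalar[OF A_subspace]
      have "h s - h t = (scalar_op (k s - k t) o\<^sub>L ?D s) + (scalar_op (k s - k t) o\<^sub>L ?R (u t)) +
          (scalar_op (k t) o\<^sub>L ?D s)"
        by (simp add: h_def scalar_op_diff o_diff_left o_diff_right)
      then have "nrm j (h s - h t) \<le> nrm j (scalar_op (k s - k t) o\<^sub>L ?D s) +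
          nrm j (scalar_op (k s - k t) o\<^sub>L ?R (u t)) + nrm j (scalar_op (k t) o\<^sub>L ?D s)"
        using seminorm_on_add[OF sn op_subspace_add[OF A_subspace sc[OF D] sc[OF RA[OF t]]] sc[OF D]]
          seminorm_on_add[OF sn sc[OF D] sc[OF RA[OF t]]]
        by (smt (verit, best))
      then show "norm (nrm j (h s - h t)) \<le> cmod (k s - k t) * nrm j (?D s) +
          cmod (k s - k t) * nrm j (?R (u t)) + cmod (k t) * nrm j (?D s)"
        using seminorm_on_nonneg[OF sn op_subspace_diff[OF A_subspace hA[OF s] hA[OF t]]]
        by (simp add: seminorm_on_scalar[OF sn D] seminorm_on_scalar[OF sn RA[OF t]])
    qed
    moreover have "((\<lambda>s. cmod (k s - k t) * nrm j (?D s) +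
        cmod (k s - k t) * nrm j (?R (u t)) + cmod (k t) * nrm j (?D s)) \<longlongrightarrow>
        0 * 0 + 0 * nrm j (?R (u t)) + cmod (k t) * 0) (at t within {0..1})"
      by (intro tendsto_intros l1 l2)
    ultimately show ?thesis by (simp add: Lim_null_comparison)
  qed
  note int = integral_in_A[of h, OF hA lim]
  have "contour_integral \<gamma> (\<lambda>z. g z * F (?R z)) = F (integral {0..1} h)" if F: "cfunctional F" for F
  proof -
    have "contour_integral \<gamma> (\<lambda>z. g z * F (?R z)) = contour_integral u (\<lambda>z. g z * F (?R z))"
      by (intro eq holomorphic_intros g cfunctional_resolvent_holomorphic[OF a W(2) F])
    also have "\<dots> = integral {0..1} (F \<circ> h)"
      unfolding contour_integral_integral
      by (rule integral_cong) (simp add: vector_derivative_at[OF u'(2)] h_def k_def cfunctional_scalar[OF F])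
    also have "\<dots> = F (integral {0..1} h)"
      by (rule integral_linear[OF integrable_continuous_interval[OF int(1)] cfunctional_bounded_linear[OF F]])
    finally show ?thesis .
  qed
  with int(2) show ?thesis by blast
qed

section \<open>Unitizations of semi-ideals\<close>

lemma op_subspace_unitization:
  assumes V: "op_subspace V"
  shows "op_subspace (unitization V)"
  unfolding op_subspace_def
proof (intro conjI ballI allI)
  show "unitization V \<subseteq> cblin"
    using op_subspace_cblin[OF V] op_subspace_add[OF op_subspace_cblin_UNIV scalar_op_cblin]
    by (auto simp: unitization_def)
  show "0 \<in> unitization V"
    unfolding unitization_def using op_subspace_0[OF V] by (auto intro!: exI[of _ 0])
  fix X Y assume "X \<in> unitization V" "Y \<in> unitization V"
  then obtain c x d y where "X = scalar_op c + x" "x \<in> V" "Y = scalar_op d + y" "y \<in> V"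
    by (auto simp: unitization_def)
  then have "X + Y = scalar_op (c + d) + (x + y)" "x + y \<in> V"
    using op_subspace_add[OF V] by (simp_all add: scalar_op_add)
  then show "X + Y \<in> unitization V" unfolding unitization_def by blast
next
  fix e X assume "X \<in> unitization V"
  then obtain c x where "X = scalar_op c + x" "x \<in> V" by (auto simp: unitization_def)
  then have "scalar_op e o\<^sub>L X = scalar_op (e * c) + (scalar_op e o\<^sub>L x)" "scalar_op e o\<^sub>L x \<in> V"
    using op_subspace_scalar[OF V] by (simp_all add: scalar_op_mult o_add_right)
  then show "scalar_op e o\<^sub>L X \<in> unitization V" unfolding unitization_def by blast
qed

lemma semi_ideal_subalgebra: "semi_ideal A V \<Longrightarrow> op_subalgebra V"
  unfolding semi_ideal_def op_subalgebra_def using A_id by (metis blinfun_compose_id(2))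

text \<open>A single path is enough, since \<open>unitization V\<close> is a subspace and the
  integral over a cycle is a sum. W will be a neighbourhood of the spectrum with the spectrum
  removed.\<close>

lemma dunford_path_integral_in_unitization:
  assumes sI: "semi_ideal A V" and x: "x \<in> V" and a_def: "a = scalar_op l + x"
    and W: "open W" "W \<inter> op_spectrum a = {}"
    and \<gamma>: "valid_path \<gamma>" "path_image \<gamma> \<subseteq> W" and f: "f holomorphic_on W"
  shows "integral {0..1} (\<lambda>t. scalar_op (f (\<gamma> t) * vector_derivative \<gamma> (at t within {0..1})) o\<^sub>L
      op_resolvent a (\<gamma> t)) \<in> unitization V" (is "integral _ ?h \<in> _")
\<comment> \<open>If the integrand is not integrable, its integral is 0 by convention, and 0 lies in
  the unitization. Otherwise functionals may be moved under the integral.\<close>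
proof (cases "?h integrable_on {0..1}")
  case False
  have "op_subspace V" using sI by (simp add: semi_ideal_def)
  then show ?thesis
    using False by (simp add: not_integrable_integral op_subspace_0[OF op_subspace_unitization])
next
  case True
  let ?R = "op_resolvent a"
  have V: "op_subspace V" "V \<subseteq> A" and sand: "\<And>x y b. x \<in> V \<Longrightarrow> y \<in> V \<Longrightarrow> b \<in> A \<Longrightarrow> x o\<^sub>L b o\<^sub>L y \<in> V"
    using sI by (auto simp: semi_ideal_def)
  have xA: "x \<in> A" using x V by blast
  have a: "a \<in> A" unfolding a_def by (rule op_subspace_add[OF A_subspace A_scalar xA])
  have FI: "F (integral {0..1} ?h) = contour_integral \<gamma> (\<lambda>z. f z * F (?R z))" if F: "cfunctional F" for F
  proof -
    have "F (integral {0..1} ?h) = integral {0..1} (F \<circ> ?h)"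
      by (rule integral_linear[OF True cfunctional_bounded_linear[OF F], symmetric])
    also have "\<dots> = contour_integral \<gamma> (\<lambda>z. f z * F (?R z))"
      unfolding contour_integral_integral_within
      by (rule integral_cong) (simp add: cfunctional_scalar[OF F])
    finally show ?thesis .
  qed
  show ?thesis
  proof (cases "l \<in> op_spectrum a")
    \<comment> \<open>Here \<open>scalar_op l - a\<close>, which equals \<open>- x\<close>, is
      invertible; spectral invariance puts its inverse y into A.\<close>
    case False
    then have "- x \<in> units_in cblin" by (simp add: op_spectrum_def a_def)
    moreover have "- x \<in> A" using op_subspace_diff[OF A_subspace op_subspace_0[OF A_subspace] xA] by simp
    ultimately have "- x \<in> units_in A" using A_units by blast
    then obtain y where y: "y \<in> A" "(- x) o\<^sub>L y = id_blinfun" "y o\<^sub>L (- x) = id_blinfun"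
      by (auto simp: units_in_def)
    have "c \<in> V" if c: "c \<in> A" for c
    proof -
      \<comment> \<open>The two signs cancel and leave an element of A between two factors x, the
        form that a semi-ideal absorbs.\<close>
      have "c = ((- x) o\<^sub>L y) o\<^sub>L c o\<^sub>L (y o\<^sub>L (- x))" by (simp add: y)
      also have "\<dots> = x o\<^sub>L (y o\<^sub>L c o\<^sub>L y) o\<^sub>L x"
        by (rule blinfun_eqI) (simp add: blinfun.minus_left blinfun.minus_right)
      finally show ?thesis using sand[OF x x A_mult[OF A_mult[OF y(1) c] y(1)]] by simp
    qed
    moreover obtain S where S: "S \<in> A"
      "\<And>F. cfunctional F \<Longrightarrow> contour_integral \<gamma> (\<lambda>z. f z * F (?R z)) = F S"
      using contour_integral_resolvent[OF a W \<gamma> f] by blast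
    moreover have "integral {0..1} ?h = S"
      by (rule cfunctional_separates) (simp only: FI S)
    ultimately have "integral {0..1} ?h = scalar_op 0 + S" "S \<in> V" by auto
    then show ?thesis unfolding unitization_def by blast
  next
    case True
    \<comment> \<open>W avoids the spectrum, hence also l, so the weights \<open>g n\<close> are
      holomorphic on W.\<close>
    then have l: "z - l \<noteq> 0" if "z \<in> W" for z using that W by auto
    define g where "g n z = f z / (z - l) ^ n" for n :: nat and z
    have g: "g n holomorphic_on W" for n
      unfolding g_def using l by (intro holomorphic_intros f) auto
    have gi: "g n contour_integrable_on \<gamma>" for n
      by (rule contour_integrable_holomorphic_simple[OF g W(1) \<gamma>])
    obtain S where S: "S \<in> A"
      "\<And>F. cfunctional F \<Longrightarrow> contour_integral \<gamma> (\<lambda>z. g 2 z * F (?R z)) = F S"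
      using contour_integral_resolvent[OF a W \<gamma> g] by blast
    let ?c = "\<lambda>n. contour_integral \<gamma> (g n)"
    let ?X = "scalar_op (?c 1) + ((scalar_op (?c 2) o\<^sub>L x) + (x o\<^sub>L S o\<^sub>L x))"
    have "integral {0..1} ?h = ?X"
    proof (rule cfunctional_separates)
      fix F :: "('k \<Rightarrow>\<^sub>L 'k) \<Rightarrow> complex"
      assume F: "cfunctional F"
      let ?G = "\<lambda>X. F (x o\<^sub>L X o\<^sub>L x)"
      have G: "cfunctional ?G" by (rule cfunctional_sandwich[OF F A_cblin[OF xA]])
      \<comment> \<open>Both forms of the resolvent equation, mR = 1 + xR and mR = 1 + Rx, are used
        in turn; the second one, multiplied by x from the left, encloses R between two factors
        x.\<close>
      have dec: "f z * F (?R z) = F id_blinfun * g 1 z + F x * g 2 z + g 2 z * ?G (?R z)" if z: "z \<in> W" for z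
      proof -
        have zs: "z \<notin> op_spectrum a" using z W by blast
        note R = resolvent[OF a zs]
        define m where "m = z - l"
        have m: "m \<noteq> 0" unfolding m_def by (rule l[OF z])
        have za: "scalar_op z - a = scalar_op m - x" by (simp add: a_def m_def scalar_op_diff)
        have 1: "scalar_op m o\<^sub>L ?R z = id_blinfun + (x o\<^sub>L ?R z)"
          using R(2) by (simp add: za o_diff_left algebra_simps)
        have 2: "scalar_op m o\<^sub>L ?R z = id_blinfun + (?R z o\<^sub>L x)"
          using R(3) by (simp add: za o_diff_right algebra_simps cblin_scalar_commute[OF A_cblin[OF R(1)]])
        have e1: "m * F (?R z) = F id_blinfun + F (x o\<^sub>L ?R z)"
          using arg_cong[OF 1, of F] by (simp add: cfunctional_scalar[OF F] cfunctional_add[OF F])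
        have "scalar_op m o\<^sub>L (x o\<^sub>L ?R z) = x o\<^sub>L (scalar_op m o\<^sub>L ?R z)"
          by (rule cblin_scalar_left_commute[OF A_cblin[OF xA], symmetric])
        also have "\<dots> = x + (x o\<^sub>L ?R z o\<^sub>L x)" by (simp add: 2 o_add_right blinfun_compose_assoc)
        finally have e2: "m * F (x o\<^sub>L ?R z) = F x + ?G (?R z)"
          using cfunctional_scalar[OF F, of m "x o\<^sub>L ?R z"] by (simp add: cfunctional_add[OF F])
        have "F (?R z) = F id_blinfun / m + F (x o\<^sub>L ?R z) / m"
          using e1 m by (simp add: field_simps)
        also have "F (x o\<^sub>L ?R z) = (F x + ?G (?R z)) / m" using e2 m by (simp add: field_simps)
        finally show ?thesis
          using m by (simp add: g_def power2_eq_square add_divide_distrib distrib_left mult_ac flip: m_def)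
      qed
      have "(\<lambda>z. g 2 z * ?G (?R z)) contour_integrable_on \<gamma>"
        by (rule contour_integrable_holomorphic_simple[OF _ W(1) \<gamma>])
           (intro holomorphic_intros g cfunctional_resolvent_holomorphic[OF a W(2) G])
      moreover have "(\<lambda>z. F id_blinfun * g 1 z) contour_integrable_on \<gamma>" "(\<lambda>z. F x * g 2 z) contour_integrable_on \<gamma>"
        by (intro contour_integrable_lmul gi)+
      moreover have "contour_integral \<gamma> (\<lambda>z. f z * F (?R z)) =
          contour_integral \<gamma> (\<lambda>z. F id_blinfun * g 1 z + F x * g 2 z + g 2 z * ?G (?R z))"
        by (rule contour_integral_cong) (use dec \<gamma> in auto)
      ultimately have "contour_integral \<gamma> (\<lambda>z. f z * F (?R z)) =
          F id_blinfun * ?c 1 + F x * ?c 2 + ?G S"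
        by (simp add: contour_integral_add contour_integral_lmul gi S(2)[OF G] contour_integrable_add)
      moreover have "F (scalar_op (?c 1)) = ?c 1 * F id_blinfun"
        using cfunctional_scalar[OF F, of "?c 1" id_blinfun] by simp
      ultimately show "F (integral {0..1} ?h) = F ?X"
        by (simp add: FI[OF F] cfunctional_add[OF F] cfunctional_scalar[OF F])
    qed
    moreover have "(scalar_op (?c 2) o\<^sub>L x) + (x o\<^sub>L S o\<^sub>L x) \<in> V"
      by (intro op_subspace_add[OF V(1)] op_subspace_scalar[OF V(1)] sand x S(1))
    ultimately show ?thesis unfolding unitization_def by blast
  qed
qed

lemma semi_ideal_hol_calculus:
  assumes sI: "semi_ideal A V"
  shows "closed_under_hol_calculus V"
  unfolding closed_under_hol_calculus_def
proof (intro conjI ballI allI impI semi_ideal_subalgebra[OF sI])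
  fix a U f b
  assume "a \<in> unitization V"
    and U: "open U \<and> op_spectrum a \<subseteq> U \<and> f holomorphic_on U \<and> hol_calculus a U f b"
  then obtain l x where ax: "a = scalar_op l + x" "x \<in> V" by (auto simp: unitization_def)
  obtain \<Gamma> where \<Gamma>: "surrounds \<Gamma> (op_spectrum a) U" and b: "b = dunford_integral f \<Gamma> a"
    using U by (auto simp: hol_calculus_def)
  have V: "op_subspace V" "V \<subseteq> A" using sI by (auto simp: semi_ideal_def)
  have "a \<in> A" unfolding ax by (intro op_subspace_add[OF A_subspace] A_scalar) (use ax V in blast)
  \<comment> \<open>The paths of a surrounding cycle run in this set.\<close>
  then have "open (U - op_spectrum a)"
    using U open_resolvent_set[OF A_cblin, of a] by (auto simp: Diff_eq)
  moreover have "f holomorphic_on U - op_spectrum a" using U holomorphic_on_subset by blast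
  ultimately have mem: "integral {0..1} (\<lambda>t. scalar_op (f (\<gamma> t) * vector_derivative \<gamma> (at t within {0..1})) o\<^sub>L
      op_resolvent a (\<gamma> t)) \<in> unitization V" if "\<gamma> \<in> set \<Gamma>" for \<gamma>
    using \<Gamma> that
    by (intro dunford_path_integral_in_unitization[OF sI ax(2,1), of "U - op_spectrum a"])
       (auto simp: surrounds_def)
  note UV = op_subspace_unitization[OF V(1)]
  have sum: "sum_list (map G xs) \<in> unitization V"
    if "\<And>\<gamma>. \<gamma> \<in> set xs \<Longrightarrow> G \<gamma> \<in> unitization V" for G and xs :: "(real \<Rightarrow> complex) list"
    using that by (induction xs) (auto intro: op_subspace_0[OF UV] op_subspace_add[OF UV])
  then show "b \<in> unitization V"
    unfolding b dunford_integral_def by (intro op_subspace_scalar[OF UV] sum mem)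
qed


section \<open>Topological properties of \<open>J\<^sub>k\<close>\<close>

text \<open>Treats finite k and \<infinity> alike: the levels intersected are those that occur in
  the index set of the norms.\<close>

lemma J_space_eq: "J_space A TT k = (\<Inter>n\<in>snd ` J_index k. J n)"
  by (cases k) (auto simp: J_space_def J_index_def image_iff)

lemma J_space_subset: "i \<in> J_index k \<Longrightarrow> J_space A TT k \<subseteq> J (snd i)"
  unfolding J_space_eq by blast

lemma J_index_ge1: "i \<in> J_index k \<Longrightarrow> 1 \<le> fst i"
  by (cases k) (auto simp: J_index_def)

lemma J_index_fst: "i \<in> J_index k \<Longrightarrow> 1 \<le> j \<Longrightarrow> (j, snd i) \<in> J_index k"
  by (cases k) (auto simp: J_index_def)

lemma J_index_nonempty: "J_index k \<noteq> {}"
  by (cases k) (auto simp: J_index_def)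

abbreviation "pp \<equiv> \<lambda>(j, n). p j n"

lemma J_space_subspace: "op_subspace (J_space A TT k)"
proof -
  have *: "op_subspace (\<Inter>n\<in>I. J n)" if "I \<noteq> {}" for I
    unfolding op_subspace_def
    using that op_subspace_cblin[OF J_subspace] op_subspace_0[OF J_subspace]
      op_subspace_add[OF J_subspace] op_subspace_scalar[OF J_subspace] by auto
  show ?thesis unfolding J_space_eq by (rule *) (use J_index_nonempty in blast)
qed

lemma pp_seminorm:
  assumes "i \<in> J_index k"
  shows "seminorm_on (J_space A TT k) (pp i)"
  using seminorm_on_subset[OF p_seminorm[OF J_index_ge1[OF assms]] J_space_subset[OF assms]]
  by (simp add: case_prod_beta)

lemma J_space_semi_ideal: "semi_ideal A (J_space A TT k)"
  unfolding semi_ideal_def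
proof (intro conjI ballI J_space_subspace)
  show "J_space A TT k \<subseteq> A" using J_space_subset J_subset_A J_index_nonempty by blast
  fix x y a assume x: "x \<in> J_space A TT k" and y: "y \<in> J_space A TT k" and a: "a \<in> A"
  have "x o\<^sub>L a o\<^sub>L y \<in> J n" if "n \<in> snd ` J_index k" for n
    using J_sandwich[OF a, of x n y] x y that unfolding J_space_eq by blast
  then show "x o\<^sub>L a o\<^sub>L y \<in> J_space A TT k" unfolding J_space_eq by blast
qed

lemma pp_mult:
  assumes i: "i \<in> J_index k" and "x \<in> J_space A TT k" "y \<in> J_space A TT k"
  shows "pp i (x o\<^sub>L y) \<le> pp i x * pp i y"
  using J_mult(2)[of x "snd i" y "fst i"] J_space_subset[OF i] J_index_ge1[OF i] assms
  by (auto simp: case_prod_beta)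

lemma pp_submult: "submult_seminorms (J_space A TT k) (J_index k) pp"
  unfolding submult_seminorms_def
  by (intro conjI ballI pp_seminorm pp_mult J_index_nonempty) simp_all

text \<open>For k = \<infinity> every level yields a limit of its own. All of them are limits of s
  in the operator norm, so they coincide and lie in every level.\<close>

lemma J_space_complete: "complete_seminorms (J_space A TT k) (J_index k) pp"
  unfolding complete_seminorms_def
proof (intro allI impI)
  fix s :: "nat \<Rightarrow> _"
  assume s: "(\<forall>n. s n \<in> J_space A TT k) \<and>
    (\<forall>i\<in>J_index k. \<forall>e>0. \<exists>N. \<forall>m\<ge>N. \<forall>n\<ge>N. pp i (s m - s n) < e)"
  have sJ: "s m \<in> J n" if "n \<in> snd ` J_index k" for m n
    using s that by (auto simp: J_space_eq)
  have "\<exists>x\<in>J n. \<forall>j\<in>{1..}. (\<lambda>m. p j n (s m - x)) \<longlonglongrightarrow> 0" if n: "n \<in> snd ` J_index k" for n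
  proof -
    have "(j, n) \<in> J_index k" if "1 \<le> j" for j using n J_index_fst that by fastforce
    then have "\<forall>j\<in>{1..}. \<forall>e>0. \<exists>N. \<forall>m\<ge>N. \<forall>m'\<ge>N. p j n (s m - s m') < e" using s by fastforce
    then show ?thesis using J_complete[of n] sJ[OF n] unfolding complete_seminorms_def by blast
  qed
  then obtain x where x: "\<And>n. n \<in> snd ` J_index k \<Longrightarrow> x n \<in> J n"
    "\<And>n j. n \<in> snd ` J_index k \<Longrightarrow> 1 \<le> j \<Longrightarrow> (\<lambda>m. p j n (s m - x n)) \<longlonglongrightarrow> 0"
    by (metis atLeast_iff)
  have lim: "s \<longlonglongrightarrow> x n" if n: "n \<in> snd ` J_index k" for n
  proof -
    have "(\<lambda>m. norm (s m - x n)) \<longlonglongrightarrow> 0"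
      by (rule tendsto_sandwich[of "\<lambda>_. 0" _ _ "\<lambda>m. p 1 n (s m - x n)"])
         (use norm_le_p op_subspace_diff[OF J_subspace sJ[OF n] x(1)[OF n]] x(2)[OF n] in auto)
    then show ?thesis by (simp add: tendsto_norm_zero_iff LIM_zero_iff)
  qed
  obtain i0 where i0: "i0 \<in> J_index k" using J_index_nonempty by blast
  let ?x = "x (snd i0)"
  have xe: "x n = ?x" if "n \<in> snd ` J_index k" for n
    using LIMSEQ_unique[OF lim[OF that] lim] i0 by blast
  have "?x \<in> J_space A TT k" unfolding J_space_eq using x(1) xe by fastforce
  moreover have "(\<lambda>n. pp i (s n - ?x)) \<longlonglongrightarrow> 0" if i: "i \<in> J_index k" for i
    using x(2)[of "snd i" "fst i"] i J_index_ge1[OF i] xe[of "snd i"] by (simp add: case_prod_beta)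
  ultimately show "\<exists>x\<in>J_space A TT k. \<forall>i\<in>J_index k. (\<lambda>n. pp i (s n - x)) \<longlonglongrightarrow> 0" by blast
qed

lemma J_frechet: "submult_frechet_algebra (J_space A TT k) (J_topology A nrm TT k)"
proof -
  obtain i where i: "i \<in> J_index k" using J_index_nonempty by blast
  \<comment> \<open>This index supplies the seminorm that dominates the operator norm.\<close>
  have i1: "(1, snd i) \<in> J_index k" by (rule J_index_fst[OF i]) simp
  show ?thesis
    unfolding J_topology_def
    by (rule submult_frechet_algebraI[OF semi_ideal_subalgebra[OF J_space_semi_ideal] pp_submult
          J_space_complete i1]) (use norm_le_p J_space_subset[OF i] in auto)
qed

lemma topspace_J: "topspace (J_topology A nrm TT k) = J_space A TT k"
  unfolding J_topology_def by (rule topspace_seminorm_topology[OF J_index_nonempty])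

lemma pp_0: "i \<in> J_index k \<Longrightarrow> pp i 0 = 0"
  by (rule seminorm_on_0[OF J_space_subspace pp_seminorm])

lemma pp_diff_nonneg:
  "i \<in> J_index k \<Longrightarrow> x \<in> J_space A TT k \<Longrightarrow> y \<in> J_space A TT k \<Longrightarrow> 0 \<le> pp i (x - y)"
  by (intro seminorm_on_nonneg[OF pp_seminorm] op_subspace_diff[OF J_space_subspace])

lemma J_topology_tendsto:
  assumes "continuous_map X (J_topology A nrm TT k) g" "i \<in> J_index k" "z \<in> topspace X"
  shows "((\<lambda>w. pp i (g w - g z)) \<longlongrightarrow> 0) (atin X z)"
  by (rule seminorm_topology_tendsto[where V = "J_space A TT k",
        OF assms(1)[unfolded J_topology_def] assms(2,3) pp_0[OF assms(2)] pp_diff_nonneg[OF assms(2)]])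

lemma J_embedding: "continuous_map (J_topology A nrm TT k) (J_topology A nrm TT 0) (\<lambda>x. x)"
  unfolding J_topology_def[of A nrm TT 0]
proof (rule continuous_map_into_seminorm_topology_bound[OF J_space_subspace J_index_nonempty pp_seminorm])
  show "x \<in> J_space A TT 0" if "x \<in> topspace (J_topology A nrm TT k)" for x
    using that J_space_semi_ideal[of k] unfolding topspace_J
    by (auto simp: semi_ideal_def J_space_def zero_enat_def)
  fix z i assume z: "z \<in> topspace (J_topology A nrm TT k)" and "i \<in> J_index 0"
  then obtain j where i: "i = (j, 0)" "1 \<le> j" by (auto simp: J_index_def zero_enat_def)
  obtain i' where "i' \<in> J_index k" using J_index_nonempty by blast
  then have i': "(j, snd i') \<in> J_index k" using J_index_fst i by blast
  have "pp i (x - z) \<le> pp (j, snd i') (x - z)" if "x \<in> topspace (J_topology A nrm TT k)" for x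
  proof -
    have "x - z \<in> J (snd i')"
      using that z J_space_subset[OF i'] op_subspace_diff[OF J_space_subspace] unfolding topspace_J by auto
    then show ?thesis using p_mono[OF i(2), of _ "snd i'" 0] by (simp add: i)
  qed
  then show "\<exists>e. (e \<longlongrightarrow> 0) (atin (J_topology A nrm TT k) z) \<and>
      (\<forall>x\<in>topspace (J_topology A nrm TT k). pp i (x - z) \<le> e x)"
    using J_topology_tendsto[OF _ i' z, of "\<lambda>x. x"] by auto
qed

lemma Psi_inf_pre_Psi: "a \<in> Psi_inf A TT \<Longrightarrow> a \<in> pre_Psi r"
  using Psi_subset_pre_Psi by (auto simp: Psi_inf_def)

text \<open>Stated for elements of all \<open>pre_Psi r\<close>, so that it applies to differences
  of elements of \<open>Psi_inf A TT\<close>.\<close>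

lemma pre_Psi_J_space_mult:
  assumes a: "\<And>r. a \<in> pre_Psi r" and x: "x \<in> J_space A TT k"
  shows "a o\<^sub>L x \<in> J_space A TT k" and "x o\<^sub>L a \<in> J_space A TT k"
    and "(j, n) \<in> J_index k \<Longrightarrow> p j n (a o\<^sub>L x) \<le> q n j a * p j n x"
    and "(j, n) \<in> J_index k \<Longrightarrow> p j n (x o\<^sub>L a) \<le> p j n x * q n j a"
proof -
  have "x \<in> J n" if "n \<in> snd ` J_index k" for n using x that by (auto simp: J_space_eq)
  then show "a o\<^sub>L x \<in> J_space A TT k" "x o\<^sub>L a \<in> J_space A TT k"
    using Psi_left_mult[OF a] Psi_right_mult[OF a] by (simp_all add: J_space_eq)
  assume i: "(j, n) \<in> J_index k"
  have "x \<in> J n" "1 \<le> j" using J_space_subset[OF i] J_index_ge1[OF i] x by auto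
  then show "p j n (a o\<^sub>L x) \<le> q n j a * p j n x" "p j n (x o\<^sub>L a) \<le> p j n x * q n j a"
    using Psi_left_mult[OF a] Psi_right_mult[OF a] by blast+
qed

lemma J_space_left_mult: "a \<in> Psi_inf A TT \<Longrightarrow> x \<in> J_space A TT k \<Longrightarrow> a o\<^sub>L x \<in> J_space A TT k"
  and J_space_right_mult: "a \<in> Psi_inf A TT \<Longrightarrow> x \<in> J_space A TT k \<Longrightarrow> x o\<^sub>L a \<in> J_space A TT k"
  by (simp_all add: pre_Psi_J_space_mult(1,2) Psi_inf_pre_Psi)

lemma Psi_seminorm_0: "i \<in> UNIV \<times> {1..} \<Longrightarrow> (case i of (r, j) \<Rightarrow> q r j) 0 = 0"
  by (auto simp: q_0)

lemma Psi_seminorm_diff_nonneg: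
  assumes "i \<in> UNIV \<times> {1..}" "a \<in> Psi_inf A TT" "b \<in> Psi_inf A TT"
  shows "0 \<le> (case i of (r, j) \<Rightarrow> q r j) (a - b)"
  using assms q_nonneg[OF _ pre_Psi_diff[OF Psi_inf_pre_Psi Psi_inf_pre_Psi]] by auto

text \<open>The seminorm (j, n) of the product is controlled by the seminorm (n, j) of the left
  factor and (j, n) of the right one; on the side of \<open>Psi_norm\<close> the order comes first
  in the index.\<close>

lemma Psi_J_continuous:
  "continuous_map (prod_topology (Psi_inf_topology A nrm TT) (J_topology A nrm TT k))
     (J_topology A nrm TT k) (\<lambda>(a, x). a o\<^sub>L x)"
  unfolding J_topology_def Psi_inf_topology_def
proof (rule continuous_map_bilinear[where ?q1.0 = "\<lambda>(r, j). q r j" and ?q2.0 = pp])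
  let ?q = "\<lambda>(r, j). q r j"
  fix i assume i: "i \<in> J_index k"
  obtain j n where ie: "i = (j, n)" by fastforce
  have j: "1 \<le> j" using J_index_ge1[OF i] ie by simp
  have key: "p j n (u o\<^sub>L y) \<le> q n j u * p j n y \<and> u o\<^sub>L y \<in> J_space A TT k"
    if "\<And>r. u \<in> pre_Psi r" "y \<in> J_space A TT k" for u y
    using pre_Psi_J_space_mult[OF that] i ie by blast
  show "\<exists>i1\<in>UNIV \<times> {1..}. \<exists>i2\<in>J_index k. \<forall>x\<in>Psi_inf A TT. \<forall>x'\<in>Psi_inf A TT.
      \<forall>y\<in>J_space A TT k. \<forall>y'\<in>J_space A TT k.
        pp i ((x - x') o\<^sub>L (y - y')) \<le> ?q i1 (x - x') * pp i2 (y - y') \<and>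
        pp i ((x - x') o\<^sub>L y') \<le> ?q i1 (x - x') * pp i2 y' \<and>
        pp i (x' o\<^sub>L (y - y')) \<le> ?q i1 x' * pp i2 (y - y') \<and>
        (x - x') o\<^sub>L (y - y') \<in> J_space A TT k \<and> (x - x') o\<^sub>L y' \<in> J_space A TT k \<and>
        x' o\<^sub>L (y - y') \<in> J_space A TT k"
  proof (rule bexI[of _ "(n, j)"], rule bexI[of _ "(j, n)"], intro ballI)
    fix x x' y y'
    assume x: "x \<in> Psi_inf A TT" "x' \<in> Psi_inf A TT" and y: "y \<in> J_space A TT k" "y' \<in> J_space A TT k"
    note dx = pre_Psi_diff[OF Psi_inf_pre_Psi[OF x(1)] Psi_inf_pre_Psi[OF x(2)]]
      and dy = op_subspace_diff[OF J_space_subspace y]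
    show "pp i ((x - x') o\<^sub>L (y - y')) \<le> ?q (n, j) (x - x') * pp (j, n) (y - y') \<and>
        pp i ((x - x') o\<^sub>L y') \<le> ?q (n, j) (x - x') * pp (j, n) y' \<and>
        pp i (x' o\<^sub>L (y - y')) \<le> ?q (n, j) x' * pp (j, n) (y - y') \<and>
        (x - x') o\<^sub>L (y - y') \<in> J_space A TT k \<and> (x - x') o\<^sub>L y' \<in> J_space A TT k \<and>
        x' o\<^sub>L (y - y') \<in> J_space A TT k"
      using key[OF dx dy] key[OF dx y(2)] key[OF Psi_inf_pre_Psi[OF x(2)] dy] by (simp add: ie)
  qed (use i j ie in auto)
next
  show "a o\<^sub>L x \<in> J_space A TT k" if "a \<in> Psi_inf A TT" "x \<in> J_space A TT k" for a x
    using that by (simp add: J_space_left_mult)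
next
  show "op_subspace (J_space A TT k)" by (rule J_space_subspace)
  show "J_index k \<noteq> {}" by (rule J_index_nonempty)
  then show "J_index k \<noteq> {}" .
  show "seminorm_on (J_space A TT k) (pp i)" if "i \<in> J_index k" for i by (rule pp_seminorm[OF that])
  show "(UNIV \<times> {1..} :: (nat \<times> nat) set) \<noteq> {}" by blast
  show "(case i of (r, j) \<Rightarrow> q r j) 0 = 0" if "i \<in> UNIV \<times> {1..}" for i
    by (rule Psi_seminorm_0[OF that])
  show "0 \<le> (case i of (r, j) \<Rightarrow> q r j) (a - b)"
    if "i \<in> UNIV \<times> {1..}" "a \<in> Psi_inf A TT" "b \<in> Psi_inf A TT" for i a b
    by (rule Psi_seminorm_diff_nonneg[OF that])
  show "pp i 0 = 0" if "i \<in> J_index k" for i by (rule pp_0[OF that])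
  show "0 \<le> pp i (x - y)" if "i \<in> J_index k" "x \<in> J_space A TT k" "y \<in> J_space A TT k" for i x y
    by (rule pp_diff_nonneg[OF that])
qed

lemma J_Psi_continuous:
  "continuous_map (prod_topology (J_topology A nrm TT k) (Psi_inf_topology A nrm TT))
     (J_topology A nrm TT k) (\<lambda>(x, a). x o\<^sub>L a)"
  unfolding J_topology_def Psi_inf_topology_def
proof (rule continuous_map_bilinear[where ?q1.0 = pp and ?q2.0 = "\<lambda>(r, j). q r j"])
  let ?q = "\<lambda>(r, j). q r j"
  fix i assume i: "i \<in> J_index k"
  obtain j n where ie: "i = (j, n)" by fastforce
  have j: "1 \<le> j" using J_index_ge1[OF i] ie by simp
  have key: "p j n (y o\<^sub>L u) \<le> p j n y * q n j u \<and> y o\<^sub>L u \<in> J_space A TT k"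
    if "\<And>r. u \<in> pre_Psi r" "y \<in> J_space A TT k" for u y
    using pre_Psi_J_space_mult[OF that] i ie by blast
  show "\<exists>i1\<in>J_index k. \<exists>i2\<in>UNIV \<times> {1..}. \<forall>y\<in>J_space A TT k. \<forall>y'\<in>J_space A TT k.
      \<forall>x\<in>Psi_inf A TT. \<forall>x'\<in>Psi_inf A TT.
        pp i ((y - y') o\<^sub>L (x - x')) \<le> pp i1 (y - y') * ?q i2 (x - x') \<and>
        pp i ((y - y') o\<^sub>L x') \<le> pp i1 (y - y') * ?q i2 x' \<and>
        pp i (y' o\<^sub>L (x - x')) \<le> pp i1 y' * ?q i2 (x - x') \<and>
        (y - y') o\<^sub>L (x - x') \<in> J_space A TT k \<and> (y - y') o\<^sub>L x' \<in> J_space A TT k \<and>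
        y' o\<^sub>L (x - x') \<in> J_space A TT k"
  proof (rule bexI[of _ "(j, n)"], rule bexI[of _ "(n, j)"], intro ballI)
    fix y y' x x'
    assume x: "x \<in> Psi_inf A TT" "x' \<in> Psi_inf A TT" and y: "y \<in> J_space A TT k" "y' \<in> J_space A TT k"
    note dx = pre_Psi_diff[OF Psi_inf_pre_Psi[OF x(1)] Psi_inf_pre_Psi[OF x(2)]]
      and dy = op_subspace_diff[OF J_space_subspace y]
    show "pp i ((y - y') o\<^sub>L (x - x')) \<le> pp (j, n) (y - y') * ?q (n, j) (x - x') \<and>
        pp i ((y - y') o\<^sub>L x') \<le> pp (j, n) (y - y') * ?q (n, j) x' \<and>
        pp i (y' o\<^sub>L (x - x')) \<le> pp (j, n) y' * ?q (n, j) (x - x') \<and>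
        (y - y') o\<^sub>L (x - x') \<in> J_space A TT k \<and> (y - y') o\<^sub>L x' \<in> J_space A TT k \<and>
        y' o\<^sub>L (x - x') \<in> J_space A TT k"
      using key[OF dx dy] key[OF Psi_inf_pre_Psi[OF x(2)] dy] key[OF dx y(2)] by (simp add: ie)
  qed (use i j ie in auto)
next
  show "x o\<^sub>L a \<in> J_space A TT k" if "x \<in> J_space A TT k" "a \<in> Psi_inf A TT" for a x
    using that by (simp add: J_space_right_mult)
next
  show "op_subspace (J_space A TT k)" by (rule J_space_subspace)
  show "J_index k \<noteq> {}" by (rule J_index_nonempty)
  then show "J_index k \<noteq> {}" .
  show "seminorm_on (J_space A TT k) (pp i)" if "i \<in> J_index k" for i by (rule pp_seminorm[OF that])
  show "(UNIV \<times> {1..} :: (nat \<times> nat) set) \<noteq> {}" by blast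
  show "(case i of (r, j) \<Rightarrow> q r j) 0 = 0" if "i \<in> UNIV \<times> {1..}" for i
    by (rule Psi_seminorm_0[OF that])
  show "0 \<le> (case i of (r, j) \<Rightarrow> q r j) (a - b)"
    if "i \<in> UNIV \<times> {1..}" "a \<in> Psi_inf A TT" "b \<in> Psi_inf A TT" for i a b
    by (rule Psi_seminorm_diff_nonneg[OF that])
  show "pp i 0 = 0" if "i \<in> J_index k" for i by (rule pp_0[OF that])
  show "0 \<le> pp i (x - y)" if "i \<in> J_index k" "x \<in> J_space A TT k" "y \<in> J_space A TT k" for i x y
    by (rule pp_diff_nonneg[OF that])
qed

lemma sandwich_continuous:
  "continuous_map
     (prod_topology (J_topology A nrm TT k)
        (prod_topology (seminorm_topology A {1..} nrm) (J_topology A nrm TT k)))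
     (J_topology A nrm TT k) (\<lambda>(x, a, y). x o\<^sub>L a o\<^sub>L y)"
    (is "continuous_map ?X _ ?f")
proof -
  have "continuous_map ?X (seminorm_topology (J_space A TT k) (J_index k) pp) ?f"
  proof (rule continuous_map_into_seminorm_topology_bound[OF J_space_subspace J_index_nonempty pp_seminorm])
    have ts: "topspace ?X = J_space A TT k \<times> (A \<times> J_space A TT k)"
      by (simp add: topspace_J topspace_seminorm_topology)
    have sand: "x o\<^sub>L a o\<^sub>L y \<in> J_space A TT k" if "x \<in> J_space A TT k" "y \<in> J_space A TT k" "a \<in> A" for x y a
      using J_space_semi_ideal that by (auto simp: semi_ideal_def)
    show "?f z \<in> J_space A TT k" if "z \<in> topspace ?X" for z
      using that sand unfolding ts by auto
    fix z i assume z: "z \<in> topspace ?X" and i: "i \<in> J_index k"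
    obtain x' a' y' where ze: "z = (x', a', y')" and z': "x' \<in> J_space A TT k" "a' \<in> A" "y' \<in> J_space A TT k"
      using z unfolding ts by auto
    let ?N = "nrm (fst i)" and ?P = "pp i"
    have j: "1 \<le> fst i" by (rule J_index_ge1[OF i])
    note sn = nrm_seminorm[OF j] and pn = pp_seminorm[OF i]
    have bound: "?P (x o\<^sub>L a o\<^sub>L y) \<le> ?P x * ?N a * ?P y"
      if "x \<in> J_space A TT k" "y \<in> J_space A TT k" "a \<in> A" for x y a
      using J_sandwich[OF that(3), of x "snd i" y] J_space_subset[OF i] that j by (auto simp: case_prod_beta)
    have t1: "((\<lambda>w. ?P (fst w - fst z)) \<longlongrightarrow> 0) (atin ?X z)"
      by (rule J_topology_tendsto[OF continuous_map_fst i z])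
    have t2: "((\<lambda>w. ?N (fst (snd w) - fst (snd z))) \<longlongrightarrow> 0) (atin ?X z)"
      by (rule seminorm_topology_tendsto[where V = A and I = "{1..}" and q = nrm])
         (use z j seminorm_on_0[OF A_subspace sn] seminorm_on_nonneg[OF sn] op_subspace_diff[OF A_subspace]
             continuous_map_compose[OF continuous_map_snd continuous_map_fst, unfolded o_def]
           in \<open>simp_all\<close>)
    have t3: "((\<lambda>w. ?P (snd (snd w) - snd (snd z))) \<longlongrightarrow> 0) (atin ?X z)"
      by (rule J_topology_tendsto[OF _ i z])
         (rule continuous_map_compose[OF continuous_map_snd continuous_map_snd, unfolded o_def])
    \<comment> \<open>Bound for the telescoped difference (x - x')ay + x'(a - a')y + x'a'(y - y').
      The varying a and y are estimated by their distances from a' and y' plus fixed values, so e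
      depends on w only through quantities that tend to 0.\<close>
    define e where "e w = ?P (fst w - x') * (?N (fst (snd w) - a') + ?N a') * (?P (snd (snd w) - y') + ?P y')
      + ?P x' * ?N (fst (snd w) - a') * (?P (snd (snd w) - y') + ?P y')
      + ?P x' * ?N a' * ?P (snd (snd w) - y')" for w
    have "(e \<longlongrightarrow> 0 * (0 + ?N a') * (0 + ?P y') + ?P x' * 0 * (0 + ?P y') + ?P x' * ?N a' * 0) (atin ?X z)"
      unfolding e_def using t1 t2 t3 by (intro tendsto_intros) (simp_all add: ze)
    moreover have "?P (?f w - ?f z) \<le> e w" if w: "w \<in> topspace ?X" for w
    proof -
      obtain x a y where we: "w = (x, a, y)" and w': "x \<in> J_space A TT k" "a \<in> A" "y \<in> J_space A TT k"
        using w unfolding ts by auto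
      note D = op_subspace_diff[OF J_space_subspace] and DA = op_subspace_diff[OF A_subspace]
      have n: "0 \<le> ?P (x - x')" "0 \<le> ?P x'" "0 \<le> ?P y" "0 \<le> ?N (a - a')" "0 \<le> ?N a" "0 \<le> ?N a'"
        by (intro seminorm_on_nonneg[OF pn] seminorm_on_nonneg[OF sn] D DA w' z')+
      have Na: "?N a \<le> ?N (a - a') + ?N a'"
        using seminorm_on_add[OF sn DA[OF w'(2) z'(2)] z'(2)] by simp
      have Py: "?P y \<le> ?P (y - y') + ?P y'"
        using seminorm_on_add[OF pn D[OF w'(3) z'(3)] z'(3)] by simp
      let ?u = "(x - x') o\<^sub>L a o\<^sub>L y" and ?v = "x' o\<^sub>L (a - a') o\<^sub>L y" and ?w = "x' o\<^sub>L a' o\<^sub>L (y - y')"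
      have uvw: "?u \<in> J_space A TT k" "?v \<in> J_space A TT k" "?w \<in> J_space A TT k"
        by (intro sand D DA w' z')+
      have "?f w - ?f z = ?u + ?v + ?w"
        by (simp add: we ze o_diff_left o_diff_right)
      then have "?P (?f w - ?f z) \<le> ?P ?u + ?P ?v + ?P ?w"
        using seminorm_on_add[OF pn uvw(1,2)]
          seminorm_on_add[OF pn op_subspace_add[OF J_space_subspace uvw(1,2)] uvw(3)] by simp
      moreover have "?P ?u \<le> ?P (x - x') * (?N (a - a') + ?N a') * (?P (y - y') + ?P y')"
        by (rule order_trans[OF bound[OF D[OF w'(1) z'(1)] w'(3) w'(2)]])
           (intro mult_mono Na Py n mult_nonneg_nonneg order_refl add_nonneg_nonneg)
      moreover have "?P ?v \<le> ?P x' * ?N (a - a') * (?P (y - y') + ?P y')"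
        by (rule order_trans[OF bound[OF z'(1) w'(3) DA[OF w'(2) z'(2)]]])
           (intro mult_left_mono Py n mult_nonneg_nonneg)
      moreover have "?P ?w \<le> ?P x' * ?N a' * ?P (y - y')"
        by (rule bound[OF z'(1) D[OF w'(3) z'(3)] z'(2)])
      ultimately show ?thesis by (simp add: e_def we)
    qed
    ultimately show "\<exists>e. (e \<longlongrightarrow> 0) (atin ?X z) \<and> (\<forall>w\<in>topspace ?X. ?P (?f w - ?f z) \<le> e w)"
      by auto
  qed
  then show ?thesis by (simp only: J_topology_def)
qed

end

theorem theorem3:
  fixes A :: "('k::complex_hilbert \<Rightarrow>\<^sub>L 'k) set"
    and nrm :: "nat \<Rightarrow> ('k \<Rightarrow>\<^sub>L 'k) \<Rightarrow> real"
    and TT :: "('k \<rightharpoonup> 'k) set"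
    and k :: enat
  assumes "submult_psi_star_algebra A {1..} nrm"
    and "\<forall>a\<in>A. nrm 1 a = norm a"
    and "finite TT"
    and "\<forall>T\<in>TT. clinear_operator T \<and> densely_defined T \<and> closed_operator T \<and> symmetric_operator T"
  shows
    "(submult_frechet_algebra (J_space A TT k) (J_topology A nrm TT k) \<and>
      submult_seminorms (J_space A TT k) (J_index k) (\<lambda>(j, n). J_norm A nrm TT j n) \<and>
      continuous_map (J_topology A nrm TT k) (J_topology A nrm TT 0) (\<lambda>x. x)) \<and>
     ((\<forall>a\<in>Psi_inf A TT. \<forall>x\<in>J_space A TT k.
         (a o\<^sub>L x) \<in> J_space A TT k \<and> (x o\<^sub>L a) \<in> J_space A TT k) \<and>
      continuous_map (prod_topology (Psi_inf_topology A nrm TT) (J_topology A nrm TT k))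
        (J_topology A nrm TT k) (\<lambda>(a, x). a o\<^sub>L x) \<and>
      continuous_map (prod_topology (J_topology A nrm TT k) (Psi_inf_topology A nrm TT))
        (J_topology A nrm TT k) (\<lambda>(x, a). x o\<^sub>L a)) \<and>
     (semi_ideal A (J_space A TT k) \<and>
      closed_under_hol_calculus (J_space A TT k) \<and>
      continuous_map
        (prod_topology (J_topology A nrm TT k)
           (prod_topology (seminorm_topology A {1..} nrm) (J_topology A nrm TT k)))
        (J_topology A nrm TT k) (\<lambda>(x, a, y). x o\<^sub>L a o\<^sub>L y))"
proof -
  interpret psi_star_setting A nrm TT
    by (rule psi_star_setting.intro) (fact assms)+
  note J = J_frechet[of k] pp_submult[of k] J_embedding[of k]
    and Psi = J_space_left_mult[of _ _ k] J_space_right_mult[of _ _ k]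
      Psi_J_continuous[of k] J_Psi_continuous[of k]
    and sI = J_space_semi_ideal[of k] semi_ideal_hol_calculus[OF J_space_semi_ideal[of k]]
      sandwich_continuous[of k]
  show ?thesis using J Psi sI by blast
qed

end
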